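(* Fix $\beta>0$ and $c<0$. Let $\gamma_n\to0^+$ and, for each $n$, let $\psi_n\in G(\beta,c,\gamma_n)$. Then there exist a subsequence (still denoted $\gamma_n,\psi_n$), real numbers $y_n$ and a solution $\psi\in H^{1/2}(\mathbb R)$ of the generalized Benjamin–Ono solitary-wave equation $$-c\psi+\beta\mathcal H\psi'+f(\psi)=0$$ such that $\psi_n(\cdot+y_n)\to\psi$ in $H^{1/2}(\mathbb R)$.
   Context: Fix $p>1$ and a $C^2$ function $f:\mathbb R\to\mathbb R$ homogeneous of degree $p$, i.e. $f(\lambda s)=\lambda^p f(s)$ for all $\lambda>0$ and $s\in\mathbb R$. Let $F$ be the antiderivative of $f$ with $F(0)=0$. Assume $F(s_0)<0$ for some $s_0\in\mathbb R$. The operators are defined as follows. $\mathcal H$ is the Hilbert transform (Fourier symbol $-i\,\mathrm{sgn}\,\xi$). $D_x^{1/2}$ is the Fourier multiplier with symbol $|\xi|^{1/2}$. $\partial_x^{-1}$ is the Fourier multiplier with symbol $(i\xi)^{-1}$. Let $\mathcal X=\{u\in H^{1/2}(\mathbb R):\partial_x^{-1}u\in L^2(\mathbb R)\}$. Functionals on $\mathcal X$: - $I(u;\beta,c,\gamma)=\int_{\mathbb R}\big(\beta(D_x^{1/2}u)^2-cu^2+\gamma(\partial_x^{-1}u)^2\big)dx$; - $K(u)=-(p+1)\int_{\mathbb R}F(u)\,dx$. For $\beta>0$, $\gamma>0$, $c<3(\beta^2\gamma/4)^{1/3}$, let $$m(\beta,c,\gamma)=\inf\Big\{\frac{I(u;\beta,c,\gamma)}{K(u)^{2/(p+1)}}:\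 u\in\mathcal X,\ K(u)>0\Big\}$$ and $$G(\beta,c,\gamma)=\{\varphi\in\mathcal X:\ K(\varphi)=I(\varphi;\beta,c,\gamma)=m(\beta,c,\gamma)^{(p+1)/(p-1)}\}.$$ This is the set of suitably rescaled minimizers. Its elements solve $\beta\mathcal H\varphi_x-c\varphi+f(\varphi)=\gamma\partial_x^{-2}\varphi$. *)

theory Defs
  imports "HOL-Analysis.Analysis"
begin

definition L2 :: "(real \<Rightarrow> real) \<Rightarrow> bool" where
  "L2 u \<longleftrightarrow> u \<in> borel_measurable lborel \<and> (\<integral>\<^sup>+ x. ennreal ((u x)\<^sup>2) \<partial>lborel) < \<infinity>"

definition fourier_trunc :: "(real \<Rightarrow> real) \<Rightarrow> real \<Rightarrow> real \<Rightarrow> complex" where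
  "fourier_trunc u R \<xi> = (LINT x:{-R..R}|lborel. exp (- \<i> * complex_of_real (\<xi> * x)) * complex_of_real (u x))"

definition is_fourier :: "(real \<Rightarrow> real) \<Rightarrow> (real \<Rightarrow> complex) \<Rightarrow> bool" where
  "is_fourier u g \<longleftrightarrow> L2 u \<and> g \<in> borel_measurable lborel \<and>
     ((\<lambda>R. \<integral>\<^sup>+ \<xi>. ennreal ((cmod (fourier_trunc u R \<xi> - g \<xi>))\<^sup>2) \<partial>lborel) \<longlongrightarrow> 0) at_top"

definition fourier :: "(real \<Rightarrow> real) \<Rightarrow> real \<Rightarrow> complex" where
  "fourier u = (SOME g. is_fourier u g)"

text \<open>H^{1/2}(R) and its norm (normalized so that the L2 part is the L2 norm).\<close>
definition H12 :: "(real \<Rightarrow> real) \<Rightarrow> bool" where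
  "H12 u \<longleftrightarrow> (\<exists>g. is_fourier u g) \<and>
     (\<integral>\<^sup>+ \<xi>. ennreal (\<bar>\<xi>\<bar> * (cmod (fourier u \<xi>))\<^sup>2) \<partial>lborel) < \<infinity>"

definition H12_norm :: "(real \<Rightarrow> real) \<Rightarrow> real" where
  "H12_norm u = sqrt (enn2real (\<integral>\<^sup>+ \<xi>. ennreal ((1 + \<bar>\<xi>\<bar>) * (cmod (fourier u \<xi>))\<^sup>2) \<partial>lborel) / (2 * pi))"

definition Dhalf :: "(real \<Rightarrow> real) \<Rightarrow> real \<Rightarrow> real" where
  "Dhalf u = (SOME w. is_fourier w (\<lambda>\<xi>. complex_of_real (sqrt \<bar>\<xi>\<bar>) * fourier u \<xi>))"

definition hilbert :: "(real \<Rightarrow> real) \<Rightarrow> real \<Rightarrow> real" where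
  "hilbert u = (SOME h. is_fourier h (\<lambda>\<xi>. - \<i> * complex_of_real (sgn \<xi>) * fourier u \<xi>))"

definition has_L2_antideriv :: "(real \<Rightarrow> real) \<Rightarrow> (real \<Rightarrow> real) \<Rightarrow> bool" where
  "has_L2_antideriv u v \<longleftrightarrow> (\<exists>g. is_fourier v g \<and>
      (AE \<xi> in lborel. g \<xi> * (\<i> * complex_of_real \<xi>) = fourier u \<xi>))"

definition dinv :: "(real \<Rightarrow> real) \<Rightarrow> real \<Rightarrow> real" where
  "dinv u = (SOME v. has_L2_antideriv u v)"

definition Xsp :: "(real \<Rightarrow> real) set" where
  "Xsp = {u. H12 u \<and> (\<exists>v. has_L2_antideriv u v)}"

definition Ifun :: "(real \<Rightarrow> real) \<Rightarrow> real \<Rightarrow> real \<Rightarrow> real \<Rightarrow> real" where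
  "Ifun u \<beta> c \<gamma> = (LINT x|lborel. \<beta> * (Dhalf u x)\<^sup>2 - c * (u x)\<^sup>2 + \<gamma> * (dinv u x)\<^sup>2)"

definition Kfun :: "real \<Rightarrow> (real \<Rightarrow> real) \<Rightarrow> (real \<Rightarrow> real) \<Rightarrow> real" where
  "Kfun p F u = - (p + 1) * (LINT x|lborel. F (u x))"

definition mval :: "real \<Rightarrow> (real \<Rightarrow> real) \<Rightarrow> real \<Rightarrow> real \<Rightarrow> real \<Rightarrow> real" where
  "mval p F \<beta> c \<gamma> = Inf {Ifun u \<beta> c \<gamma> / (Kfun p F u) powr (2 / (p + 1)) | u. u \<in> Xsp \<and> Kfun p F u > 0}"

definition Gset :: "real \<Rightarrow> (real \<Rightarrow> real) \<Rightarrow> real \<Rightarrow> real \<Rightarrow> real \<Rightarrow> (real \<Rightarrow> real) set" where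
  "Gset p F \<beta> c \<gamma> = {\<phi> \<in> Xsp. Kfun p F \<phi> = Ifun \<phi> \<beta> c \<gamma> \<and>
      Ifun \<phi> \<beta> c \<gamma> = (mval p F \<beta> c \<gamma>) powr ((p + 1) / (p - 1))}"

definition test_fun :: "(real \<Rightarrow> real) \<Rightarrow> bool" where
  "test_fun \<phi> \<longleftrightarrow> (\<exists>d. d 0 = \<phi> \<and> (\<forall>k x. (d k has_real_derivative d (Suc k) x) (at x)))
      \<and> bounded {x. \<phi> x \<noteq> 0}"

text \<open>Distributional solution of  -c psi + beta H psi' + f(psi) = 0, where
  (H psi')(phi) = - int (H psi) phi'.\<close>
definition BO_solution :: "(real \<Rightarrow> real) \<Rightarrow> real \<Rightarrow> real \<Rightarrow> (real \<Rightarrow> real) \<Rightarrow> bool" where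
  "BO_solution f \<beta> c \<psi> \<longleftrightarrow> (\<forall>\<phi>. test_fun \<phi> \<longrightarrow>
     (LINT x|lborel. (- c * \<psi> x + f (\<psi> x)) * \<phi> x) - \<beta> * (LINT x|lborel. hilbert \<psi> x * deriv \<phi> x) = 0)"

end

(*
The energy Q u = (1 / 2 pi) int (b |xi| - c) |u^|^2 dominates the H^{1/2} norm, and Ifun u b c gamma = Q u + gamma |dinv u|^2.
Cutting off low frequencies shows that Xsp is dense in H^{1/2}, so m(gamma) tends to m0 = inf Q / K^{2/(p+1)} and the psi_n
form a minimizing sequence for the problem without gamma, normalized by Q <= K -> L = m0^{(p+1)/(p-1)}.

The only consequence of Q-boundedness used in physical space is |u(. + h) - u| <= D |h|^{1/2} in L^2. It makes averages over
intervals of length 2^{-k} grow at most linearly in k, which yields the embedding in L^q, q > 2; it excludes vanishing of the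
L^q norm when all averages of a fixed length are small; and it gives almost everywhere convergent subsequences.

Along such a subsequence (after translations, with nonzero limit v) Q splits by weak convergence and K by the Brezis-Lieb
argument. With a = Q v / L the inequality K u <= L (Q u / L)^{(p+1)/2} then forces 1 <= a^{(p+1)/2} + (1 - a)^{(p+1)/2}, so
a = 1, the convergence is strong and v is a minimizer; its Euler-Lagrange equation is the solitary-wave equation.
*)
theory Submission
  imports Defs "HOL-Probability.Probability" "HOL-Complex_Analysis.Great_Picard" "HOL-Real_Asymp.Real_Asymp"
begin

section \<open>Square-integrable functions\<close>

text \<open>Since \<open>\<gamma> n\<close> tends to 0, the term
  \<open>\<gamma> n * (nrm (dinv (\<psi> n)))^2\<close> gives no bound on \<open>dinv\<close>
  uniform in n, and the limit is only known to lie in H^{1/2}. The infimum m0 runs over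
  \<open>Xsp\<close>, so its inequality has to be extended by density before it applies to the limit
  and to the remainders. The sign \<open>c < 0\<close> makes Q coercive without help from the
  \<open>\<gamma>\<close> term.

  Regularity 1/2 on the line is critical: it gives no uniform bound on functions, and averages over
  shrinking intervals may grow. The growth is linear in k, while the part of the function above
  twice the averages at scale 2^{-k} has squared L^2 norm of order 2^{-k}. The geometric factor
  beats every power of k, hence L^q for all finite q > 2.

  The splitting is strict because K has degree q = p + 1 > 2 and Q has degree 2: the exponent q / 2
  exceeds 1, so distributing Q over two pieces loses. Normalizing Q and K to the same limit L
  removes the Lagrange multiplier from the Euler-Lagrange equation.\<close>

definition sqint :: "(real \<Rightarrow> 'a::euclidean_space) \<Rightarrow> bool" where
  "sqint u \<longleftrightarrow> u \<in> borel_measurable lborel \<and> integrable lborel (\<lambda>x. (norm (u x))\<^sup>2)"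

text \<open>The Bochner integral of a non-integrable function is 0, so \<open>nrm\<close> vanishes
  outside L^2. A small value means something only together with \<open>sqint\<close>, which is why
  the two always travel together.\<close>

definition nrm :: "(real \<Rightarrow> 'a::euclidean_space) \<Rightarrow> real" where
  "nrm u = sqrt (LBINT x. (norm (u x))\<^sup>2)"

lemma sqint_meas: "sqint u \<Longrightarrow> u \<in> borel_measurable borel"
  by (simp add: sqint_def)

lemma sqint_int: "sqint u \<Longrightarrow> integrable lborel (\<lambda>x. (norm (u x))\<^sup>2)"
  by (simp add: sqint_def)

lemma nrm_nonneg [simp]: "0 \<le> nrm u"
  by (simp add: nrm_def)

lemma nrm_sq: "(nrm u)\<^sup>2 = (LBINT x. (norm (u x))\<^sup>2)"
  by (simp add: nrm_def)

lemma sqint_bound: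
  fixes u :: "real \<Rightarrow> 'a::euclidean_space" and v :: "real \<Rightarrow> 'b::euclidean_space"
  assumes "sqint v" "u \<in> borel_measurable borel" "AE x in lborel. norm (u x) \<le> norm (v x)"
  shows "sqint u"
  unfolding sqint_def
proof
  show "u \<in> borel_measurable lborel" using assms by simp
  show "integrable lborel (\<lambda>x. (norm (u x))\<^sup>2)"
    apply (rule Bochner_Integration.integrable_bound[OF sqint_int[OF assms(1)]])
    using assms(2) apply simp
    using assms(3) by eventually_elim (simp add: power_mono)
qed

lemma sqint_mult_left: "sqint u \<Longrightarrow> sqint (\<lambda>x. c * u x)" for c :: "'a::{euclidean_space, real_normed_field}"
  by (auto simp: sqint_def power_mult_distrib norm_mult)

lemma sqint_uminus: "sqint u \<Longrightarrow> sqint (\<lambda>x. - u x)"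
  by (auto simp: sqint_def)

lemma norm_add_sq_le: "(norm (a + b))\<^sup>2 \<le> 2 * (norm a)\<^sup>2 + 2 * (norm b)\<^sup>2" for a b :: "'a::real_normed_vector"
proof -
  have "(norm (a + b))\<^sup>2 \<le> (norm a + norm b)\<^sup>2" by (simp add: norm_triangle_ineq power_mono)
  also have "\<dots> \<le> 2 * (norm a)\<^sup>2 + 2 * (norm b)\<^sup>2"
    using sum_squares_bound[of "norm a" "norm b"] by (simp add: power2_sum)
  finally show ?thesis .
qed

lemma sqint_add: assumes "sqint u" "sqint v" shows "sqint (\<lambda>x. u x + v x)"
  unfolding sqint_def
proof
  have [measurable]: "u \<in> borel_measurable borel" "v \<in> borel_measurable borel"
    using assms sqint_meas by auto
  show "(\<lambda>x. u x + v x) \<in> borel_measurable lborel" by simp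
  show "integrable lborel (\<lambda>x. (norm (u x + v x))\<^sup>2)"
    apply (rule Bochner_Integration.integrable_bound[where f="\<lambda>x. 2 * (norm (u x))\<^sup>2 + 2 * (norm (v x))\<^sup>2"])
    using assms by (auto simp: sqint_int norm_add_sq_le)
qed

lemma sqint_diff: assumes "sqint u" "sqint v" shows "sqint (\<lambda>x. u x - v x)"
  using sqint_add[OF assms(1) sqint_uminus[OF assms(2)]] by simp

lemma integrable_norm_prod:
  fixes u :: "real \<Rightarrow> 'a::euclidean_space" and v :: "real \<Rightarrow> 'b::euclidean_space"
  assumes "sqint u" "sqint v" shows "integrable lborel (\<lambda>x. norm (u x) * norm (v x))"
proof (rule Bochner_Integration.integrable_bound[where f="\<lambda>x. (norm (u x))\<^sup>2 + (norm (v x))\<^sup>2"])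
  have [measurable]: "u \<in> borel_measurable borel" "v \<in> borel_measurable borel"
    using assms sqint_meas by auto
  show "integrable lborel (\<lambda>x. (norm (u x))\<^sup>2 + (norm (v x))\<^sup>2)" using assms by (auto simp: sqint_int)
  show "(\<lambda>x. norm (u x) * norm (v x)) \<in> borel_measurable lborel" by simp
  show "AE x in lborel. norm (norm (u x) * norm (v x)) \<le> norm ((norm (u x))\<^sup>2 + (norm (v x))\<^sup>2)"
  proof (rule AE_I2)
    fix x
    have *: "a * b \<le> a\<^sup>2 + b\<^sup>2" if "a \<ge> 0" "b \<ge> 0" for a b :: real
      using sum_squares_bound[of a b] mult_nonneg_nonneg[OF that] by linarith
    show "norm (norm (u x) * norm (v x)) \<le> norm ((norm (u x))\<^sup>2 + (norm (v x))\<^sup>2)"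
      using *[of "norm (u x)" "norm (v x)"] by simp
  qed
qed

lemma integrable_inner:
  assumes "sqint u" "sqint v" shows "integrable lborel (\<lambda>x. u x \<bullet> v x)"
proof (rule Bochner_Integration.integrable_bound[OF integrable_norm_prod[OF assms]])
  have [measurable]: "u \<in> borel_measurable borel" "v \<in> borel_measurable borel"
    using assms sqint_meas by auto
  show "(\<lambda>x. u x \<bullet> v x) \<in> borel_measurable lborel" by simp
qed (simp add: Cauchy_Schwarz_ineq2)

lemma nrm_add_sq:
  assumes "sqint u" "sqint v"
  shows "(nrm (\<lambda>x. u x + v x))\<^sup>2 = (nrm u)\<^sup>2 + 2 * (LBINT x. u x \<bullet> v x) + (nrm v)\<^sup>2"
proof -
  have "(norm (a + b))\<^sup>2 = (norm a)\<^sup>2 + 2 * (a \<bullet> b) + (norm b)\<^sup>2" for a b :: 'a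
    by (simp add: power2_norm_eq_inner inner_add_left inner_add_right inner_commute)
  then have "(nrm (\<lambda>x. u x + v x))\<^sup>2 = (LBINT x. (norm (u x))\<^sup>2 + 2 * (u x \<bullet> v x) + (norm (v x))\<^sup>2)"
    by (simp add: nrm_sq)
  also have "\<dots> = (nrm u)\<^sup>2 + 2 * (LBINT x. u x \<bullet> v x) + (nrm v)\<^sup>2"
    using assms by (simp add: nrm_sq sqint_int integrable_inner)
  finally show ?thesis .
qed

lemma nrm_mult_left: "nrm (\<lambda>x. c * u x) = norm c * nrm u" for c :: "'a::{euclidean_space, real_normed_field}"
  by (simp add: nrm_def power_mult_distrib real_sqrt_mult norm_mult)

lemma nrm_uminus: "nrm (\<lambda>x. - u x) = nrm u"
  by (simp add: nrm_def)

lemma nrm_minus_commute: "nrm (\<lambda>x. u x - v x) = nrm (\<lambda>x. v x - u x)"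
  by (simp add: nrm_def norm_minus_commute)

lemma nrm_of_real: "nrm (\<lambda>x. complex_of_real (u x)) = nrm u"
  by (simp add: nrm_def)

lemma sqint_of_real: "sqint (\<lambda>x. complex_of_real (u x)) \<longleftrightarrow> sqint u"
  unfolding sqint_def borel_measurable_complex_iff by simp

lemma nrm_mono:
  fixes u :: "real \<Rightarrow> 'a::euclidean_space" and v :: "real \<Rightarrow> 'b::euclidean_space"
  assumes "sqint v" "sqint u" "AE x in lborel. norm (u x) \<le> norm (v x)"
  shows "nrm u \<le> nrm v"
  unfolding nrm_def
  apply (rule real_sqrt_le_mono, rule integral_mono_AE[OF sqint_int[OF assms(2)] sqint_int[OF assms(1)]])
  using assms(3) by eventually_elim (simp add: power_mono)

lemma nrm_cong_AE:
  assumes "u \<in> borel_measurable borel" "v \<in> borel_measurable borel" "AE x in lborel. u x = v x"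
  shows "nrm u = nrm v"
  unfolding nrm_def
  by (rule arg_cong[where f=sqrt], rule integral_cong_AE) (use assms in auto)

lemma sqint_cong_AE:
  assumes "sqint u" "v \<in> borel_measurable borel" "AE x in lborel. u x = v x"
  shows "sqint v"
  by (rule sqint_bound[OF assms(1,2)]) (use assms(3) in auto)

text \<open>Integrate y z <= (t y^2 + z^2 / t) / 2 with the optimal constant t, the quotient of the
  norms. Adding e to both norms keeps t positive and finite when one of them vanishes; e tends to 0
  at the end.\<close>

lemma Cauchy_Schwarz_norm:
  fixes u :: "real \<Rightarrow> 'a::euclidean_space" and v :: "real \<Rightarrow> 'b::euclidean_space"
  assumes "sqint u" "sqint v"
  shows "(LBINT x. norm (u x) * norm (v x)) \<le> nrm u * nrm v"
proof -
  have *: "(LBINT x. norm (u x) * norm (v x)) \<le> (nrm u + e) * (nrm v + e)" if e: "e > 0" for e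
  proof -
    let ?a = "nrm u + e" let ?b = "nrm v + e"
    have ab: "?a > 0" "?b > 0" using e by (auto simp: add_nonneg_pos)
    let ?t = "?b / ?a"
    have t: "?t > 0" using ab by simp
    have "(LBINT x. norm (u x) * norm (v x))
        \<le> (LBINT x. (?t * (norm (u x))\<^sup>2 + (norm (v x))\<^sup>2 / ?t) / 2)"
    proof (rule integral_mono)
      show "integrable lborel (\<lambda>x. norm (u x) * norm (v x))" by (rule integrable_norm_prod[OF assms])
      show "integrable lborel (\<lambda>x. (?t * (norm (u x))\<^sup>2 + (norm (v x))\<^sup>2 / ?t) / 2)"
        using assms by (auto simp: sqint_int)
      fix x
      have "y * z \<le> (t * y\<^sup>2 + z\<^sup>2 / t) / 2" if "t > 0" for t y z :: real
      proof -
        have "2 * t * (y * z) \<le> (t * y)\<^sup>2 + z\<^sup>2"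
          using sum_squares_bound[of "t * y" z] by (simp add: mult.assoc)
        also have "\<dots> = 2 * t * ((t * y\<^sup>2 + z\<^sup>2 / t) / 2)"
          using that by (simp add: power2_eq_square distrib_left)
        finally show ?thesis using that by (simp only: mult_le_cancel_left_pos)
      qed
      from this[OF t] show "norm (u x) * norm (v x) \<le> (?t * (norm (u x))\<^sup>2 + (norm (v x))\<^sup>2 / ?t) / 2" .
    qed
    also have "\<dots> = (?t * (nrm u)\<^sup>2 + (nrm v)\<^sup>2 / ?t) / 2"
      using assms by (simp add: sqint_int nrm_sq)
    also have "\<dots> \<le> (?t * ?a\<^sup>2 + ?b\<^sup>2 / ?t) / 2"
      using t e by (intro divide_right_mono add_mono mult_left_mono power_mono) auto
    also have "\<dots> = ?a * ?b"
    proof -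
      have "(b / a * a\<^sup>2 + b\<^sup>2 / (b / a)) / 2 = a * b" if "a > 0" "b > 0" for a b :: real
        using that by (simp add: power2_eq_square)
      then show ?thesis using ab by blast
    qed
    finally show ?thesis .
  qed
  have "((\<lambda>e. (nrm u + e) * (nrm v + e)) \<longlongrightarrow> (nrm u + 0) * (nrm v + 0)) (at_right 0)"
    by (intro tendsto_intros)
  then have "(LBINT x. norm (u x) * norm (v x)) \<le> (nrm u + 0) * (nrm v + 0)"
    by (rule tendsto_lowerbound) (auto simp: eventually_at_right_less * intro: eventually_mono[OF eventually_at_right_less])
  then show ?thesis by simp
qed

lemma Cauchy_Schwarz_inner:
  assumes "sqint u" "sqint v"
  shows "\<bar>LBINT x. u x \<bullet> v x\<bar> \<le> nrm u * nrm v"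
proof -
  have "\<bar>LBINT x. u x \<bullet> v x\<bar> \<le> (LBINT x. norm (u x) * norm (v x))"
    by (rule order_trans[OF integral_abs_bound])
      (intro integral_mono integrable_abs integrable_inner integrable_norm_prod assms, rule Cauchy_Schwarz_ineq2)
  also note Cauchy_Schwarz_norm[OF assms]
  finally show ?thesis .
qed

lemma nrm_triangle:
  assumes "sqint u" "sqint v" shows "nrm (\<lambda>x. u x + v x) \<le> nrm u + nrm v"
proof (rule power2_le_imp_le)
  show "(nrm (\<lambda>x. u x + v x))\<^sup>2 \<le> (nrm u + nrm v)\<^sup>2"
    using nrm_add_sq[OF assms] Cauchy_Schwarz_inner[OF assms] by (simp add: power2_sum)
qed simp

lemma nrm_triangle_diff:
  assumes "sqint u" "sqint v" "sqint w"
  shows "nrm (\<lambda>x. u x - w x) \<le> nrm (\<lambda>x. u x - v x) + nrm (\<lambda>x. v x - w x)"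
  using nrm_triangle[OF sqint_diff[OF assms(1,2)] sqint_diff[OF assms(2,3)]] by simp

lemma nrm_diff_ineq:
  assumes "sqint u" "sqint v" shows "\<bar>nrm u - nrm v\<bar> \<le> nrm (\<lambda>x. u x - v x)"
  using nrm_triangle[OF sqint_diff[OF assms] assms(2)]
    nrm_triangle[OF sqint_diff[OF assms(2,1)] assms(1)] nrm_minus_commute[of u v] by simp

lemma nrm_eq_0_iff: assumes "sqint u" shows "nrm u = 0 \<longleftrightarrow> (AE x in lborel. u x = 0)"
  using integral_nonneg_eq_0_iff_AE[OF sqint_int[OF assms]] by (simp add: nrm_def)

lemma nrm_tendsto:
  assumes "\<And>n. sqint (u n)" "sqint v" "(\<lambda>n. nrm (\<lambda>x. u n x - v x)) \<longlonglongrightarrow> 0"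
  shows "(\<lambda>n. nrm (u n)) \<longlonglongrightarrow> nrm v"
proof (rule LIM_zero_cancel, rule Lim_null_comparison[OF _ assms(3)])
  show "\<forall>\<^sub>F n in sequentially. norm (nrm (u n) - nrm v) \<le> nrm (\<lambda>x. u n x - v x)"
    using nrm_diff_ineq[OF assms(1,2)] by simp
qed

lemma integral_inner_tendsto:
  assumes "\<And>n. sqint (u n)" "sqint v" "(\<lambda>n. nrm (\<lambda>x. u n x - v x)) \<longlonglongrightarrow> 0"
    and "\<And>n. sqint (w n)" "sqint z" "(\<lambda>n. nrm (\<lambda>x. w n x - z x)) \<longlonglongrightarrow> 0"
  shows "(\<lambda>n. LBINT x. u n x \<bullet> w n x) \<longlonglongrightarrow> (LBINT x. v x \<bullet> z x)"
proof (rule LIM_zero_cancel, rule Lim_null_comparison)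
  show "\<forall>\<^sub>F n in sequentially. norm ((LBINT x. u n x \<bullet> w n x) - (LBINT x. v x \<bullet> z x))
     \<le> nrm (\<lambda>x. u n x - v x) * nrm (w n) + nrm v * nrm (\<lambda>x. w n x - z x)"
  proof (rule always_eventually, rule allI)
    fix n
    have "(LBINT x. u n x \<bullet> w n x) - (LBINT x. v x \<bullet> z x)
      = (LBINT x. (u n x - v x) \<bullet> w n x) + (LBINT x. v x \<bullet> (w n x - z x))"
      using assms by (simp add: inner_diff_left inner_diff_right integrable_inner)
    then show "norm ((LBINT x. u n x \<bullet> w n x) - (LBINT x. v x \<bullet> z x))
     \<le> nrm (\<lambda>x. u n x - v x) * nrm (w n) + nrm v * nrm (\<lambda>x. w n x - z x)"
      using Cauchy_Schwarz_inner[OF sqint_diff[OF assms(1)[of n] assms(2)] assms(4)[of n]]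
        Cauchy_Schwarz_inner[OF assms(2) sqint_diff[OF assms(4)[of n] assms(5)]]
      by simp
  qed
  have "(\<lambda>n. nrm (\<lambda>x. u n x - v x) * nrm (w n) + nrm v * nrm (\<lambda>x. w n x - z x))
     \<longlonglongrightarrow> 0 * nrm z + nrm v * 0"
    by (intro tendsto_intros assms nrm_tendsto)
  then show "(\<lambda>n. nrm (\<lambda>x. u n x - v x) * nrm (w n) + nrm v * nrm (\<lambda>x. w n x - z x)) \<longlonglongrightarrow> 0" by simp
qed

lemma nn_integral_sqint:
  assumes "sqint u" shows "(\<integral>\<^sup>+x. ennreal ((norm (u x))\<^sup>2) \<partial>lborel) = ennreal ((nrm u)\<^sup>2)"
  unfolding nrm_sq by (rule nn_integral_eq_integral[OF sqint_int[OF assms]]) simp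

lemma sqint_iff_nn:
  "sqint u \<longleftrightarrow> u \<in> borel_measurable lborel \<and> (\<integral>\<^sup>+x. ennreal ((norm (u x))\<^sup>2) \<partial>lborel) < \<infinity>"
  unfolding sqint_def by (auto simp: integrable_iff_bounded)

text \<open>Fatou's lemma in the extended reals, because membership of the limit in L^2 is part of
  the conclusion.\<close>

lemma sqint_Fatou:
  assumes u: "\<And>n. sqint (u n)" and b: "\<forall>\<^sub>F n in sequentially. nrm (u n) \<le> B"
    and lim: "AE x in lborel. (\<lambda>n. u n x) \<longlonglongrightarrow> v x" and v [measurable]: "v \<in> borel_measurable borel"
  shows "sqint v" "nrm v \<le> B"
proof -
  have [measurable]: "u n \<in> borel_measurable borel" for n using u sqint_meas by auto
  have B: "B \<ge> 0" using eventually_happens'[OF _ b] nrm_nonneg order_trans by (metis sequentially_bot)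
  have "(\<integral>\<^sup>+x. ennreal ((norm (v x))\<^sup>2) \<partial>lborel) = (\<integral>\<^sup>+x. liminf (\<lambda>n. ennreal ((norm (u n x))\<^sup>2)) \<partial>lborel)"
  proof (rule nn_integral_cong_AE, use lim in eventually_elim)
    fix x assume "(\<lambda>n. u n x) \<longlonglongrightarrow> v x"
    then have "(\<lambda>n. ennreal ((norm (u n x))\<^sup>2)) \<longlonglongrightarrow> ennreal ((norm (v x))\<^sup>2)"
      by (intro tendsto_ennrealI tendsto_intros)
    from lim_imp_Liminf[OF _ this] show "ennreal ((norm (v x))\<^sup>2) = liminf (\<lambda>n. ennreal ((norm (u n x))\<^sup>2))"
      by simp
  qed
  also have "\<dots> \<le> liminf (\<lambda>n. \<integral>\<^sup>+x. ennreal ((norm (u n x))\<^sup>2) \<partial>lborel)"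
    by (rule nn_integral_liminf) simp
  also have "\<dots> \<le> ennreal (B\<^sup>2)"
  proof (rule order_trans[OF Liminf_le_Limsup Limsup_bounded])
    show "\<forall>\<^sub>F n in sequentially. (\<integral>\<^sup>+x. ennreal ((norm (u n x))\<^sup>2) \<partial>lborel) \<le> ennreal (B\<^sup>2)"
      using b by eventually_elim (simp add: nn_integral_sqint[OF u] power_mono ennreal_leI)
  qed simp
  finally have le: "(\<integral>\<^sup>+x. ennreal ((norm (v x))\<^sup>2) \<partial>lborel) \<le> ennreal (B\<^sup>2)" .
  then show s: "sqint v" unfolding sqint_iff_nn by (auto simp: order_le_less_trans)
  have "(nrm v)\<^sup>2 \<le> B\<^sup>2" using le by (simp add: nn_integral_sqint[OF s] ennreal_le_iff)
  then show "nrm v \<le> B" using B power2_le_imp_le by blast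
qed

section \<open>Gaussian weights and completeness of L^2\<close>

lemma std_normal_density_le_1: "std_normal_density x \<le> 1"
proof -
  have "1 \<le> sqrt (2 * pi)" using pi_gt3 by (intro real_le_rsqrt) simp
  then have "1 / sqrt (2 * pi) * exp (- x\<^sup>2 / 2) \<le> 1 * 1"
    by (intro mult_mono) auto
  then show ?thesis by (simp add: std_normal_density_def)
qed

lemma gaussian_sqint: "sqint std_normal_density"
proof -
  have "integrable lborel (\<lambda>x. (std_normal_density x)\<^sup>2)"
  proof (rule Bochner_Integration.integrable_bound[of _ std_normal_density])
    show "AE x in lborel. norm ((std_normal_density x)\<^sup>2) \<le> norm (std_normal_density x)"
    proof (rule AE_I2)
      fix x :: real
      have "std_normal_density x \<le> 1"
      by (rule std_normal_density_le_1)
      then show "norm ((std_normal_density x)\<^sup>2) \<le> norm (std_normal_density x)"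
        by (simp add: power2_eq_square mult_left_le)
    qed
  qed auto
  then show ?thesis by (simp add: sqint_def)
qed

text \<open>The weight makes this a statement about local L^2 convergence, as local compactness
  needs it. The Gaussian is itself in L^2, so by Cauchy-Schwarz the sequence weighted by its square
  is Cauchy in L^1 and has an almost everywhere Cauchy subsequence; the weight is nowhere 0 and can
  be divided out.\<close>

lemma L2_Cauchy_AE_subseq:
  fixes u :: "nat \<Rightarrow> real \<Rightarrow> 'a::euclidean_space"
  assumes u: "\<And>n. sqint (u n)"
    and C: "\<And>e. e > 0 \<Longrightarrow> \<exists>N. \<forall>i\<ge>N. \<forall>j\<ge>N. nrm (\<lambda>x. std_normal_density x *\<^sub>R (u i x - u j x)) < e"
  obtains r v where "strict_mono r" "v \<in> borel_measurable borel" "AE x in lborel. (\<lambda>n. u (r n) x) \<longlonglongrightarrow> v x"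
proof -
  have [measurable]: "u n \<in> borel_measurable borel" for n using u sqint_meas by auto
  define w where "w x = (std_normal_density x)\<^sup>2" for x
  have wpos: "w x > 0" for x using normal_density_pos[of 1 0 x] by (simp add: w_def)
  define s where "s n x = w x *\<^sub>R u n x" for n x
  have int: "integrable lborel (\<lambda>x. w x *\<^sub>R z x)" if "sqint z" for z :: "real \<Rightarrow> 'a"
  proof -
    have [measurable]: "z \<in> borel_measurable borel" using that sqint_meas by auto
    have g1: "std_normal_density x \<le> 1" for x
    by (rule std_normal_density_le_1)
    have "w x \<le> std_normal_density x" for x
      using g1[of x] by (simp add: w_def power2_eq_square mult_left_le)
    then show ?thesis
      by (intro Bochner_Integration.integrable_bound[OF integrable_norm_prod[OF gaussian_sqint that]])
        (auto simp: w_def intro!: mult_right_mono)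
  qed
  have si: "integrable lborel (s n)" for n unfolding s_def by (rule int[OF u])
  have sC: "\<exists>N. \<forall>i\<ge>N. \<forall>j\<ge>N. (LBINT x. norm (s i x - s j x)) < e" if e: "e > 0" for e
  proof -
    let ?g = "nrm std_normal_density + 1"
    have g: "?g > 0" by (simp add: add_nonneg_pos)
    obtain N where N: "\<And>i j. i \<ge> N \<Longrightarrow> j \<ge> N \<Longrightarrow> nrm (\<lambda>x. std_normal_density x *\<^sub>R (u i x - u j x)) < e / ?g"
      using C[of "e / ?g"] e g by auto
    have "(LBINT x. norm (s i x - s j x)) < e" if ij: "i \<ge> N" "j \<ge> N" for i j
    proof -
      let ?d = "\<lambda>x. std_normal_density x *\<^sub>R (u i x - u j x)"
      have d: "sqint ?d"
      proof (rule sqint_bound[OF sqint_diff[OF u u, of i j]])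
        have "norm (std_normal_density x) \<le> 1" for x
        by (simp add: std_normal_density_le_1)
        then show "AE x in lborel. norm (?d x) \<le> norm (u i x - u j x)"
          by (auto intro!: mult_left_le_one_le)
      qed simp
      have "(LBINT x. norm (s i x - s j x)) = (LBINT x. norm (std_normal_density x) * norm (?d x))"
        by (simp add: s_def w_def power2_eq_square mult.assoc flip: scaleR_diff_right)
      also have "\<dots> \<le> nrm std_normal_density * nrm ?d" by (rule Cauchy_Schwarz_norm[OF gaussian_sqint d])
      also have "\<dots> \<le> ?g * nrm ?d" by (intro mult_right_mono) auto
      also have "\<dots> < e" using N[OF ij] g by (simp add: field_simps)
      finally show ?thesis .
    qed
    then show ?thesis by blast
  qed
  obtain r where r: "strict_mono r" "AE x in lborel. Cauchy (\<lambda>i. s (r i) x)"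
    using cauchy_L1_AE_cauchy_subseq[OF si sC] by blast
  have conv: "AE x in lborel. convergent (\<lambda>n. u (r n) x)"
    using r(2)
  proof eventually_elim
    fix x assume "Cauchy (\<lambda>i. s (r i) x)"
    then obtain l where "(\<lambda>i. s (r i) x) \<longlonglongrightarrow> l" using convergent_eq_Cauchy by blast
    then have "(\<lambda>i. (1 / w x) *\<^sub>R s (r i) x) \<longlonglongrightarrow> (1 / w x) *\<^sub>R l" by (intro tendsto_intros)
    then show "convergent (\<lambda>n. u (r n) x)" using wpos[of x] by (auto simp: s_def convergent_def)
  qed
  define v where "v x = lim (\<lambda>n. u (r n) x)" for x
  have "v \<in> borel_measurable borel"
    unfolding v_def by (rule borel_measurable_lim_metric) simp
  moreover have "AE x in lborel. (\<lambda>n. u (r n) x) \<longlonglongrightarrow> v x"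
    using conv by eventually_elim (simp add: v_def convergent_LIMSEQ_iff)
  ultimately show ?thesis using that r(1) by blast
qed

lemma L2_complete:
  fixes u :: "nat \<Rightarrow> real \<Rightarrow> 'a::euclidean_space"
  assumes u: "\<And>n. sqint (u n)"
    and C: "\<And>e. e > 0 \<Longrightarrow> \<exists>N. \<forall>i\<ge>N. \<forall>j\<ge>N. nrm (\<lambda>x. u i x - u j x) < e"
  obtains r v where "strict_mono r" "sqint v" "AE x in lborel. (\<lambda>n. u (r n) x) \<longlonglongrightarrow> v x"
    "(\<lambda>n. nrm (\<lambda>x. u n x - v x)) \<longlonglongrightarrow> 0"
proof -
  have [measurable]: "u n \<in> borel_measurable borel" for n using u sqint_meas by auto
  have C': "\<exists>N. \<forall>i\<ge>N. \<forall>j\<ge>N. nrm (\<lambda>x. std_normal_density x *\<^sub>R (u i x - u j x)) < e" if "e > 0" for e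
  proof -
    have "nrm (\<lambda>x. std_normal_density x *\<^sub>R (u i x - u j x)) \<le> nrm (\<lambda>x. u i x - u j x)" for i j
    proof (rule nrm_mono)
      have "norm (std_normal_density x) \<le> 1" for x
      by (simp add: std_normal_density_le_1)
      then show *: "AE x in lborel. norm (std_normal_density x *\<^sub>R (u i x - u j x)) \<le> norm (u i x - u j x)"
        by (auto intro!: mult_left_le_one_le)
      show "sqint (\<lambda>x. u i x - u j x)" using u sqint_diff by blast
      then show "sqint (\<lambda>x. std_normal_density x *\<^sub>R (u i x - u j x))"
        by (rule sqint_bound) (use * in auto)
    qed
    then show ?thesis using C[OF that] order_le_less_trans by meson
  qed
  obtain r v where r: "strict_mono r" and v [measurable]: "v \<in> borel_measurable borel"
    and lim: "AE x in lborel. (\<lambda>n. u (r n) x) \<longlonglongrightarrow> v x"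
    using L2_Cauchy_AE_subseq[OF u C'] by blast
  \<comment> \<open>Fatou along the subsequence with \<open>n\<close> held fixed turns the Cauchy
    estimate into an estimate of the distance to the limit.\<close>
  have main: "sqint (\<lambda>x. u n x - v x) \<and> nrm (\<lambda>x. u n x - v x) \<le> e"
    if N: "\<forall>i\<ge>N. \<forall>j\<ge>N. nrm (\<lambda>x. u i x - u j x) < e" and n: "n \<ge> N" for n N e
  proof -
    have 1: "\<And>k. sqint (\<lambda>x. u n x - u (r k) x)" using u sqint_diff by blast
    have 2: "\<forall>\<^sub>F k in sequentially. nrm (\<lambda>x. u n x - u (r k) x) \<le> e"
      using N n by (intro eventually_sequentiallyI[of N])
        (meson less_imp_le order_trans seq_suble[OF r])
    have 3: "AE x in lborel. (\<lambda>k. u n x - u (r k) x) \<longlonglongrightarrow> u n x - v x"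
      using lim by eventually_elim (intro tendsto_intros)
    show ?thesis using sqint_Fatou[OF 1 2 3] by simp
  qed
  obtain N where "\<forall>i\<ge>N. \<forall>j\<ge>N. nrm (\<lambda>x. u i x - u j x) < 1" using C[of 1] by auto
  then have "sqint (\<lambda>x. u N x - v x)" using main by blast
  from sqint_diff[OF u[of N] this] have sv: "sqint v" by simp
  have "(\<lambda>n. nrm (\<lambda>x. u n x - v x)) \<longlonglongrightarrow> 0"
  proof (rule LIMSEQ_I)
    fix e :: real assume "e > 0"
    then obtain N where "\<forall>i\<ge>N. \<forall>j\<ge>N. nrm (\<lambda>x. u i x - u j x) < e/2" using C[of "e/2"] by auto
    then have "\<forall>n\<ge>N. nrm (\<lambda>x. u n x - v x) \<le> e/2" using main by blast
    then show "\<exists>no. \<forall>n\<ge>no. norm (nrm (\<lambda>x. u n x - v x) - 0) < e"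
      using \<open>e > 0\<close> by (intro exI[of _ N]) force
  qed
  then show ?thesis using that r sv lim by blast
qed

lemma sqint_translate: "sqint u \<Longrightarrow> sqint (\<lambda>x. u (x + h))"
  using lborel_integrable_real_affine[of "\<lambda>x. (norm (u x))\<^sup>2" 1 h]
  by (auto simp: sqint_def add.commute)

lemma nrm_translate: "nrm (\<lambda>x. u (x + h)) = nrm u"
  using lborel_integral_real_affine[of 1 "\<lambda>x. (norm (u x))\<^sup>2" h] by (simp add: nrm_def add.commute)

lemma sqint_reflect: "sqint u \<Longrightarrow> sqint (\<lambda>x. u (- x))"
  using lborel_integrable_real_affine[of "\<lambda>x. (norm (u x))\<^sup>2" "-1" 0]
  by (auto simp: sqint_def)

lemma nrm_reflect: "nrm (\<lambda>x. u (- x)) = nrm u"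
  using lborel_integral_real_affine[of "-1" "\<lambda>x. (norm (u x))\<^sup>2" 0] by (simp add: nrm_def)

section \<open>Continuity of translations in $L^1$\<close>

lemma integrable_translate:
  fixes f :: "real \<Rightarrow> 'a::{banach, second_countable_topology}"
  shows "integrable lborel f \<Longrightarrow> integrable lborel (\<lambda>x. f (x + h))"
  using lborel_integrable_real_affine[of f 1 h] by (simp add: add.commute)

lemma integral_translate:
  fixes f :: "real \<Rightarrow> 'a::{banach, second_countable_topology}"
  shows "(LBINT x. f (x + h)) = (LBINT x. f x)"
  using lborel_integral_real_affine[of 1 f h] by (simp add: add.commute)

text \<open>By translation invariance the error of replacing \<open>f\<close> by \<open>g\<close> is
  the same before and after the shift, so the property is closed under L^1 limits. It serves both
  the indicator and the limit case of the induction below.\<close>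

lemma translate_approx:
  fixes f :: "real \<Rightarrow> 'a::{banach, second_countable_topology}"
  assumes f: "integrable lborel f"
    and ap: "\<And>e. e > 0 \<Longrightarrow> \<exists>g. integrable lborel g \<and> (\<lambda>n. LBINT x. norm (g (x + h n) - g x)) \<longlonglongrightarrow> 0 \<and> (LBINT x. norm (f x - g x)) < e"
  shows "(\<lambda>n. LBINT x. norm (f (x + h n) - f x)) \<longlonglongrightarrow> 0"
proof (rule LIMSEQ_I)
  fix e :: real assume e: "e > 0"
  obtain g where g: "integrable lborel g" "(\<lambda>n. LBINT x. norm (g (x + h n) - g x)) \<longlonglongrightarrow> 0"
    and fg: "(LBINT x. norm (f x - g x)) < e/3" using ap[of "e/3"] e by auto
  obtain N where N: "\<And>n. n \<ge> N \<Longrightarrow> (LBINT x. norm (g (x + h n) - g x)) < e/3"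
    using LIMSEQ_D[OF g(2), of "e/3"] e by auto
  have "(LBINT x. norm (f (x + h n) - f x)) < e" if n: "n \<ge> N" for n
  proof -
    have i: "integrable lborel (\<lambda>x. norm (f x - g x))" using f g by auto
    note f' = integrable_translate[OF f, of "h n"] and g' = integrable_translate[OF g(1), of "h n"]
    have "(LBINT x. norm (f (x + h n) - f x))
       \<le> (LBINT x. norm (f (x + h n) - g (x + h n)) + norm (g (x + h n) - g x) + norm (f x - g x))"
    proof (rule integral_mono)
      fix x
      have "f (x + h n) - f x = (f (x + h n) - g (x + h n)) + (g (x + h n) - g x) + (g x - f x)" by simp
      then show "norm (f (x + h n) - f x) \<le> norm (f (x + h n) - g (x + h n)) + norm (g (x + h n) - g x) + norm (f x - g x)"
        by (metis norm_triangle_le add_mono norm_triangle_ineq norm_minus_commute order_refl)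
    qed (use f g f' g' in auto)
    also have "\<dots> = (LBINT x. norm (f (x + h n) - g (x + h n))) + (LBINT x. norm (g (x + h n) - g x)) + (LBINT x. norm (f x - g x))"
      using f g f' g' by simp
    also have "(LBINT x. norm (f (x + h n) - g (x + h n))) = (LBINT x. norm (f x - g x))"
      by (rule integral_translate[where f="\<lambda>x. norm (f x - g x)"])
    finally show ?thesis using fg N[OF n] by simp
  qed
  then show "\<exists>no. \<forall>n\<ge>no. norm ((LBINT x. norm (f (x + h n) - f x)) - 0) < e"
    by (intro exI[of _ N]) auto
qed

text \<open>The absolute difference of two indicators is their sum minus twice their product. The
  sum has constant integral; the product converges pointwise to the indicator, by openness inside
  \<open>U\<close> and trivially outside, where it is 0.\<close>

lemma translate_indicator_open:
  fixes c :: "'a::{banach, second_countable_topology}"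
  assumes U: "open U" and fin: "emeasure lborel U < \<infinity>" and h: "h \<longlonglongrightarrow> (0::real)"
  shows "(\<lambda>n. LBINT x. norm (indicator U (x + h n) *\<^sub>R c - indicator U x *\<^sub>R c)) \<longlonglongrightarrow> 0"
proof -
  let ?i = "indicator U :: real \<Rightarrow> real"
  have [measurable]: "U \<in> sets borel" using U by auto
  have iU: "integrable lborel ?i" using fin by (simp add: integrable_indicator_iff)
  note iUh = integrable_translate[OF iU]
  have ip: "integrable lborel (\<lambda>x. ?i (x + h n) * ?i x)" for n
    by (rule Bochner_Integration.integrable_bound[OF iU]) (auto simp: indicator_def)
  have "(\<lambda>n. LBINT x. ?i (x + h n) * ?i x) \<longlonglongrightarrow> (LBINT x. ?i x)"
  proof (rule integral_dominated_convergence[where w="?i"])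
    show "AE x in lborel. (\<lambda>n. ?i (x + h n) * ?i x) \<longlonglongrightarrow> ?i x"
    proof (rule AE_I2)
      fix x
      show "(\<lambda>n. ?i (x + h n) * ?i x) \<longlonglongrightarrow> ?i x"
      proof (cases "x \<in> U")
        case True
        have "(\<lambda>n. x + h n) \<longlonglongrightarrow> x + 0" by (intro tendsto_intros h)
        then have "\<forall>\<^sub>F n in sequentially. x + h n \<in> U" using U True by (auto dest: topological_tendstoD)
        then have "\<forall>\<^sub>F n in sequentially. ?i (x + h n) * ?i x = ?i x" by eventually_elim (use True in auto)
        then show ?thesis by (rule tendsto_eventually)
      qed auto
    qed
  qed (use iU in \<open>auto simp: indicator_def\<close>)
  then have "(\<lambda>n. norm c * ((LBINT x. ?i x) + (LBINT x. ?i x) - 2 * (LBINT x. ?i (x + h n) * ?i x)))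
     \<longlonglongrightarrow> norm c * ((LBINT x. ?i x) + (LBINT x. ?i x) - 2 * (LBINT x. ?i x))"
    by (intro tendsto_intros)
  moreover have "(LBINT x. norm (indicator U (x + h n) *\<^sub>R c - indicator U x *\<^sub>R c))
     = norm c * ((LBINT x. ?i x) + (LBINT x. ?i x) - 2 * (LBINT x. ?i (x + h n) * ?i x))" for n
  proof -
    have "norm (indicator U (x + h n) *\<^sub>R c - indicator U x *\<^sub>R c)
        = norm c * (?i (x + h n) + ?i x - 2 * (?i (x + h n) * ?i x))" for x
      by (auto simp: indicator_def)
    then have "(LBINT x. norm (indicator U (x + h n) *\<^sub>R c - indicator U x *\<^sub>R c))
        = (LBINT x. norm c * (?i (x + h n) + ?i x - 2 * (?i (x + h n) * ?i x)))" by simp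
    also have "\<dots> = norm c * ((LBINT x. ?i (x + h n)) + (LBINT x. ?i x) - 2 * (LBINT x. ?i (x + h n) * ?i x))"
      using iU iUh[of "h n"] ip[of n] by simp
    also have "(LBINT x. ?i (x + h n)) = (LBINT x. ?i x)" by (rule integral_translate)
    finally show ?thesis .
  qed
  ultimately show ?thesis by simp
qed

text \<open>Induction over integrable functions. Outer regularity replaces a measurable set by an
  open superset of almost the same measure, for which convergence of the indicators is
  elementary.\<close>

lemma L1_translate_tendsto:
  fixes f :: "real \<Rightarrow> 'a::{banach, second_countable_topology}"
  assumes f: "integrable lborel f" and h: "h \<longlonglongrightarrow> (0::real)"
  shows "(\<lambda>n. LBINT x. norm (f (x + h n) - f x)) \<longlonglongrightarrow> 0"
  using f
proof (induction f rule: integrable_induct)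
  case (base A c)
  then have A: "A \<in> sets borel" "emeasure lborel A < \<infinity>" by auto
  show ?case
  proof (rule translate_approx)
    show iA: "integrable lborel (\<lambda>x. indicator A x *\<^sub>R c)" using A by (auto simp: less_top)
    fix e :: real assume e: "e > 0"
    let ?d = "e / (norm c + 1)"
    have d: "?d > 0" using e by (simp add: add_nonneg_pos)
    obtain U where U: "open U" "A \<subseteq> U" "emeasure lborel (U - A) < ennreal ?d"
      using outer_regular_lborel[OF A(1) d] by auto
    have mU: "U \<in> sets borel" using U by auto
    have "emeasure lborel U \<le> emeasure lborel A + emeasure lborel (U - A)"
      by (rule order_trans[OF emeasure_mono[of U "A \<union> (U - A)"] emeasure_subadditive]) (use A mU in auto)
    also have "\<dots> < \<infinity>" using A(2) U(3) by (auto simp: less_top[symmetric] top_unique)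
    finally have fU: "emeasure lborel U < \<infinity>" .
    have iU: "integrable lborel (\<lambda>x. indicator U x *\<^sub>R c)" using mU fU by (auto simp: less_top)
    have "(LBINT x. norm (indicator A x *\<^sub>R c - indicator U x *\<^sub>R c)) = (LBINT x. norm c * indicator (U - A) x)"
      by (rule Bochner_Integration.integral_cong) (use U(2) in \<open>auto simp: indicator_def\<close>)
    also have "\<dots> = norm c * measure lborel (U - A)" by simp
    also have "\<dots> \<le> norm c * ?d"
      using U(3) d by (intro mult_left_mono) (auto simp: measure_def enn2real_leI)
    also have "\<dots> < e"
    proof -
      have "e * norm c < e * (norm c + 1)" using e by simp
      moreover have "norm c + 1 > 0" by (simp add: add_nonneg_pos)
      ultimately show ?thesis by (simp add: field_simps)
    qed
    finally show "\<exists>g. integrable lborel g \<and> (\<lambda>n. LBINT x. norm (g (x + h n) - g x)) \<longlonglongrightarrow> 0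
       \<and> (LBINT x. norm (indicator A x *\<^sub>R c - g x)) < e"
      using iU translate_indicator_open[OF U(1) fU h, of c] by (intro exI[of _ "\<lambda>x. indicator U x *\<^sub>R c"]) auto
  qed
next
  case (add f g)
  have "(\<lambda>n. (LBINT x. norm (f (x + h n) - f x)) + (LBINT x. norm (g (x + h n) - g x))) \<longlonglongrightarrow> 0 + 0"
    by (intro tendsto_add add)
  then have lim: "(\<lambda>n. (LBINT x. norm (f (x + h n) - f x)) + (LBINT x. norm (g (x + h n) - g x))) \<longlonglongrightarrow> 0" by simp
  show ?case
  proof (rule Lim_null_comparison[OF _ lim])
    show "\<forall>\<^sub>F n in sequentially. norm (LBINT x. norm (f (x + h n) + g (x + h n) - (f x + g x)))
      \<le> (LBINT x. norm (f (x + h n) - f x)) + (LBINT x. norm (g (x + h n) - g x))"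
    proof (rule always_eventually, rule allI)
      fix n
      note f' = integrable_translate[OF \<open>integrable lborel f\<close>, of "h n"] and g' = integrable_translate[OF \<open>integrable lborel g\<close>, of "h n"]
      have "(LBINT x. norm (f (x + h n) + g (x + h n) - (f x + g x)))
         \<le> (LBINT x. norm (f (x + h n) - f x) + norm (g (x + h n) - g x))"
        by (rule integral_mono) (use add f' g' in \<open>auto intro!: norm_diff_triangle_ineq\<close>)
      then show "norm (LBINT x. norm (f (x + h n) + g (x + h n) - (f x + g x)))
         \<le> (LBINT x. norm (f (x + h n) - f x)) + (LBINT x. norm (g (x + h n) - g x))"
        using add f' g' by (simp add: integral_nonneg_AE)
    qed
  qed
next
  case (lim f s)
  show ?case
  proof (rule translate_approx[OF \<open>integrable lborel f\<close>])
    fix e :: real assume e: "e > 0"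
    have m [measurable]: "f \<in> borel_measurable borel" "s i \<in> borel_measurable borel" for i
      using lim borel_measurable_integrable by auto
    have "(\<lambda>i. LBINT x. norm (f x - s i x)) \<longlonglongrightarrow> (\<integral>x. 0 \<partial>(lborel :: real measure))"
    \<comment> \<open>The approximants satisfy |s_i| <= 2 |f|, hence |f - s_i| <= 3 |f|.\<close>
    proof (rule integral_dominated_convergence[where w="\<lambda>x. 3 * norm (f x)"])
      show "AE x in lborel. (\<lambda>i. norm (f x - s i x)) \<longlonglongrightarrow> 0"
      proof (rule AE_I2)
        fix x
        have "(\<lambda>i. norm (f x - s i x)) \<longlonglongrightarrow> norm (f x - f x)" using lim(2)[of x] by (intro tendsto_intros) auto
        then show "(\<lambda>i. norm (f x - s i x)) \<longlonglongrightarrow> 0" by simp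
      qed
      show "AE x in lborel. norm (norm (f x - s i x)) \<le> 3 * norm (f x)" for i
      proof (rule AE_I2)
        fix x show "norm (norm (f x - s i x)) \<le> 3 * norm (f x)"
          using lim(3)[of x i] norm_triangle_ineq4[of "f x" "s i x"] by simp
      qed
    qed (use lim in auto)
    from LIMSEQ_D[OF this e] obtain i where "(LBINT x. norm (f x - s i x)) < e" by auto
    then show "\<exists>g. integrable lborel g \<and> (\<lambda>n. LBINT x. norm (g (x + h n) - g x)) \<longlonglongrightarrow> 0
       \<and> (LBINT x. norm (f x - g x)) < e" using lim by blast
  qed
qed

section \<open>The Fourier transform on $L^1$\<close>

text \<open>Sign and normalization are those of \<open>fourier_trunc\<close>; with no prefactor,
  every Plancherel identity below carries a factor 2 pi.\<close>

definition ft :: "(real \<Rightarrow> complex) \<Rightarrow> real \<Rightarrow> complex" where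
  "ft u \<xi> = (LBINT x. exp (- \<i> * complex_of_real (\<xi> * x)) * u x)"

lemma norm_exp_ii [simp]: "norm (exp (- \<i> * complex_of_real t)) = 1"
  using norm_exp_i_times[of "- t"] by simp

lemma ft_measurable [measurable]:
  assumes [measurable]: "u \<in> borel_measurable borel" shows "ft u \<in> borel_measurable borel"
  unfolding ft_def by measurable

lemma ft_integrand:
  assumes u: "integrable lborel u" shows "integrable lborel (\<lambda>x. exp (- \<i> * complex_of_real (\<xi> * x)) * u x)"
proof (rule Bochner_Integration.integrable_bound[OF u])
  have [measurable]: "u \<in> borel_measurable borel" using borel_measurable_integrable[OF u] by simp
  show "(\<lambda>x. exp (- \<i> * complex_of_real (\<xi> * x)) * u x) \<in> borel_measurable lborel" by measurable
  show "AE x in lborel. cmod (exp (- \<i> * complex_of_real (\<xi> * x)) * u x) \<le> cmod (u x)"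
    by (rule AE_I2) (simp only: norm_mult norm_exp_ii)
qed

lemma norm_ft_le:
  assumes "integrable lborel u" shows "norm (ft u \<xi>) \<le> (LBINT x. norm (u x))"
proof -
  have "norm (ft u \<xi>) \<le> (LBINT x. norm (exp (- \<i> * complex_of_real (\<xi> * x)) * u x))"
    unfolding ft_def by (rule integral_norm_bound)
  then show ?thesis by (simp only: norm_mult norm_exp_ii mult_1)
qed

lemma ft_add: "integrable lborel u \<Longrightarrow> integrable lborel v \<Longrightarrow> ft (\<lambda>x. u x + v x) \<xi> = ft u \<xi> + ft v \<xi>"
  unfolding ft_def by (simp only: distrib_left Bochner_Integration.integral_add ft_integrand)

lemma ft_diff: "integrable lborel u \<Longrightarrow> integrable lborel v \<Longrightarrow> ft (\<lambda>x. u x - v x) \<xi> = ft u \<xi> - ft v \<xi>"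
  unfolding ft_def by (simp only: right_diff_distrib Bochner_Integration.integral_diff ft_integrand)

lemma ft_cmult: "ft (\<lambda>x. a * u x) \<xi> = a * ft u \<xi>"
  unfolding ft_def by (subst integral_mult_right_zero[symmetric]) (simp only: mult.left_commute)

lemma ft_reflect: "ft (\<lambda>x. u (- x)) \<xi> = ft u (- \<xi>)"
  unfolding ft_def
  using lborel_integral_real_affine[of "-1" "\<lambda>x. exp (- \<i> * complex_of_real (- \<xi> * x)) * u x" 0] by simp

lemma ft_cnj: "ft (\<lambda>x. cnj (u x)) \<xi> = cnj (ft u (- \<xi>))"
  unfolding ft_def
  using Bochner_Integration.integral_cnj[of lborel "\<lambda>x. exp (- \<i> * complex_of_real (- \<xi> * x)) * u x"] by (simp add: exp_cnj)

lemma ft_translate: "ft (\<lambda>x. u (x + h)) \<xi> = exp (\<i> * complex_of_real (\<xi> * h)) * ft u \<xi>"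
proof -
  have "ft u \<xi> = (LBINT x. exp (- \<i> * complex_of_real (\<xi> * (x + h))) * u (x + h))"
    unfolding ft_def by (rule integral_translate[symmetric])
  also have "\<dots> = (LBINT x. exp (- \<i> * complex_of_real (\<xi> * h)) * (exp (- \<i> * complex_of_real (\<xi> * x)) * u (x + h)))"
    by (simp add: distrib_left exp_add[symmetric] mult.assoc[symmetric] add.commute)
  also have "\<dots> = exp (- \<i> * complex_of_real (\<xi> * h)) * ft (\<lambda>x. u (x + h)) \<xi>" unfolding ft_def by simp
  finally show ?thesis by (simp add: mult.assoc[symmetric] exp_add[symmetric])
qed

lemma ft_mult_formula:
  assumes u: "integrable lborel u" and v: "integrable lborel v"
  shows "(LBINT \<xi>. ft u \<xi> * v \<xi>) = (LBINT x. u x * ft v x)"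
proof -
  have [measurable]: "u \<in> borel_measurable borel" "v \<in> borel_measurable borel"
    using borel_measurable_integrable[OF u] borel_measurable_integrable[OF v] by auto
  let ?f = "\<lambda>x \<xi>. exp (- \<i> * complex_of_real (\<xi> * x)) * u x * v \<xi>"
  have n: "norm (?f x \<xi>) = norm (u x) * norm (v \<xi>)" for x \<xi>
    by (simp only: norm_mult norm_exp_ii)
  have "integrable (lborel \<Otimes>\<^sub>M lborel) (case_prod ?f)"
  proof (rule lborel_pair.Fubini_integrable)
    show "case_prod ?f \<in> borel_measurable (lborel \<Otimes>\<^sub>M lborel)" by measurable
    show "integrable lborel (\<lambda>x. LBINT y. norm (case (x, y) of (x, xa) \<Rightarrow> ?f x xa))"
      using u by (simp only: prod.case n) simp
    show "AE x in lborel. integrable lborel (\<lambda>y. case (x, y) of (x, xa) \<Rightarrow> ?f x xa)"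
    proof (rule AE_I2)
      fix x
      have "integrable lborel (\<lambda>y. norm (u x) * norm (v y))" using v by simp
      then show "integrable lborel (\<lambda>y. case (x, y) of (x, xa) \<Rightarrow> ?f x xa)"
        unfolding prod.case
      proof (rule Bochner_Integration.integrable_bound)
        show "(\<lambda>y. ?f x y) \<in> borel_measurable lborel" by measurable
        show "AE y in lborel. norm (?f x y) \<le> norm (norm (u x) * norm (v y))"
          unfolding n by simp
      qed
    qed
  qed
  from lborel_pair.Fubini_integral[OF this]
  have "(LBINT \<xi>. (LBINT x. ?f x \<xi>)) = (LBINT x. (LBINT \<xi>. ?f x \<xi>))" .
  moreover have "(LBINT x. ?f x \<xi>) = ft u \<xi> * v \<xi>" for \<xi>
    unfolding ft_def by (rule integral_mult_left_zero)
  moreover have "(LBINT \<xi>. ?f x \<xi>) = u x * ft v x" for x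
    unfolding ft_def by (subst integral_mult_right_zero[symmetric]) (simp only: mult_ac)
  ultimately show ?thesis by (simp only:)
qed

text \<open>The right-hand side is written as 2 pi times a rescaled probability density, so that for
  growing \<open>a\<close> it is visibly an approximate identity at 0.\<close>

lemma ft_gaussian:
  fixes a :: real assumes a: "a > 0"
  shows "ft (\<lambda>x. complex_of_real (exp (- (x / a)\<^sup>2 / 2))) \<xi> = complex_of_real (2 * pi * a * std_normal_density (a * \<xi>))"
proof -
  \<comment> \<open>The characteristic function uses the opposite sign in the exponent, hence the
    evaluation at \<open>- t\<close>.\<close>
  have ch: "(LBINT x. exp (- \<i> * complex_of_real (t * x)) * complex_of_real (std_normal_density x)) = complex_of_real (exp (- t\<^sup>2 / 2))" for t
  proof -
    have "complex_of_real (exp (- (- t)\<^sup>2 / 2)) = char std_normal_distribution (- t)"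
      by (simp add: char_std_normal_distribution)
    also have "\<dots> = (LBINT x. std_normal_density x *\<^sub>R iexp (- t * x))"
      unfolding char_def by (subst integral_density) auto
    finally show ?thesis by (simp add: scaleR_conv_of_real mult.commute)
  qed
  have "ft (\<lambda>x. complex_of_real (exp (- (x / a)\<^sup>2 / 2))) \<xi>
     = \<bar>a\<bar> *\<^sub>R (LBINT x. exp (- \<i> * complex_of_real (\<xi> * (0 + a * x))) * complex_of_real (exp (- ((0 + a * x) / a)\<^sup>2 / 2)))"
    unfolding ft_def using a by (intro lborel_integral_real_affine) simp
  also have "(LBINT x. exp (- \<i> * complex_of_real (\<xi> * (0 + a * x))) * complex_of_real (exp (- ((0 + a * x) / a)\<^sup>2 / 2)))
    = (LBINT x. complex_of_real (sqrt (2 * pi)) * (exp (- \<i> * complex_of_real ((a * \<xi>) * x)) * complex_of_real (std_normal_density x)))"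
    using a by (intro Bochner_Integration.integral_cong) (auto simp: std_normal_density_def mult_ac)
  also have "\<dots> = complex_of_real (sqrt (2 * pi)) * complex_of_real (exp (- (a * \<xi>)\<^sup>2 / 2))"
    by (simp only: integral_mult_right_zero ch)
  finally have "ft (\<lambda>x. complex_of_real (exp (- (x / a)\<^sup>2 / 2))) \<xi> = complex_of_real (a * sqrt (2 * pi) * exp (- (a * \<xi>)\<^sup>2 / 2))"
    using a by (simp add: scaleR_conv_of_real)
  also have "a * sqrt (2 * pi) * exp (- (a * \<xi>)\<^sup>2 / 2) = 2 * pi * a * std_normal_density (a * \<xi>)"
  proof -
    have "2 * pi / sqrt (2 * pi) = sqrt (2 * pi)" by (rule real_div_sqrt) simp
    then have *: "2 * pi * a * (1 / sqrt (2 * pi) * e) = a * sqrt (2 * pi) * e" for e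
      by (metis (no_types, lifting) mult.assoc mult.commute mult.left_commute times_divide_eq_right mult_1)
    show ?thesis unfolding std_normal_density_def * ..
  qed
  finally show ?thesis .
qed

text \<open>Integrability makes \<open>ft\<close> an honest integral, boundedness makes the
  autocorrelation bounded and continuous at 0; truncation shows that the class is dense in
  L^2.\<close>

definition BL1 :: "(real \<Rightarrow> complex) \<Rightarrow> bool" where
  "BL1 u \<longleftrightarrow> integrable lborel u \<and> (\<exists>B. \<forall>x. norm (u x) \<le> B)"

lemma BL1_integrable: "BL1 u \<Longrightarrow> integrable lborel u"
  by (simp add: BL1_def)

lemma BL1_meas: "BL1 u \<Longrightarrow> u \<in> borel_measurable borel"
  using borel_measurable_integrable[of lborel u] by (simp add: BL1_def)

lemma BL1_sqint: assumes "BL1 u" shows "sqint u"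
proof -
  obtain B where B: "\<And>x. norm (u x) \<le> B" using assms unfolding BL1_def by auto
  have [measurable]: "u \<in> borel_measurable borel" using assms BL1_meas by auto
  have "integrable lborel (\<lambda>x. (norm (u x))\<^sup>2)"
  proof (rule Bochner_Integration.integrable_bound[where f="\<lambda>x. B * norm (u x)"])
    show "integrable lborel (\<lambda>x. B * norm (u x))" using BL1_integrable[OF assms] by simp
    have "norm ((norm (u x))\<^sup>2) \<le> norm (B * norm (u x))" for x
      using mult_right_mono[OF B[of x], of "norm (u x)"] order_trans[OF norm_ge_zero B[of x]]
      by (simp add: power2_eq_square abs_mult)
    then show "AE x in lborel. norm ((norm (u x))\<^sup>2) \<le> norm (B * norm (u x))" by simp
  qed measurable
  then show ?thesis by (simp add: sqint_def)
qed

lemma BL1_add: assumes "BL1 u" "BL1 v" shows "BL1 (\<lambda>x. u x + v x)"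
proof -
  obtain B C where "\<And>x. norm (u x) \<le> B" "\<And>x. norm (v x) \<le> C" using assms unfolding BL1_def by auto
  then have "\<And>x. norm (u x + v x) \<le> B + C" by (intro norm_triangle_mono)
  then show ?thesis using assms unfolding BL1_def by auto
qed

lemma BL1_cmult: assumes "BL1 u" shows "BL1 (\<lambda>x. a * u x)"
proof -
  obtain B where "\<And>x. norm (u x) \<le> B" using assms unfolding BL1_def by auto
  then have "\<And>x. norm (a * u x) \<le> norm a * B" unfolding norm_mult by (intro mult_left_mono) auto
  then show ?thesis using assms unfolding BL1_def by auto
qed

lemma BL1_translate: "BL1 u \<Longrightarrow> BL1 (\<lambda>x. u (x + h))"
  unfolding BL1_def using integrable_translate[of u h] by auto

lemma BL1_reflect: "BL1 u \<Longrightarrow> BL1 (\<lambda>x. u (- x))"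
  unfolding BL1_def using lborel_integrable_real_affine[of u "-1" 0] by auto

lemma BL1_cnj: "BL1 u \<Longrightarrow> BL1 (\<lambda>x. cnj (u x))"
  unfolding BL1_def by auto

lemma borel_measurable_cnj [measurable]: "f \<in> borel_measurable M \<Longrightarrow> (\<lambda>x. cnj (f x)) \<in> borel_measurable M"
  by (simp add: borel_measurable_complex_iff)

section \<open>Autocorrelation and Plancherel's identity\<close>

definition acorr :: "(real \<Rightarrow> complex) \<Rightarrow> real \<Rightarrow> complex" where
  "acorr u h = (LBINT x. u (x + h) * cnj (u x))"

text \<open>The transform of the autocorrelation is the energy density of \<open>u\<close>; testing it against widening
  Gaussians gives Plancherel's identity.\<close>
lemma acorr_pair_integrable:
  fixes u :: "real \<Rightarrow> complex"
  assumes u: "integrable lborel u"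
  shows "integrable (lborel \<Otimes>\<^sub>M lborel) (\<lambda>(x, h). u (x + h) * cnj (u x))"
proof (rule lborel_pair.Fubini_integrable)
  have [measurable]: "u \<in> borel_measurable borel" using borel_measurable_integrable[OF u] by simp
  show "(\<lambda>(x, h). u (x + h) * cnj (u x)) \<in> borel_measurable (lborel \<Otimes>\<^sub>M lborel)" by measurable
  have 1: "(LBINT h. norm (u (x + h) * cnj (u x))) = norm (u x) * (LBINT h. norm (u h))" for x
    using integral_translate[of "\<lambda>y. norm (u y)" x] by (simp add: norm_mult mult.commute add.commute)
  show "integrable lborel (\<lambda>x. LBINT y. norm (case (x, y) of (x, h) \<Rightarrow> u (x + h) * cnj (u x)))"
    unfolding prod.case 1 using u by simp
  show "AE x in lborel. integrable lborel (\<lambda>y. case (x, y) of (x, h) \<Rightarrow> u (x + h) * cnj (u x))"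
    unfolding prod.case using integrable_translate[OF u] by (simp add: add.commute)
qed

lemma acorr_integrable:
  assumes u: "integrable lborel u" shows "integrable lborel (acorr u)"
  using lborel_pair.integrable_snd[OF acorr_pair_integrable[OF u]] unfolding acorr_def by simp

lemma acorr_bound:
  assumes u: "integrable lborel u" and B: "\<And>x. norm (u x) \<le> B"
  shows "norm (acorr u h) \<le> B * (LBINT x. norm (u x))"
proof -
  have [measurable]: "u \<in> borel_measurable borel" using borel_measurable_integrable[OF u] by simp
  have "norm (acorr u h) \<le> (LBINT x. norm (u (x + h) * cnj (u x)))" unfolding acorr_def by (rule integral_norm_bound)
  also have "\<dots> \<le> (LBINT x. B * norm (u x))"
  proof (rule integral_mono')
    show "integrable lborel (\<lambda>x. B * norm (u x))" using u by simp
  qed (auto simp: norm_mult intro!: mult_right_mono B mult_nonneg_nonneg order_trans[OF norm_ge_zero B])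
  finally show ?thesis by simp
qed

text \<open>Boundedness of \<open>u\<close> pulls one factor out of the integral; what remains is
  continuity of translations in L^1.\<close>

lemma acorr_cont:
  assumes u: "integrable lborel u" and B: "\<And>x. norm (u x) \<le> B" and h: "h \<longlonglongrightarrow> 0"
  shows "(\<lambda>n. acorr u (h n)) \<longlonglongrightarrow> acorr u 0"
proof (rule LIM_zero_cancel, rule Lim_null_comparison)
  have [measurable]: "u \<in> borel_measurable borel" using borel_measurable_integrable[OF u] by simp
  have B0: "B \<ge> 0" using order_trans[OF norm_ge_zero B] .
  have i: "integrable lborel (\<lambda>x. u (x + h) * cnj (u x))" for h
  proof (rule Bochner_Integration.integrable_bound[where f="\<lambda>x. B * norm (u x)"])
    show "integrable lborel (\<lambda>x. B * norm (u x))" using u by simp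
    show "AE x in lborel. norm (u (x + h) * cnj (u x)) \<le> norm (B * norm (u x))"
      using B0 by (auto simp: norm_mult intro!: mult_right_mono B)
  qed measurable
  show "\<forall>\<^sub>F n in sequentially. norm (acorr u (h n) - acorr u 0) \<le> B * (LBINT x. norm (u (x + h n) - u x))"
  proof (rule always_eventually, rule allI)
    fix n
    have "acorr u (h n) - acorr u 0 = (LBINT x. (u (x + h n) - u x) * cnj (u x))"
      unfolding acorr_def using i[of "h n"] i[of 0] by (simp add: left_diff_distrib)
    also have "norm \<dots> \<le> (LBINT x. norm ((u (x + h n) - u x) * cnj (u x)))" by (rule integral_norm_bound)
    also have "\<dots> \<le> (LBINT x. B * norm (u (x + h n) - u x))"
    proof (rule integral_mono')
      show "integrable lborel (\<lambda>x. B * norm (u (x + h n) - u x))" using u integrable_translate[OF u] by simp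
    qed (auto simp: norm_mult mult.commute[of B] intro!: mult_left_mono B mult_nonneg_nonneg B0)
    finally show "norm (acorr u (h n) - acorr u 0) \<le> B * (LBINT x. norm (u (x + h n) - u x))" by simp
  qed
  have "(\<lambda>n. B * (LBINT x. norm (u (x + h n) - u x))) \<longlonglongrightarrow> B * 0"
    by (intro tendsto_intros L1_translate_tendsto u h)
  then show "(\<lambda>n. B * (LBINT x. norm (u (x + h n) - u x))) \<longlonglongrightarrow> 0" by simp
qed

lemma ft_acorr:
  assumes u: "integrable lborel u"
  shows "ft (acorr u) \<xi> = complex_of_real ((norm (ft u \<xi>))\<^sup>2)"
proof -
  have [measurable]: "u \<in> borel_measurable borel" using borel_measurable_integrable[OF u] by simp
  let ?e = "\<lambda>h. exp (- \<i> * complex_of_real (\<xi> * h))"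
  let ?f = "\<lambda>x h. ?e h * (u (x + h) * cnj (u x))"
  have int: "integrable (lborel \<Otimes>\<^sub>M lborel) (case_prod ?f)"
  proof (rule Bochner_Integration.integrable_bound[OF acorr_pair_integrable[OF u]])
    show "case_prod ?f \<in> borel_measurable (lborel \<Otimes>\<^sub>M lborel)" by measurable
    show "AE x in lborel \<Otimes>\<^sub>M lborel. norm (case x of (x, h) \<Rightarrow> ?f x h) \<le> norm (case x of (x, h) \<Rightarrow> u (x + h) * cnj (u x))"
      by (rule AE_I2) (simp only: split_beta norm_mult norm_exp_ii mult_1 order_refl)
  qed
  have "ft (acorr u) \<xi> = (LBINT h. (LBINT x. ?f x h))"
    unfolding ft_def acorr_def by (simp only: integral_mult_right_zero)
  also have "\<dots> = (LBINT x. (LBINT h. ?f x h))" by (rule lborel_pair.Fubini_integral[OF int])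
  also have "\<dots> = (LBINT x. ft u \<xi> * cnj (?e x * u x))"
  proof (rule Bochner_Integration.integral_cong[OF refl])
    fix x
    have "(LBINT h. ?f x h) = cnj (u x) * ft (\<lambda>h. u (h + x)) \<xi>"
      unfolding ft_def by (subst integral_mult_right_zero[symmetric]) (simp only: mult_ac add.commute)
    also have "\<dots> = cnj (u x) * (exp (\<i> * complex_of_real (\<xi> * x)) * ft u \<xi>)" unfolding ft_translate ..
    also have "\<dots> = ft u \<xi> * cnj (?e x * u x)" by (simp add: exp_cnj)
    finally show "(LBINT h. ?f x h) = ft u \<xi> * cnj (?e x * u x)" .
  qed
  also have "\<dots> = ft u \<xi> * cnj (ft u \<xi>)"
    unfolding ft_def by (simp only: integral_mult_right_zero Bochner_Integration.integral_cnj)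
  finally show ?thesis by (simp only: complex_norm_square)
qed

theorem Plancherel_BL1:
  assumes "BL1 u" shows "sqint (ft u)" "(nrm (ft u))\<^sup>2 = 2 * pi * (nrm u)\<^sup>2"
proof -
  have u: "integrable lborel u" using assms by (rule BL1_integrable)
  have [measurable]: "u \<in> borel_measurable borel" using borel_measurable_integrable[OF u] by simp
  obtain B where B: "\<And>x. norm (u x) \<le> B" using assms unfolding BL1_def by auto
  have A [measurable]: "acorr u \<in> borel_measurable borel"
    using borel_measurable_integrable[OF acorr_integrable[OF u]] by simp
  define g where "g n \<xi> = exp (- (\<xi> / real (Suc n))\<^sup>2 / 2)" for n \<xi>
  have gm [measurable]: "g n \<in> borel_measurable borel" for n unfolding g_def by measurable
  have g_alt: "g n \<xi> = sqrt (2 * pi) * std_normal_density (0 + 1 / real (Suc n) * \<xi>)" for n \<xi>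
    by (simp add: g_def std_normal_density_def)
  have gi: "integrable lborel (g n)" for n
    unfolding g_alt by (intro integrable_mult_right lborel_integrable_real_affine) auto
  define f where "f n \<xi> = (norm (ft u \<xi>))\<^sup>2 * g n \<xi>" for n \<xi>
  have fi: "integrable lborel (f n)" for n
  proof (rule Bochner_Integration.integrable_bound[where f="\<lambda>\<xi>. (LBINT x. norm (u x))\<^sup>2 * g n \<xi>"])
    show "integrable lborel (\<lambda>\<xi>. (LBINT x. norm (u x))\<^sup>2 * g n \<xi>)" using gi by simp
    have "norm (f n \<xi>) \<le> norm ((LBINT x. norm (u x))\<^sup>2 * g n \<xi>)" for \<xi>
      unfolding f_def using norm_ft_le[OF u, of \<xi>] by (auto simp: abs_mult g_def intro!: mult_right_mono power_mono)
    then show "AE x in lborel. norm (f n x) \<le> norm ((LBINT x. norm (u x))\<^sup>2 * g n x)" by simp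
    show "f n \<in> borel_measurable lborel" unfolding f_def by measurable
  qed
  \<comment> \<open>The multiplication formula moves the wide Gaussian in frequency onto a narrow
    one in space, so the left side becomes 2 pi times an average of \<open>acorr u\<close>
    concentrating at 0. The substitution x to x / (n + 1) fixes the density and shrinks the argument
    of \<open>acorr\<close> instead.\<close>
  have id: "complex_of_real (LBINT \<xi>. f n \<xi>)
     = complex_of_real (2 * pi) * (LBINT x. acorr u (x / real (Suc n)) * complex_of_real (std_normal_density x))" for n
  proof -
    have "complex_of_real (LBINT \<xi>. f n \<xi>) = (LBINT \<xi>. ft (acorr u) \<xi> * complex_of_real (g n \<xi>))"
      unfolding f_def by (simp add: ft_acorr[OF u] flip: integral_complex_of_real)
    also have "\<dots> = (LBINT x. acorr u x * ft (\<lambda>\<xi>. complex_of_real (g n \<xi>)) x)"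
      by (rule ft_mult_formula[OF acorr_integrable[OF u]]) (use gi in simp)
    also have "\<dots> = (LBINT x. complex_of_real (2 * pi * real (Suc n)) * (acorr u x * complex_of_real (std_normal_density (real (Suc n) * x))))"
      unfolding g_def by (subst ft_gaussian) (auto simp: mult_ac)
    also have "\<dots> = complex_of_real (2 * pi * real (Suc n)) * (LBINT x. acorr u x * complex_of_real (std_normal_density (real (Suc n) * x)))"
      by (rule integral_mult_right_zero)
    also have "(LBINT x. acorr u x * complex_of_real (std_normal_density (real (Suc n) * x)))
      = \<bar>1 / real (Suc n)\<bar> *\<^sub>R (LBINT x. acorr u (0 + 1 / real (Suc n) * x) * complex_of_real (std_normal_density (real (Suc n) * (0 + 1 / real (Suc n) * x))))"
      by (rule lborel_integral_real_affine) simp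
    finally show ?thesis by (simp add: scaleR_conv_of_real del: of_nat_Suc)
  qed
  have lim1: "(\<lambda>n. LBINT x. acorr u (x / real (Suc n)) * complex_of_real (std_normal_density x))
     \<longlonglongrightarrow> (LBINT x. acorr u 0 * complex_of_real (std_normal_density x))"
  proof (rule integral_dominated_convergence[where w="\<lambda>x. B * (LBINT x. norm (u x)) * std_normal_density x"])
    show "integrable lborel (\<lambda>x. B * (LBINT x. norm (u x)) * std_normal_density x)" by simp
    show "AE x in lborel. (\<lambda>n. acorr u (x / real (Suc n)) * complex_of_real (std_normal_density x)) \<longlonglongrightarrow> acorr u 0 * complex_of_real (std_normal_density x)"
    proof (rule AE_I2)
      fix x :: real
      have "(\<lambda>n. x / real (Suc n)) \<longlonglongrightarrow> 0" by (rule LIMSEQ_Suc) (rule lim_const_over_n)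
      from acorr_cont[OF u B this]
      show "(\<lambda>n. acorr u (x / real (Suc n)) * complex_of_real (std_normal_density x)) \<longlonglongrightarrow> acorr u 0 * complex_of_real (std_normal_density x)"
        by (intro tendsto_intros)
    qed
    show "AE x in lborel. norm (acorr u (x / real (Suc n)) * complex_of_real (std_normal_density x)) \<le> B * (LBINT x. norm (u x)) * std_normal_density x" for n
      using acorr_bound[OF u B] by (auto simp: norm_mult intro!: mult_right_mono)
  qed measurable
  have a0: "acorr u 0 = complex_of_real ((nrm u)\<^sup>2)"
    unfolding acorr_def nrm_sq integral_complex_of_real[symmetric] complex_norm_square by simp
  have s1: "(LBINT x. acorr u 0 * complex_of_real (std_normal_density x)) = acorr u 0"
  proof -
    have "(LBINT x. std_normal_density x) = 1"
      using integral_std_normal_moment_even[of 0] integral_normal_density by simp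
    then show ?thesis by simp
  qed
  have "(\<lambda>n. complex_of_real (LBINT \<xi>. f n \<xi>)) \<longlonglongrightarrow> complex_of_real (2 * pi) * complex_of_real ((nrm u)\<^sup>2)"
    unfolding id using tendsto_mult[OF tendsto_const lim1[unfolded s1]] unfolding a0 by blast
  then have "(\<lambda>n. Re (complex_of_real (LBINT \<xi>. f n \<xi>))) \<longlonglongrightarrow> Re (complex_of_real (2 * pi) * complex_of_real ((nrm u)\<^sup>2))"
    by (rule tendsto_Re)
  then have lim: "(\<lambda>n. LBINT \<xi>. f n \<xi>) \<longlonglongrightarrow> 2 * pi * (nrm u)\<^sup>2" by simp
  \<comment> \<open>Integrability of |ft u|^2 is not known beforehand. The Gaussians increase with
    n, so monotone convergence delivers it together with the value of the integral.\<close>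
  have mono: "AE x in lborel. mono (\<lambda>n. f n x)"
  proof (rule AE_I2, rule monoI)
    fix x and m n :: nat assume "m \<le> n"
    then have "(x / real (Suc n))\<^sup>2 \<le> (x / real (Suc m))\<^sup>2"
      unfolding power_divide by (intro divide_left_mono power_mono) auto
    then show "f m x \<le> f n x" unfolding f_def g_def by (intro mult_left_mono) auto
  qed
  have fl: "AE x in lborel. (\<lambda>n. f n x) \<longlonglongrightarrow> (norm (ft u x))\<^sup>2"
  proof (rule AE_I2)
    fix x
    have "(\<lambda>n. x / real (Suc n)) \<longlonglongrightarrow> 0" by (rule LIMSEQ_Suc) (rule lim_const_over_n)
    then have "(\<lambda>n. f n x) \<longlonglongrightarrow> (norm (ft u x))\<^sup>2 * exp (- 0\<^sup>2 / 2)"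
      unfolding f_def g_def by (intro tendsto_intros) auto
    then show "(\<lambda>n. f n x) \<longlonglongrightarrow> (norm (ft u x))\<^sup>2" by simp
  qed
  have m: "(\<lambda>x. (norm (ft u x))\<^sup>2) \<in> borel_measurable lborel" by measurable
  have "integrable lborel (\<lambda>x. (norm (ft u x))\<^sup>2)"
    by (rule integrable_monotone_convergence[OF fi mono fl lim m])
  then show "sqint (ft u)" by (simp add: sqint_def)
  show "(nrm (ft u))\<^sup>2 = 2 * pi * (nrm u)\<^sup>2"
    unfolding nrm_sq[of "ft u"] by (rule integral_monotone_convergence[OF fi mono fl lim m])
qed

lemma nrm_ft: assumes "BL1 u" shows "nrm (ft u) = sqrt (2 * pi) * nrm u"
proof -
  have "(nrm (ft u))\<^sup>2 = (sqrt (2 * pi) * nrm u)\<^sup>2" by (simp add: Plancherel_BL1(2)[OF assms] power_mult_distrib)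
  then show ?thesis by (simp add: power2_eq_iff_nonneg)
qed

section \<open>The Fourier transform on $L^2$\<close>

text \<open>The unitary extension of \<open>ft\<close> as a relation: \<open>g\<close> is an $L^2$ limit of transforms of bounded integrable
  functions converging to \<open>u\<close>.  It determines \<open>g\<close> from \<open>u\<close> only up to null sets.\<close>
definition Fr :: "(real \<Rightarrow> complex) \<Rightarrow> (real \<Rightarrow> complex) \<Rightarrow> bool" where
  "Fr u g \<longleftrightarrow> sqint u \<and> sqint g \<and> (\<exists>w. (\<forall>n. BL1 (w n)) \<and>
     (\<lambda>n. nrm (\<lambda>x. w n x - u x)) \<longlonglongrightarrow> 0 \<and> (\<lambda>n. nrm (\<lambda>\<xi>. ft (w n) \<xi> - g \<xi>)) \<longlonglongrightarrow> 0)"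

lemma Fr_sqint: assumes "Fr u g" shows "sqint u" "sqint g"
  using assms by (auto simp: Fr_def)

lemma FrE:
  assumes "Fr u g"
  obtains w where "\<And>n. BL1 (w n)" "(\<lambda>n. nrm (\<lambda>x. w n x - u x)) \<longlonglongrightarrow> 0" "(\<lambda>n. nrm (\<lambda>\<xi>. ft (w n) \<xi> - g \<xi>)) \<longlonglongrightarrow> 0"
  using assms unfolding Fr_def by blast

lemma FrI:
  assumes "sqint u" "sqint g" "\<And>n. BL1 (w n)" "(\<lambda>n. nrm (\<lambda>x. w n x - u x)) \<longlonglongrightarrow> 0" "(\<lambda>n. nrm (\<lambda>\<xi>. ft (w n) \<xi> - g \<xi>)) \<longlonglongrightarrow> 0"
  shows "Fr u g"
  using assms unfolding Fr_def by blast

lemma Fr_cong_AE: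
  assumes "Fr u g" "u' \<in> borel_measurable borel" "AE x in lborel. u x = u' x"
    "g' \<in> borel_measurable borel" "AE x in lborel. g x = g' x"
  shows "Fr u' g'"
proof -
  obtain w where w: "\<And>n. BL1 (w n)" "(\<lambda>n. nrm (\<lambda>x. w n x - u x)) \<longlonglongrightarrow> 0" "(\<lambda>n. nrm (\<lambda>\<xi>. ft (w n) \<xi> - g \<xi>)) \<longlonglongrightarrow> 0"
    using FrE[OF assms(1)] by blast
  have [measurable]: "u \<in> borel_measurable borel" "g \<in> borel_measurable borel" "w n \<in> borel_measurable borel" for n
    using Fr_sqint[OF assms(1)] w(1) by (auto intro: sqint_meas BL1_meas)
  note assms(2,4) [measurable]
  have "nrm (\<lambda>x. w n x - u x) = nrm (\<lambda>x. w n x - u' x)" for n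
    by (rule nrm_cong_AE) (use assms(3) in auto)
  moreover have "nrm (\<lambda>x. ft (w n) x - g x) = nrm (\<lambda>x. ft (w n) x - g' x)" for n
    by (rule nrm_cong_AE) (use assms(5) in auto)
  ultimately show ?thesis
    using w FrI[OF sqint_cong_AE[OF Fr_sqint(1)[OF assms(1)] assms(2,3)] sqint_cong_AE[OF Fr_sqint(2)[OF assms(1)] assms(4,5)]]
    by auto
qed

lemma Fr_add: assumes "Fr u g" "Fr v h" shows "Fr (\<lambda>x. u x + v x) (\<lambda>x. g x + h x)"
proof -
  note s = Fr_sqint[OF assms(1)] Fr_sqint[OF assms(2)]
  obtain w where w: "\<And>n. BL1 (w n)" "(\<lambda>n. nrm (\<lambda>x. w n x - u x)) \<longlonglongrightarrow> 0" "(\<lambda>n. nrm (\<lambda>\<xi>. ft (w n) \<xi> - g \<xi>)) \<longlonglongrightarrow> 0"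
    using FrE[OF assms(1)] by blast
  obtain z where z: "\<And>n. BL1 (z n)" "(\<lambda>n. nrm (\<lambda>x. z n x - v x)) \<longlonglongrightarrow> 0" "(\<lambda>n. nrm (\<lambda>\<xi>. ft (z n) \<xi> - h \<xi>)) \<longlonglongrightarrow> 0"
    using FrE[OF assms(2)] by blast
  have ft: "ft (\<lambda>x. w n x + z n x) \<xi> = ft (w n) \<xi> + ft (z n) \<xi>" for n \<xi>
    by (rule ft_add) (auto intro: BL1_integrable w z)
  have *: "(\<lambda>n. nrm (\<lambda>x. (a n x + b n x) - (a' x + b' x))) \<longlonglongrightarrow> 0"
    if "\<And>n. sqint (a n)" "\<And>n. sqint (b n)" "sqint a'" "sqint b'"
      "(\<lambda>n. nrm (\<lambda>x. a n x - a' x)) \<longlonglongrightarrow> 0" "(\<lambda>n. nrm (\<lambda>x. b n x - b' x)) \<longlonglongrightarrow> 0"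
    for a b :: "nat \<Rightarrow> real \<Rightarrow> complex" and a' b'
  proof (rule Lim_null_comparison)
    have e: "(a n x + b n x) - (a' x + b' x) = (a n x - a' x) + (b n x - b' x)" for n x by simp
    show "\<forall>\<^sub>F n in sequentially. norm (nrm (\<lambda>x. (a n x + b n x) - (a' x + b' x))) \<le> nrm (\<lambda>x. a n x - a' x) + nrm (\<lambda>x. b n x - b' x)"
      unfolding e using nrm_triangle[OF sqint_diff[OF that(1,3)] sqint_diff[OF that(2,4)]] by simp
    show "(\<lambda>n. nrm (\<lambda>x. a n x - a' x) + nrm (\<lambda>x. b n x - b' x)) \<longlonglongrightarrow> 0"
      using tendsto_add[OF that(5,6)] by simp
  qed
  show ?thesis
  proof (rule FrI[where w="\<lambda>n x. w n x + z n x"])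
    show "(\<lambda>n. nrm (\<lambda>x. w n x + z n x - (u x + v x))) \<longlonglongrightarrow> 0"
      by (rule *) (use s w z in \<open>auto intro: BL1_sqint\<close>)
    show "(\<lambda>n. nrm (\<lambda>\<xi>. ft (\<lambda>x. w n x + z n x) \<xi> - (g \<xi> + h \<xi>))) \<longlonglongrightarrow> 0"
      unfolding ft by (rule *) (use s w z in \<open>auto intro: Plancherel_BL1(1)\<close>)
  qed (use s w z in \<open>auto intro: sqint_add BL1_add\<close>)
qed

lemma Fr_cmult: assumes "Fr u g" shows "Fr (\<lambda>x. a * u x) (\<lambda>x. a * g x)"
proof -
  note s = Fr_sqint[OF assms(1)]
  obtain w where w: "\<And>n. BL1 (w n)" "(\<lambda>n. nrm (\<lambda>x. w n x - u x)) \<longlonglongrightarrow> 0" "(\<lambda>n. nrm (\<lambda>\<xi>. ft (w n) \<xi> - g \<xi>)) \<longlonglongrightarrow> 0"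
    using FrE[OF assms(1)] by blast
  show ?thesis
    by (rule FrI[where w="\<lambda>n x. a * w n x"])
      (use s w in \<open>auto intro: sqint_mult_left BL1_cmult tendsto_mult_right_zero
        simp: ft_cmult nrm_mult_left simp flip: right_diff_distrib\<close>)
qed

lemma Fr_diff: assumes "Fr u g" "Fr v h" shows "Fr (\<lambda>x. u x - v x) (\<lambda>x. g x - h x)"
  using Fr_add[OF assms(1) Fr_cmult[OF assms(2), of "-1"]] by simp

lemma Fr_reflect: assumes "Fr u g" shows "Fr (\<lambda>x. u (- x)) (\<lambda>x. g (- x))"
proof -
  note s = Fr_sqint[OF assms(1)]
  obtain w where w: "\<And>n. BL1 (w n)" "(\<lambda>n. nrm (\<lambda>x. w n x - u x)) \<longlonglongrightarrow> 0" "(\<lambda>n. nrm (\<lambda>\<xi>. ft (w n) \<xi> - g \<xi>)) \<longlonglongrightarrow> 0"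
    using FrE[OF assms(1)] by blast
  show ?thesis
  proof (rule FrI[where w="\<lambda>n x. w n (- x)"])
    show "(\<lambda>n. nrm (\<lambda>x. w n (- x) - u (- x))) \<longlonglongrightarrow> 0"
      using w(2) nrm_reflect[of "\<lambda>x. w _ x - u x"] by simp
    show "(\<lambda>n. nrm (\<lambda>\<xi>. ft (\<lambda>x. w n (- x)) \<xi> - g (- \<xi>))) \<longlonglongrightarrow> 0"
      unfolding ft_reflect using w(3) nrm_reflect[of "\<lambda>x. ft (w _) x - g x"] by simp
  qed (use s w in \<open>auto intro: sqint_reflect BL1_reflect\<close>)
qed

lemma nrm_cnj: "nrm (\<lambda>x. cnj (u x)) = nrm u"
  by (simp add: nrm_def)

lemma sqint_cnj: "sqint u \<Longrightarrow> sqint (\<lambda>x. cnj (u x))"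
  by (auto simp: sqint_def)

lemma Fr_cnj: assumes "Fr u g" shows "Fr (\<lambda>x. cnj (u x)) (\<lambda>x. cnj (g (- x)))"
proof -
  note s = Fr_sqint[OF assms(1)]
  obtain w where w: "\<And>n. BL1 (w n)" "(\<lambda>n. nrm (\<lambda>x. w n x - u x)) \<longlonglongrightarrow> 0" "(\<lambda>n. nrm (\<lambda>\<xi>. ft (w n) \<xi> - g \<xi>)) \<longlonglongrightarrow> 0"
    using FrE[OF assms(1)] by blast
  show ?thesis
  proof (rule FrI[where w="\<lambda>n x. cnj (w n x)"])
    show "(\<lambda>n. nrm (\<lambda>x. cnj (w n x) - cnj (u x))) \<longlonglongrightarrow> 0"
      using w(2) nrm_cnj[of "\<lambda>x. w _ x - u x"] by simp
    show "(\<lambda>n. nrm (\<lambda>\<xi>. ft (\<lambda>x. cnj (w n x)) \<xi> - cnj (g (- \<xi>)))) \<longlonglongrightarrow> 0"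
      unfolding ft_cnj using w(3) nrm_reflect[of "\<lambda>x. ft (w _) x - g x"] nrm_cnj[of "\<lambda>x. ft (w _) (-x) - g (-x)"] by simp
  qed (use s w in \<open>auto intro: sqint_cnj sqint_reflect BL1_cnj\<close>)
qed

lemma norm_exp_ii' [simp]: "norm (exp (\<i> * complex_of_real t)) = 1"
  using norm_exp_i_times[of t] by simp

lemma sqint_exp_mult: assumes "sqint g" shows "sqint (\<lambda>\<xi>. exp (\<i> * complex_of_real (\<xi> * h)) * g \<xi>)"
proof (rule sqint_bound[OF assms])
  have [measurable]: "g \<in> borel_measurable borel" using assms sqint_meas by auto
  show "(\<lambda>\<xi>. exp (\<i> * complex_of_real (\<xi> * h)) * g \<xi>) \<in> borel_measurable borel" by measurable
  show "AE x in lborel. norm (exp (\<i> * complex_of_real (x * h)) * g x) \<le> norm (g x)"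
    by (rule AE_I2) (simp only: norm_mult norm_exp_ii')
qed

lemma Fr_translate: assumes "Fr u g" shows "Fr (\<lambda>x. u (x + h)) (\<lambda>\<xi>. exp (\<i> * complex_of_real (\<xi> * h)) * g \<xi>)"
proof -
  note s = Fr_sqint[OF assms(1)]
  obtain w where w: "\<And>n. BL1 (w n)" "(\<lambda>n. nrm (\<lambda>x. w n x - u x)) \<longlonglongrightarrow> 0" "(\<lambda>n. nrm (\<lambda>\<xi>. ft (w n) \<xi> - g \<xi>)) \<longlonglongrightarrow> 0"
    using FrE[OF assms(1)] by blast
  show ?thesis
  proof (rule FrI[where w="\<lambda>n x. w n (x + h)"])
    show "(\<lambda>n. nrm (\<lambda>x. w n (x + h) - u (x + h))) \<longlonglongrightarrow> 0"
      using w(2) nrm_translate[of "\<lambda>x. w _ x - u x"] by simp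
    have "nrm (\<lambda>\<xi>. exp (\<i> * complex_of_real (\<xi> * h)) * ft (w n) \<xi> - exp (\<i> * complex_of_real (\<xi> * h)) * g \<xi>) = nrm (\<lambda>\<xi>. ft (w n) \<xi> - g \<xi>)" for n
      unfolding nrm_def right_diff_distrib[symmetric] norm_mult norm_exp_ii' by simp
    then show "(\<lambda>n. nrm (\<lambda>\<xi>. ft (\<lambda>x. w n (x + h)) \<xi> - exp (\<i> * complex_of_real (\<xi> * h)) * g \<xi>)) \<longlonglongrightarrow> 0"
      unfolding ft_translate using w(3) by simp
    show "sqint (\<lambda>\<xi>. exp (\<i> * complex_of_real (\<xi> * h)) * g \<xi>)" using s by (intro sqint_exp_mult)
  qed (use s w in \<open>auto intro: sqint_translate BL1_translate\<close>)
qed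

lemma Fr_nrm: assumes "Fr u g" shows "nrm g = sqrt (2 * pi) * nrm u"
proof -
  note s = Fr_sqint[OF assms(1)]
  obtain w where w: "\<And>n. BL1 (w n)" "(\<lambda>n. nrm (\<lambda>x. w n x - u x)) \<longlonglongrightarrow> 0" "(\<lambda>n. nrm (\<lambda>\<xi>. ft (w n) \<xi> - g \<xi>)) \<longlonglongrightarrow> 0"
    using FrE[OF assms(1)] by blast
  have 1: "(\<lambda>n. nrm (ft (w n))) \<longlonglongrightarrow> nrm g"
    by (rule nrm_tendsto) (use s w in \<open>auto intro: Plancherel_BL1(1)\<close>)
  have "(\<lambda>n. nrm (w n)) \<longlonglongrightarrow> nrm u"
    by (rule nrm_tendsto) (use s w in \<open>auto intro: BL1_sqint\<close>)
  then have 2: "(\<lambda>n. nrm (ft (w n))) \<longlonglongrightarrow> sqrt (2 * pi) * nrm u"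
    unfolding nrm_ft[OF w(1)] by (intro tendsto_intros)
  show ?thesis using LIMSEQ_unique[OF 1 2] .
qed

lemma Fr_nrm_sq: assumes "Fr u g" shows "(nrm g)\<^sup>2 = 2 * pi * (nrm u)\<^sup>2"
  by (simp add: Fr_nrm[OF assms] power_mult_distrib)

lemma Fr_BL1: assumes "BL1 u" shows "Fr u (ft u)"
  by (rule FrI[where w="\<lambda>n. u"]) (use assms in \<open>auto intro: BL1_sqint Plancherel_BL1(1) simp: nrm_def\<close>)

lemma Fr_unique: assumes "Fr u g" "Fr v h" "AE x in lborel. u x = v x" shows "AE x in lborel. g x = h x"
proof -
  note d = Fr_diff[OF assms(1,2)]
  have "nrm (\<lambda>x. u x - v x) = 0"
    using Fr_sqint(1)[OF d] assms(3) by (subst nrm_eq_0_iff) auto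
  then have "nrm (\<lambda>x. g x - h x) = 0" using Fr_nrm[OF d] by simp
  then show ?thesis using Fr_sqint(2)[OF d] by (subst (asm) nrm_eq_0_iff) auto
qed

text \<open>Polarization of the isometry. The inner product is the real one on the plane, that is,
  the real part of the Hermitian pairing.\<close>

lemma Fr_inner:
  assumes "Fr u g" "Fr v h"
  shows "(LBINT x. g x \<bullet> h x) = 2 * pi * (LBINT x. u x \<bullet> v x)"
proof -
  have 1: "(nrm (\<lambda>x. g x + h x))\<^sup>2 = 2 * pi * (nrm (\<lambda>x. u x + v x))\<^sup>2"
    by (rule Fr_nrm_sq[OF Fr_add[OF assms]])
  have "2 * (LBINT x. g x \<bullet> h x) = 2 * (2 * pi * (LBINT x. u x \<bullet> v x))"
    using 1 nrm_add_sq[OF Fr_sqint(2)[OF assms(1)] Fr_sqint(2)[OF assms(2)]]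
      nrm_add_sq[OF Fr_sqint(1)[OF assms(1)] Fr_sqint(1)[OF assms(2)]]
      Fr_nrm_sq[OF assms(1)] Fr_nrm_sq[OF assms(2)] by (simp add: algebra_simps)
  then show ?thesis by simp
qed

text \<open>Domain and values are cut at the same level, so one sequence lands in \<open>BL1\<close>
  for every measurable \<open>u\<close>, with errors dominated by \<open>u\<close> itself.\<close>

definition trnc :: "(real \<Rightarrow> complex) \<Rightarrow> nat \<Rightarrow> real \<Rightarrow> complex" where
  "trnc u n x = (if \<bar>x\<bar> \<le> real n \<and> norm (u x) \<le> real n then u x else 0)"

lemma trnc_BL1: assumes [measurable]: "u \<in> borel_measurable borel" shows "BL1 (trnc u n)"
proof -
  have m [measurable]: "trnc u n \<in> borel_measurable borel" unfolding trnc_def by measurable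
  have b: "norm (trnc u n x) \<le> real n" for x by (simp add: trnc_def)
  have "integrable lborel (trnc u n)"
  proof (rule integrableI_bounded_set[where A="{-real n..real n}" and B="real n"])
    show "AE x in lborel. x \<in> {- real n..real n} \<longrightarrow> norm (trnc u n x) \<le> real n" using b by auto
    show "AE x in lborel. x \<notin> {- real n..real n} \<longrightarrow> trnc u n x = 0" by (auto simp: trnc_def)
  qed auto
  then show ?thesis using b unfolding BL1_def by blast
qed

lemma trnc_tendsto: "(\<lambda>n. trnc u n x) \<longlonglongrightarrow> u x"
proof (rule tendsto_eventually)
  obtain N where "max \<bar>x\<bar> (norm (u x)) \<le> real N" using real_arch_simple by blast
  then show "\<forall>\<^sub>F n in sequentially. trnc u n x = u x"
    by (intro eventually_sequentiallyI[of N]) (auto simp: trnc_def)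
qed

lemma trnc_norm: "norm (trnc u n x - u x) \<le> norm (u x)"
  by (simp add: trnc_def)

lemma trnc_L2: assumes u: "sqint u" shows "(\<lambda>n. nrm (\<lambda>x. trnc u n x - u x)) \<longlonglongrightarrow> 0"
proof -
  have [measurable]: "u \<in> borel_measurable borel" using u sqint_meas by auto
  have [measurable]: "trnc u n \<in> borel_measurable borel" for n by (rule BL1_meas, rule trnc_BL1) simp
  have "(\<lambda>n. LBINT x. (norm (trnc u n x - u x))\<^sup>2) \<longlonglongrightarrow> (LBINT x. (norm (u x - u x))\<^sup>2)"
  proof (rule integral_dominated_convergence[where w="\<lambda>x. (norm (u x))\<^sup>2"])
    show "AE x in lborel. (\<lambda>n. (norm (trnc u n x - u x))\<^sup>2) \<longlonglongrightarrow> (norm (u x - u x))\<^sup>2"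
      by (rule AE_I2) (intro tendsto_intros trnc_tendsto)
    show "AE x in lborel. norm ((norm (trnc u n x - u x))\<^sup>2) \<le> (norm (u x))\<^sup>2" for n
      using trnc_norm by (auto intro!: power_mono)
  qed (use sqint_int[OF u] in measurable)
  from tendsto_real_sqrt[OF this] show ?thesis unfolding nrm_def by simp
qed

lemma L2_limit_Cauchy:
  assumes "\<And>n. sqint (u n)" "sqint v" "(\<lambda>n. nrm (\<lambda>x. u n x - v x)) \<longlonglongrightarrow> 0" "e > 0"
  shows "\<exists>N. \<forall>i\<ge>N. \<forall>j\<ge>N. nrm (\<lambda>x. u i x - u j x) < e"
proof -
  obtain N where N: "\<And>n. n \<ge> N \<Longrightarrow> nrm (\<lambda>x. u n x - v x) < e/2"
    using LIMSEQ_D[OF assms(3), of "e/2"] assms(4) by auto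
  have "nrm (\<lambda>x. u i x - u j x) < e" if "i \<ge> N" "j \<ge> N" for i j
    using nrm_triangle_diff[OF assms(1)[of i] assms(2) assms(1)[of j]] N[OF that(1)] N[OF that(2)]
      nrm_minus_commute[of v "u j"] by simp
  then show ?thesis by blast
qed

text \<open>On \<open>BL1\<close> the transform multiplies distances by sqrt (2 pi), so the
  transforms of the truncations form a Cauchy sequence, and L^2 is complete.\<close>

lemma Fr_exists: assumes u: "sqint u" obtains g where "Fr u g"
proof -
  have bl: "BL1 (trnc u n)" for n by (rule trnc_BL1[OF sqint_meas[OF u]])
  have e: "nrm (\<lambda>\<xi>. ft (trnc u i) \<xi> - ft (trnc u j) \<xi>) = sqrt (2 * pi) * nrm (\<lambda>x. trnc u i x - trnc u j x)" for i j
    by (rule Fr_nrm[OF Fr_diff[OF Fr_BL1[OF bl] Fr_BL1[OF bl]]])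
  have C: "\<exists>N. \<forall>i\<ge>N. \<forall>j\<ge>N. nrm (\<lambda>\<xi>. ft (trnc u i) \<xi> - ft (trnc u j) \<xi>) < e" if "e > 0" for e
  proof -
    have "e / sqrt (2 * pi) > 0" using that by simp
    from L2_limit_Cauchy[OF BL1_sqint[OF bl] u trnc_L2[OF u] this]
    show ?thesis unfolding e by (simp add: field_simps)
  qed
  obtain r g where "sqint g" "(\<lambda>n. nrm (\<lambda>x. ft (trnc u n) x - g x)) \<longlonglongrightarrow> 0"
    using L2_complete[OF Plancherel_BL1(1)[OF bl] C] by blast
  then show ?thesis using that FrI[OF u _ bl trnc_L2[OF u]] by blast
qed

text \<open>The limit \<open>v\<close> has some transform; the isometry forces the transforms of the
  sequence to converge to it as well, so it agrees with \<open>h\<close> almost everywhere.\<close>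

lemma Fr_closed:
  assumes "\<And>n. Fr (u n) (g n)" "sqint v" "sqint h"
    "(\<lambda>n. nrm (\<lambda>x. u n x - v x)) \<longlonglongrightarrow> 0" "(\<lambda>n. nrm (\<lambda>x. g n x - h x)) \<longlonglongrightarrow> 0"
  shows "Fr v h"
proof -
  obtain h' where h': "Fr v h'" using Fr_exists[OF assms(2)] .
  note s = Fr_sqint[OF assms(1)] Fr_sqint[OF h']
  have "nrm (\<lambda>x. h x - h' x) \<le> nrm (\<lambda>x. g n x - h x) + sqrt (2 * pi) * nrm (\<lambda>x. u n x - v x)" for n
    using nrm_triangle_diff[OF assms(3) s(2)[of n] s(4)] Fr_nrm[OF Fr_diff[OF assms(1)[of n] h']] nrm_minus_commute[of h "g n"]
    by simp
  then have "nrm (\<lambda>x. h x - h' x) \<le> 0 + sqrt (2 * pi) * 0"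
    by (intro tendsto_lowerbound[OF tendsto_add[OF assms(5) tendsto_mult[OF tendsto_const assms(4)]]]) auto
  then have "nrm (\<lambda>x. h x - h' x) = 0" using nrm_nonneg[of "\<lambda>x. h x - h' x"] by linarith
  then have "AE x in lborel. h' x = h x"
    using sqint_diff[OF assms(3) s(4)] by (subst (asm) nrm_eq_0_iff) auto
  then show ?thesis by (intro Fr_cong_AE[OF h']) (auto intro: sqint_meas assms)
qed

text \<open>For integrable but possibly unbounded \<open>u\<close>, as it occurs in
  \<open>fourier_trunc\<close>, the two notions of transform must be matched. Truncations converge
  in L^1, so their transforms converge pointwise to \<open>ft u\<close>, while a subsequence
  converges almost everywhere to the L^2 limit.\<close>

lemma Fr_ft: assumes u: "sqint u" "integrable lborel u" shows "Fr u (ft u)"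
proof -
  obtain g where g: "Fr u g" using Fr_exists[OF u(1)] .
  have [measurable]: "u \<in> borel_measurable borel" "g \<in> borel_measurable borel"
    using u Fr_sqint[OF g] sqint_meas by auto
  have bl: "BL1 (trnc u n)" for n by (rule trnc_BL1) simp
  have [measurable]: "trnc u n \<in> borel_measurable borel" for n using bl by (rule BL1_meas)
  note d = Fr_diff[OF Fr_BL1[OF bl] g]
  have lim0: "(\<lambda>n. nrm (\<lambda>\<xi>. ft (trnc u n) \<xi> - g \<xi>)) \<longlonglongrightarrow> 0"
    unfolding Fr_nrm[OF d] using tendsto_mult[OF tendsto_const trnc_L2[OF u(1)], of "sqrt (2*pi)"] by simp
  obtain r v where r: "strict_mono r" "sqint v" "AE x in lborel. (\<lambda>n. ft (trnc u (r n)) x) \<longlonglongrightarrow> v x"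
    and v: "(\<lambda>n. nrm (\<lambda>x. ft (trnc u n) x - v x)) \<longlonglongrightarrow> 0"
    using L2_complete[OF Plancherel_BL1(1)[OF bl] L2_limit_Cauchy[OF Plancherel_BL1(1)[OF bl] Fr_sqint(2)[OF g] lim0]] .
  have fv: "Fr u v"
    by (rule Fr_closed[OF Fr_BL1[OF bl] u(1) r(2) trnc_L2[OF u(1)] v])
  have l1: "(\<lambda>n. LBINT x. norm (trnc u n x - u x)) \<longlonglongrightarrow> (LBINT x. norm (u x - u x))"
  proof (rule integral_dominated_convergence[where w="\<lambda>x. norm (u x)"])
    show "AE x in lborel. (\<lambda>n. norm (trnc u n x - u x)) \<longlonglongrightarrow> norm (u x - u x)"
      by (rule AE_I2) (intro tendsto_intros trnc_tendsto)
    show "AE x in lborel. norm (norm (trnc u n x - u x)) \<le> norm (u x)" for n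
      using trnc_norm by auto
  qed (use u in auto)
  have pt: "(\<lambda>n. ft (trnc u n) \<xi>) \<longlonglongrightarrow> ft u \<xi>" for \<xi>
  proof (rule LIM_zero_cancel, rule Lim_null_comparison)
    show "\<forall>\<^sub>F n in sequentially. norm (ft (trnc u n) \<xi> - ft u \<xi>) \<le> (LBINT x. norm (trnc u n x - u x))"
    proof (rule always_eventually, rule allI)
      fix n
      have "ft (trnc u n) \<xi> - ft u \<xi> = ft (\<lambda>x. trnc u n x - u x) \<xi>"
        by (rule ft_diff[symmetric]) (auto intro: BL1_integrable bl u)
      then show "norm (ft (trnc u n) \<xi> - ft u \<xi>) \<le> (LBINT x. norm (trnc u n x - u x))"
        using norm_ft_le[of "\<lambda>x. trnc u n x - u x" \<xi>] BL1_integrable[OF bl] u(2) by simp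
    qed
    show "(\<lambda>n. LBINT x. norm (trnc u n x - u x)) \<longlonglongrightarrow> 0" using l1 by simp
  qed
  have "AE x in lborel. v x = ft u x"
    using r(3)
  proof eventually_elim
    fix x assume "(\<lambda>n. ft (trnc u (r n)) x) \<longlonglongrightarrow> v x"
    moreover have "(\<lambda>n. ft (trnc u (r n)) x) \<longlonglongrightarrow> ft u x"
      using LIMSEQ_subseq_LIMSEQ[OF pt r(1)] by (simp add: comp_def)
    ultimately show "v x = ft u x" by (rule LIMSEQ_unique)
  qed
  then show ?thesis by (intro Fr_cong_AE[OF fv]) auto
qed

text \<open>Since \<open>a \<bullet> cnj b\<close> is the real part of \<open>a * b\<close>, this is
  the real part of the multiplication formula, carried to L^2 by continuity.\<close>

lemma Fr_mult_formula:
  assumes "Fr u g" "Fr v h"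
  shows "(LBINT x. g x \<bullet> cnj (v x)) = (LBINT x. u x \<bullet> cnj (h x))"
proof -
  note s = Fr_sqint[OF assms(1)] Fr_sqint[OF assms(2)]
  obtain w where w: "\<And>n. BL1 (w n)" "(\<lambda>n. nrm (\<lambda>x. w n x - u x)) \<longlonglongrightarrow> 0" "(\<lambda>n. nrm (\<lambda>\<xi>. ft (w n) \<xi> - g \<xi>)) \<longlonglongrightarrow> 0"
    using FrE[OF assms(1)] by blast
  obtain z where z: "\<And>n. BL1 (z n)" "(\<lambda>n. nrm (\<lambda>x. z n x - v x)) \<longlonglongrightarrow> 0" "(\<lambda>n. nrm (\<lambda>\<xi>. ft (z n) \<xi> - h \<xi>)) \<longlonglongrightarrow> 0"
    using FrE[OF assms(2)] by blast
  have c: "nrm (\<lambda>x. cnj (a x) - cnj (b x)) = nrm (\<lambda>x. a x - b x)" for a b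
    using nrm_cnj[of "\<lambda>x. a x - b x"] by simp
  have inn: "a \<bullet> cnj b = Re (a * b)" for a b by (simp add: inner_complex_def)
  have 1: "(\<lambda>n. LBINT x. ft (w n) x \<bullet> cnj (z n x)) \<longlonglongrightarrow> (LBINT x. g x \<bullet> cnj (v x))"
    by (rule integral_inner_tendsto)
      (use s w z in \<open>auto simp: c intro: sqint_cnj BL1_sqint Plancherel_BL1(1)\<close>)
  have 2: "(\<lambda>n. LBINT x. w n x \<bullet> cnj (ft (z n) x)) \<longlonglongrightarrow> (LBINT x. u x \<bullet> cnj (h x))"
    by (rule integral_inner_tendsto)
      (use s w z in \<open>auto simp: c intro: sqint_cnj BL1_sqint Plancherel_BL1(1)\<close>)
  have prodint: "integrable lborel (\<lambda>x. a x * b x)" if "sqint a" "sqint b" for a b :: "real \<Rightarrow> complex"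
  proof (rule Bochner_Integration.integrable_bound[OF integrable_norm_prod[OF that]])
    have [measurable]: "a \<in> borel_measurable borel" "b \<in> borel_measurable borel" using that sqint_meas by auto
    show "(\<lambda>x. a x * b x) \<in> borel_measurable lborel" by measurable
  qed (simp add: norm_mult)
  have "(LBINT x. ft (w n) x \<bullet> cnj (z n x)) = (LBINT x. w n x \<bullet> cnj (ft (z n) x))" for n
  proof -
    have "(LBINT x. ft (w n) x \<bullet> cnj (z n x)) = Re (LBINT x. ft (w n) x * z n x)"
      unfolding inn by (rule integral_Re[OF prodint]) (auto intro: BL1_sqint Plancherel_BL1(1) w z)
    also have "\<dots> = Re (LBINT x. w n x * ft (z n) x)"
      by (subst ft_mult_formula) (auto intro: BL1_integrable w z)
    also have "\<dots> = (LBINT x. w n x \<bullet> cnj (ft (z n) x))"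
      unfolding inn by (rule integral_Re[OF prodint, symmetric]) (auto intro: BL1_sqint Plancherel_BL1(1) w z)
    finally show ?thesis .
  qed
  then show ?thesis using LIMSEQ_unique[OF 1] 2 by simp
qed

text \<open>No inversion integral is involved. Let \<open>h\<close> be a transform of
  \<open>g\<close> and \<open>d\<close> its deviation from the claimed function. Moving the
  transform across the pairing of \<open>h\<close> with \<open>d\<close>, and then applying
  Parseval, gives the pairing of the claimed function with \<open>d\<close>; subtracting, the norm
  of \<open>d\<close> is 0.\<close>

theorem Fr_inversion:
  assumes "Fr u g" shows "Fr g (\<lambda>x. complex_of_real (2 * pi) * u (- x))"
proof -
  note s = Fr_sqint[OF assms]
  obtain h where h: "Fr g h" using Fr_exists[OF s(2)] .
  define d where "d x = h x - complex_of_real (2 * pi) * u (- x)" for x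
  have sd: "sqint d" unfolding d_def by (intro sqint_diff sqint_mult_left sqint_reflect s Fr_sqint(2)[OF h])
  obtain e where e: "Fr (\<lambda>x. cnj (d x)) e" using Fr_exists[OF sqint_cnj[OF sd]] .
  \<comment> \<open>Reflection and conjugation turn the transform of \<open>cnj d\<close> into one
    of the reflected \<open>d\<close>, which is the form Parseval's identity needs.\<close>
  have rc: "Fr (\<lambda>x. d (- x)) (\<lambda>x. cnj (e x))"
    using Fr_reflect[OF Fr_cnj[OF e]] by simp
  have 1: "(LBINT x. h x \<bullet> d x) = (LBINT x. g x \<bullet> cnj (e x))"
    using Fr_mult_formula[OF h e] by simp
  have "(LBINT x. g x \<bullet> cnj (e x)) = 2 * pi * (LBINT x. u x \<bullet> d (- x))"
    by (rule Fr_inner[OF assms rc])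
  also have "(LBINT x. u x \<bullet> d (- x)) = (LBINT x. u (- x) \<bullet> d x)"
    using lborel_integral_real_affine[of "-1" "\<lambda>x. u (-x) \<bullet> d x" 0] by simp
  finally have 0: "(LBINT x. g x \<bullet> cnj (e x)) = 2 * pi * (LBINT x. u (- x) \<bullet> d x)" .
  have 2: "(LBINT x. h x \<bullet> d x) = (LBINT x. (complex_of_real (2 * pi) * u (- x)) \<bullet> d x)"
  proof -
    have "(complex_of_real (2 * pi) * z) \<bullet> y = 2 * pi * (z \<bullet> y)" for z y
      by (simp add: inner_complex_def algebra_simps)
    then show ?thesis unfolding 1 0 by simp
  qed
  have "(nrm d)\<^sup>2 = (LBINT x. d x \<bullet> d x)" by (simp add: nrm_sq power2_norm_eq_inner)
  also have "\<dots> = (LBINT x. h x \<bullet> d x - (complex_of_real (2 * pi) * u (- x)) \<bullet> d x)"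
    by (rule Bochner_Integration.integral_cong[OF refl]) (simp add: d_def inner_diff_left)
  also have "\<dots> = (LBINT x. h x \<bullet> d x) - (LBINT x. (complex_of_real (2 * pi) * u (- x)) \<bullet> d x)"
    by (rule Bochner_Integration.integral_diff)
      (intro integrable_inner sd sqint_mult_left sqint_reflect s Fr_sqint(2)[OF h])+
  also have "\<dots> = 0" using 2 by simp
  finally have "nrm d = 0" by simp
  then have "AE x in lborel. d x = 0" using nrm_eq_0_iff[OF sd] by simp
  then show ?thesis
    using sqint_meas[OF Fr_sqint(1)[OF h]] sqint_meas[OF Fr_sqint(2)[OF h]] sqint_meas[OF s(1)]
    by (intro Fr_cong_AE[OF h]) (auto simp: d_def)
qed

lemma Fr_injective: assumes "Fr u g" "Fr v h" "AE x in lborel. g x = h x" shows "AE x in lborel. u x = v x"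
proof -
  note d = Fr_diff[OF assms(1,2)]
  have "nrm (\<lambda>x. g x - h x) = 0"
    using Fr_sqint(2)[OF d] assms(3) by (subst nrm_eq_0_iff) auto
  then have "nrm (\<lambda>x. u x - v x) = 0" using Fr_nrm[OF d] by simp
  then show ?thesis using Fr_sqint(1)[OF d] by (subst (asm) nrm_eq_0_iff) auto
qed

text \<open>Inversion makes the transform onto; Hermitian symmetry of \<open>g\<close> says that the
  preimage and its conjugate have the same transform, so the preimage is real. This is the source of
  real functions with prescribed transforms, hence of the objects that \<open>Dhalf\<close>,
  \<open>hilbert\<close> and \<open>dinv\<close> select.\<close>

theorem Fr_surj_real:
  assumes g: "sqint g" and herm: "AE \<xi> in lborel. cnj (g (- \<xi>)) = g \<xi>"
  obtains u where "Fr (\<lambda>x. complex_of_real (u x)) g"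
proof -
  obtain v where v: "Fr g v" using Fr_exists[OF g] .
  define c where "c = complex_of_real (1 / (2 * pi))"
  define w where "w x = c * v (- x)" for x
  have c2: "c * (complex_of_real (2 * pi) * z) = z" for z by (simp add: c_def)
  have "Fr w (\<lambda>x. c * (complex_of_real (2 * pi) * g x))"
    unfolding w_def using Fr_cmult[OF Fr_reflect[OF Fr_inversion[OF v]], of c] by simp
  then have w: "Fr w g" unfolding c2 .
  have "AE x in lborel. cnj (w x) = w x"
    by (rule Fr_injective[OF Fr_cnj[OF w] w herm])
  then have r: "AE x in lborel. w x = complex_of_real (Re (w x))"
    by eventually_elim (metis Reals_cnj_iff of_real_Re)
  have [measurable]: "w \<in> borel_measurable borel" using Fr_sqint[OF w] sqint_meas by auto
  have "Fr (\<lambda>x. complex_of_real (Re (w x))) g"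
    by (rule Fr_cong_AE[OF w _ r]) (use sqint_meas[OF g] in auto)
  then show ?thesis by (rule that)
qed

lemma Fr_real_herm:
  assumes "Fr (\<lambda>x. complex_of_real (u x)) g" shows "AE \<xi> in lborel. cnj (g (- \<xi>)) = g \<xi>"
  using Fr_unique[OF Fr_cnj[OF assms] assms] by simp

section \<open>Functions with an $L^2$ modulus of continuity of order one half\<close>

text \<open>For fixed \<open>M\<close> and \<open>D\<close> this is a bounded set of the Besov space
  B^{1/2}_{2,infinity}, which contains H^{1/2}.\<close>

definition tbound :: "real \<Rightarrow> real \<Rightarrow> (real \<Rightarrow> real) \<Rightarrow> bool" where
  "tbound M D u \<longleftrightarrow> sqint u \<and> nrm u \<le> M \<and> (\<forall>h. nrm (\<lambda>x. u (x + h) - u x) \<le> D * sqrt \<bar>h\<bar>)"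

definition av :: "real \<Rightarrow> (real \<Rightarrow> real) \<Rightarrow> real \<Rightarrow> real" where
  "av d u x = (LBINT h. indicator {0..d} h * u (x + h)) / d"

lemma tbound_nonneg: assumes "tbound M D u" shows "0 \<le> M" "0 \<le> D"
proof -
  show "0 \<le> M" using assms nrm_nonneg[of u] unfolding tbound_def by linarith
  have "nrm (\<lambda>x. u (x + 1) - u x) \<le> D * sqrt \<bar>1\<bar>" using assms unfolding tbound_def by blast
  then show "0 \<le> D" by (simp add: order_trans[OF nrm_nonneg])
qed

lemma sqint_indicator: "sqint (indicator {a..b} :: real \<Rightarrow> real)"
  unfolding sqint_def by (auto simp: power2_eq_square integrable_indicator_iff emeasure_lborel_Icc_eq simp flip: indicator_inter_arith)

lemma nrm_indicator: "a \<le> b \<Longrightarrow> nrm (indicator {a..b} :: real \<Rightarrow> real) = sqrt (b - a)"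
  unfolding nrm_def by (simp add: power2_eq_square flip: indicator_inter_arith)

lemma interval_CS:
  fixes u :: "real \<Rightarrow> real"
  assumes "sqint u" "d > 0" shows "\<bar>LBINT h. indicator {0..d} h * u h\<bar> \<le> sqrt d * nrm u"
  using Cauchy_Schwarz_inner[OF sqint_indicator[of 0 d] assms(1)] assms(2) by (simp add: nrm_indicator inner_real_def)

lemma sqint_shift: "sqint u \<Longrightarrow> sqint (\<lambda>h. u (x + h))"
  using sqint_translate[of u x] by (simp add: add.commute)

lemma nrm_shift: "nrm (\<lambda>h. u (x + h)) = nrm u"
  using nrm_translate[of u x] by (simp add: add.commute)

lemma av_int:
  fixes u :: "real \<Rightarrow> real"
  assumes "sqint u" shows "integrable lborel (\<lambda>h. indicator {a..b} h * u (x + h))"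
  using integrable_inner[OF sqint_indicator sqint_shift[OF assms]] by simp

lemma av_bound: assumes "sqint u" "d > 0" shows "\<bar>av d u x\<bar> \<le> nrm u / sqrt d"
proof -
  have "\<bar>av d u x\<bar> \<le> (sqrt d * nrm u) / d"
    unfolding av_def using interval_CS[OF sqint_shift[OF assms(1), of x] assms(2)] assms(2)
    by (simp add: nrm_shift abs_divide divide_right_mono)
  also have "\<dots> = nrm u / sqrt d" using assms(2) by (simp add: real_sqrt_divide field_simps flip: real_sqrt_mult)
  finally show ?thesis .
qed

text \<open>Cauchy-Schwarz over the averaging interval. For |x - y| = d the bound is
  \<open>D\<close> at every scale: the scale invariance of the critical exponent 1/2.\<close>

lemma av_diff_shift:
  assumes "tbound M D u" "d > 0" shows "\<bar>av d u x - av d u y\<bar> \<le> D * sqrt \<bar>x - y\<bar> / sqrt d"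
proof -
  have u: "sqint u" and t: "nrm (\<lambda>h. u (h + (x - y)) - u h) \<le> D * sqrt \<bar>x - y\<bar>" using assms unfolding tbound_def by auto
  have n: "nrm (\<lambda>h. u (x + h) - u (y + h)) = nrm (\<lambda>h. u (h + (x - y)) - u h)"
    using nrm_shift[of "\<lambda>h. u (h + (x - y)) - u h" y] by (simp add: algebra_simps)
  have "av d u x - av d u y = (LBINT h. indicator {0..d} h * (u (x + h) - u (y + h))) / d"
    unfolding av_def using av_int[OF u] by (simp add: right_diff_distrib diff_divide_distrib)
  also have "\<bar>\<dots>\<bar> \<le> (sqrt d * nrm (\<lambda>h. u (x + h) - u (y + h))) / d"
    using interval_CS[OF sqint_diff[OF sqint_shift[OF u] sqint_shift[OF u]] assms(2)] assms(2)
    by (simp add: abs_divide divide_right_mono)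
  also have "\<dots> = nrm (\<lambda>h. u (x + h) - u (y + h)) / sqrt d" using assms(2) by (simp add: field_simps flip: real_sqrt_mult)
  also have "\<dots> \<le> D * sqrt \<bar>x - y\<bar> / sqrt d" using t n assms(2) by (simp add: divide_right_mono)
  finally show ?thesis .
qed

lemma av_halve:
  assumes "sqint u" "d > 0" shows "av d u x = (av (d/2) u x + av (d/2) u (x + d/2)) / 2"
proof -
  have [measurable]: "u \<in> borel_measurable borel" using assms sqint_meas by auto
  have 1: "(LBINT h. indicator {0..d/2} h * u (x + d/2 + h)) = (LBINT h. indicator {d/2..d} h * u (x + h))"
  proof -
    have "(LBINT h. indicator {d/2..d} h * u (x + h)) = (LBINT h. indicator {d/2..d} (h + d/2) * u (x + (h + d/2)))"
      by (rule integral_translate[symmetric])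
    also have "\<dots> = (LBINT h. indicator {0..d/2} h * u (x + d/2 + h))"
      by (rule Bochner_Integration.integral_cong) (auto simp: indicator_def algebra_simps)
    finally show ?thesis ..
  qed
  have "(LBINT h. indicator {0..d} h * u (x + h))
     = (LBINT h. indicator {0..d/2} h * u (x + h) + indicator {d/2..d} h * u (x + h))"
  proof (rule integral_cong_AE)
    \<comment> \<open>The two closed halves overlap in the midpoint, a null set.\<close>
    have "AE h in lborel. h \<noteq> d/2" by (rule AE_lborel_singleton)
    then show "AE h in lborel. indicator {0..d} h * u (x + h) = indicator {0..d/2} h * u (x + h) + indicator {d/2..d} h * u (x + h)"
      by eventually_elim (use assms(2) in \<open>auto simp: indicator_def\<close>)
  qed measurable
  also have "\<dots> = (LBINT h. indicator {0..d/2} h * u (x + h)) + (LBINT h. indicator {d/2..d} h * u (x + h))"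
    using av_int[OF assms(1)] by simp
  finally show ?thesis unfolding av_def 1 using assms(2) by (simp add: field_simps)
qed

text \<open>Halving the averaging interval changes the average by a bounded amount, so averages grow only
  logarithmically; this makes the superlevel sets of a function decay exponentially.\<close>
lemma av_log_bound:
  assumes "tbound M D u" shows "\<bar>av ((1/2)^k) u x\<bar> \<le> M + real k * D"
proof (induction k arbitrary: x)
  case 0
  have "sqint u" "nrm u \<le> M" using assms by (auto simp: tbound_def)
  then show ?case using av_bound[of u 1 x] by simp
next
  case (Suc k)
  have u: "sqint u" using assms by (auto simp: tbound_def)
  let ?d = "(1/2::real)^k"
  have d: "?d > 0" by simp
  have h: "av ?d u x = (av (?d/2) u x + av (?d/2) u (x + ?d/2)) / 2" by (rule av_halve[OF u d])
  \<comment> \<open>The shift equals the new averaging length, so the two square roots cancel and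
    only \<open>D\<close> is left.\<close>
  have "\<bar>av (?d/2) u x - av (?d/2) u (x + ?d/2)\<bar> \<le> D * sqrt \<bar>x - (x + ?d/2)\<bar> / sqrt (?d/2)"
    by (rule av_diff_shift[OF assms]) simp
  then have "\<bar>av (?d/2) u x - av (?d/2) u (x + ?d/2)\<bar> \<le> D" by simp
  then have "\<bar>av (?d/2) u x\<bar> \<le> \<bar>av ?d u x\<bar> + D" using h tbound_nonneg(2)[OF assms] by (simp add: abs_if split: if_splits)
  then show ?case using Suc[of x] by (simp add: algebra_simps)
qed

lemma av_measurable [measurable]:
  assumes [measurable]: "u \<in> borel_measurable borel" shows "av d u \<in> borel_measurable borel"
  unfolding av_def by measurable

text \<open>By Cauchy-Schwarz the squared deviation is at most the mean over h in [0, d] of |u(x +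
  h) - u(x)|^2. Tonelli exchanges the integrals and the translation bound D^2 h <= D^2 d finishes.
  Extended integrals are used because the difference is not yet known to be in L^2.\<close>

lemma av_approx:
  assumes t: "tbound M D u" and d: "d > 0"
  shows "sqint (\<lambda>x. u x - av d u x)" "nrm (\<lambda>x. u x - av d u x) \<le> D * sqrt d"
proof -
  have u: "sqint u" and th: "\<And>h. nrm (\<lambda>x. u (x + h) - u x) \<le> D * sqrt \<bar>h\<bar>" using t unfolding tbound_def by auto
  have [measurable]: "u \<in> borel_measurable borel" using sqint_meas[OF u] .
  have D: "D \<ge> 0" using tbound_nonneg[OF t] by simp
  have pt: "ennreal ((norm (u x - av d u x))\<^sup>2) \<le> ennreal (1/d) * (\<integral>\<^sup>+h. indicator {0..d} h * ennreal ((norm (u (x + h) - u x))\<^sup>2) \<partial>lborel)" for x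
  proof -
    let ?w = "\<lambda>h. indicator {0..d} h * (u (x + h) - u x)"
    have w: "sqint ?w"
    proof (rule sqint_bound)
      show "sqint (\<lambda>h. \<bar>u (x + h)\<bar> + \<bar>indicator {0..d} h * u x\<bar>)"
      proof (rule sqint_add)
        show "sqint (\<lambda>h. \<bar>u (x + h)\<bar>)" by (rule sqint_bound[OF sqint_shift[OF u, of x]]) auto
        show "sqint (\<lambda>h. \<bar>indicator {0..d} h * u x\<bar>)"
          by (rule sqint_bound[OF sqint_mult_left[OF sqint_indicator[of 0 d], of "u x"]]) (auto simp: indicator_def)
      qed
    qed (auto simp: indicator_def)
    have c: "(LBINT h. indicator {0..d} h * u x) = d * u x" using d by simp
    have i: "integrable lborel (\<lambda>h. indicator {0..d} h * u x)" using d by simp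
    have "av d u x - u x = (LBINT h. indicator {0..d} h * (u (x + h) - u x)) / d"
      unfolding right_diff_distrib av_def using av_int[OF u, of 0 d x] c i d by (simp add: field_simps)
    \<comment> \<open>A second copy of the indicator costs nothing. The increment alone is not in
      L^2 as a function of \<open>h\<close>, because of the constant \<open>u x\<close>; cut to the
      interval it is, as \<open>interval_CS\<close> requires.\<close>
    also have "\<dots> = (LBINT h. indicator {0..d} h * ?w h) / d"
      by (intro arg_cong2[where f="(/)"] Bochner_Integration.integral_cong) (auto simp: indicator_def)
    finally have "\<bar>u x - av d u x\<bar> = \<bar>LBINT h. indicator {0..d} h * ?w h\<bar> / d" using d by (metis abs_divide abs_minus_commute abs_of_pos)
    also have "\<dots> \<le> sqrt d * nrm ?w / d" using interval_CS[OF w d] d by (simp add: divide_right_mono)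
    finally have "\<bar>u x - av d u x\<bar> \<le> sqrt d * nrm ?w / d" .
    then have "\<bar>u x - av d u x\<bar>\<^sup>2 \<le> (sqrt d * nrm ?w / d)\<^sup>2" by (intro power_mono) auto
    also have "\<dots> = 1/d * (nrm ?w)\<^sup>2"
    proof -
      have "(sqrt d * y / d)\<^sup>2 = 1/d * y\<^sup>2" for y
        using d by (simp add: power_mult_distrib power_divide) (simp add: power2_eq_square)
      then show ?thesis .
    qed
    finally have "ennreal ((norm (u x - av d u x))\<^sup>2) \<le> ennreal (1/d * (nrm ?w)\<^sup>2)" by (simp add: ennreal_leI)
    also have "\<dots> = ennreal (1/d) * (\<integral>\<^sup>+h. ennreal ((norm (?w h))\<^sup>2) \<partial>lborel)"
      unfolding nn_integral_sqint[OF w] by (rule ennreal_mult) (use d in auto)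
    also have "(\<integral>\<^sup>+h. ennreal ((norm (?w h))\<^sup>2) \<partial>lborel) = (\<integral>\<^sup>+h. indicator {0..d} h * ennreal ((norm (u (x + h) - u x))\<^sup>2) \<partial>lborel)"
      by (rule nn_integral_cong) (auto simp: indicator_def)
    finally show ?thesis .
  qed
  have "(\<integral>\<^sup>+x. ennreal ((norm (u x - av d u x))\<^sup>2) \<partial>lborel)
     \<le> (\<integral>\<^sup>+x. ennreal (1/d) * (\<integral>\<^sup>+h. indicator {0..d} h * ennreal ((norm (u (x + h) - u x))\<^sup>2) \<partial>lborel) \<partial>lborel)"
    by (rule nn_integral_mono) (rule pt)
  also have "\<dots> = ennreal (1/d) * (\<integral>\<^sup>+x. (\<integral>\<^sup>+h. indicator {0..d} h * ennreal ((norm (u (x + h) - u x))\<^sup>2) \<partial>lborel) \<partial>lborel)"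
    by (rule nn_integral_cmult) measurable
  also have "(\<integral>\<^sup>+x. (\<integral>\<^sup>+h. indicator {0..d} h * ennreal ((norm (u (x + h) - u x))\<^sup>2) \<partial>lborel) \<partial>lborel)
     = (\<integral>\<^sup>+h. (\<integral>\<^sup>+x. indicator {0..d} h * ennreal ((norm (u (x + h) - u x))\<^sup>2) \<partial>lborel) \<partial>lborel)"
    by (rule lborel_pair.Fubini') measurable
  also have "\<dots> = (\<integral>\<^sup>+h. indicator {0..d} h * ennreal ((nrm (\<lambda>x. u (x + h) - u x))\<^sup>2) \<partial>lborel)"
    by (intro nn_integral_cong, subst nn_integral_cmult) (auto simp: nn_integral_sqint[OF sqint_diff[OF sqint_translate[OF u] u], simplified])
  also have "\<dots> \<le> (\<integral>\<^sup>+h. ennreal (D\<^sup>2 * d) * indicator {0..d} h \<partial>lborel)"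
  proof (rule nn_integral_mono)
    fix h
    have "(nrm (\<lambda>x. u (x + h) - u x))\<^sup>2 \<le> D\<^sup>2 * d" if "h \<in> {0..d}"
    proof -
      have "(nrm (\<lambda>x. u (x + h) - u x))\<^sup>2 \<le> (D * sqrt \<bar>h\<bar>)\<^sup>2" by (intro power_mono th) simp
      also have "\<dots> = D\<^sup>2 * h" using that by (simp add: power_mult_distrib)
      also have "\<dots> \<le> D\<^sup>2 * d" using that by (intro mult_left_mono) auto
      finally show ?thesis .
    qed
    then show "indicator {0..d} h * ennreal ((nrm (\<lambda>x. u (x + h) - u x))\<^sup>2) \<le> ennreal (D\<^sup>2 * d) * indicator {0..d} h"
      by (auto simp: indicator_def ennreal_leI)
  qed
  also have "\<dots> = ennreal (D\<^sup>2 * d) * ennreal d" using d by (subst nn_integral_cmult_indicator) auto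
  also have "ennreal (1/d) * (ennreal (D\<^sup>2 * d) * ennreal d) = ennreal ((D * sqrt d)\<^sup>2)"
    using d by (simp add: power_mult_distrib flip: ennreal_mult)
  finally have le: "(\<integral>\<^sup>+x. ennreal ((norm (u x - av d u x))\<^sup>2) \<partial>lborel) \<le> ennreal ((D * sqrt d)\<^sup>2)"
    by (simp add: mult_left_mono)
  show s: "sqint (\<lambda>x. u x - av d u x)"
    unfolding sqint_iff_nn using le by (auto simp: order_le_less_trans)
  have "(nrm (\<lambda>x. u x - av d u x))\<^sup>2 \<le> (D * sqrt d)\<^sup>2"
    using le unfolding nn_integral_sqint[OF s] by (subst (asm) ennreal_le_iff) auto
  then show "nrm (\<lambda>x. u x - av d u x) \<le> D * sqrt d"
    by (rule power2_le_imp_le) (use D d in simp)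
qed

text \<open>Where \<open>\<bar>u\<bar>\<close> exceeds twice its averages, it is at most twice its distance from them.\<close>
lemma level_set_bound:
  assumes t: "tbound M D u" and d: "d > 0" and l: "\<And>x. \<bar>av d u x\<bar> \<le> l"
  defines "v \<equiv> \<lambda>x. if \<bar>u x\<bar> > 2 * l then u x else 0"
  shows "sqint v" "nrm v \<le> 2 * D * sqrt d"
proof -
  have u: "sqint u" using t unfolding tbound_def by auto
  have [measurable]: "u \<in> borel_measurable borel" using sqint_meas[OF u] .
  have [measurable]: "v \<in> borel_measurable borel" unfolding v_def by measurable
  show s: "sqint v" by (rule sqint_bound[OF u]) (auto simp: v_def)
  note a = av_approx[OF t d]
  have "nrm v \<le> nrm (\<lambda>x. 2 * (u x - av d u x))"
  proof (rule nrm_mono[OF sqint_mult_left[OF a(1)] s], rule AE_I2)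
    fix x show "norm (v x) \<le> norm (2 * (u x - av d u x))" using l[of x] by (auto simp: v_def)
  qed
  also have "\<dots> = 2 * nrm (\<lambda>x. u x - av d u x)"
    by (rule nrm_mult_left[THEN trans]) simp
  finally show "nrm v \<le> 2 * D * sqrt d" using a(2) by simp
qed

section \<open>Embedding into L^q and exclusion of vanishing\<close>

lemma sobolev_series:
  fixes L a :: real assumes "L > 0"
  shows "summable (\<lambda>k::nat. (2 * (real k + 2) * L) powr a * (1/2)^k)"
proof -
  have "(\<lambda>k::nat. (2 * (real k + 2) * L) powr a * (1/2)^k) \<in> O(\<lambda>k. inverse (real k ^ 2))"
    using assms by real_asymp
  then show ?thesis
    by (rule summable_comparison_test_bigo[rotated]) (use inverse_power_summable[of 2] in simp)
qed

text \<open>Either |y| <= 2 L, or |y| lies in a layer 2 (k + 1) L < |y| <= 2 (k + 2) L, and then the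
  single term with this k dominates. The series form integrates term by term without a partition of
  the line.\<close>

lemma sobolev_pointwise:
  fixes y L q :: real
  assumes L: "L > 0" and q: "q > 2"
  shows "ennreal (\<bar>y\<bar> powr q) \<le> ennreal ((2 * L) powr (q - 2) * y\<^sup>2)
    + (\<Sum>k. ennreal ((2 * (real k + 2) * L) powr (q - 2) * (if \<bar>y\<bar> > 2 * ((real k + 1) * L) then y\<^sup>2 else 0)))"
proof -
  have pw: "\<bar>y\<bar> powr q \<le> b powr (q - 2) * y\<^sup>2" if "\<bar>y\<bar> \<le> b" "b > 0" for b
  proof (cases "y = 0")
    case False
    have "\<bar>y\<bar> powr q = \<bar>y\<bar> powr (q - 2) * \<bar>y\<bar> powr 2" using powr_add[of "\<bar>y\<bar>" "q - 2" 2] by simp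
    also have "\<bar>y\<bar> powr 2 = y\<^sup>2" using False by simp
    also have "\<bar>y\<bar> powr (q - 2) * y\<^sup>2 \<le> b powr (q - 2) * y\<^sup>2"
      using that q by (intro mult_right_mono powr_mono2) auto
    finally show ?thesis .
  qed (use q in simp)
  let ?f = "\<lambda>k::nat. ennreal ((2 * (real k + 2) * L) powr (q - 2) * (if \<bar>y\<bar> > 2 * ((real k + 1) * L) then y\<^sup>2 else 0))"
  show ?thesis
  proof (cases "\<bar>y\<bar> \<le> 2 * L")
    case True
    then show ?thesis using pw[OF True] L by (intro add_increasing2 ennreal_leI) auto
  next
    case False
    \<comment> \<open>\<open>m\<close> counts the layers of height 2 L up to |y|. The lowest is
      taken by the first summand, so m is at least 2 and the series index is m - 2.\<close>
    define m where "m = nat \<lceil>\<bar>y\<bar> / (2 * L)\<rceil>"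
    have r: "\<bar>y\<bar> / (2 * L) > 1" using False L by (simp add: field_simps)
    have m1: "real m \<ge> \<bar>y\<bar> / (2 * L)" unfolding m_def using r by linarith
    have m2: "real m < \<bar>y\<bar> / (2 * L) + 1" unfolding m_def using r by linarith
    have m3: "m \<ge> 2" using m1 r by linarith
    define k where "k = m - 2"
    have k: "real m = real k + 2" using m3 by (simp add: k_def)
    have 1: "\<bar>y\<bar> \<le> 2 * (real k + 2) * L" using m1 L unfolding k by (simp add: field_simps)
    have 2: "\<bar>y\<bar> > 2 * ((real k + 1) * L)" using m2 L unfolding k by (simp add: field_simps)
    have "\<bar>y\<bar> powr q \<le> (2 * (real k + 2) * L) powr (q - 2) * y\<^sup>2"
      by (rule pw[OF 1]) (use L in simp)
    then have "ennreal (\<bar>y\<bar> powr q) \<le> ?f k" using 2 by (simp add: ennreal_leI)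
    also have "?f k = (\<Sum>i\<in>{k}. ?f i)" by simp
    also have "\<dots> \<le> (\<Sum>k. ?f k)" by (rule sum_le_suminf) auto
    also have "\<dots> \<le> ennreal ((2 * L) powr (q - 2) * y\<^sup>2) + (\<Sum>k. ?f k)" by (rule add_increasing) simp_all
    finally show ?thesis .
  qed
qed

text \<open>At scale 2^{-k} the averages are at most (k + 1) L, so the part of \<open>u\<close>
  above 2 (k + 1) L has squared norm at most 4 D^2 2^{-k} by \<open>level_set_bound\<close>.
  Inserted into the layer decomposition this leaves a series of a power of k against 2^{-k},
  depending only on q, M and D.\<close>

theorem sobolev_embedding:
  assumes q: "(q::real) > 2" and M: "M \<ge> 0" and D: "D \<ge> 0"
  obtains C where "C \<ge> 0" "\<And>u. tbound M D u \<Longrightarrow> integrable lborel (\<lambda>x. \<bar>u x\<bar> powr q)"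
    "\<And>u. tbound M D u \<Longrightarrow> (LBINT x. \<bar>u x\<bar> powr q) \<le> C"
proof -
  \<comment> \<open>Chosen so that M + k D <= (k + 1) L; the summand 1 keeps it positive when M and
    D vanish.\<close>
  define L where "L = M + D + 1"
  have L: "L > 0" using M D by (simp add: L_def)
  define c where "c k = (2 * (real k + 2) * L) powr (q - 2) * (4 * D\<^sup>2 * (1/2)^k)" for k :: nat
  have c0: "c k \<ge> 0" for k by (simp add: c_def)
  have cs: "summable c"
  proof -
    have "c = (\<lambda>k. 4 * D\<^sup>2 * ((2 * (real k + 2) * L) powr (q - 2) * (1/2)^k))" by (auto simp: c_def)
    then show ?thesis using summable_mult[OF sobolev_series[OF L]] by simp
  qed
  define C where "C = (2 * L) powr (q - 2) * M\<^sup>2 + suminf c"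
  have C: "C \<ge> 0" unfolding C_def using suminf_nonneg[OF cs c0] by simp
  have main: "(\<integral>\<^sup>+x. ennreal (\<bar>u x\<bar> powr q) \<partial>lborel) \<le> ennreal C" if t: "tbound M D u" for u
  proof -
    have u: "sqint u" "nrm u \<le> M" using t unfolding tbound_def by auto
    have [measurable]: "u \<in> borel_measurable borel" using sqint_meas[OF u(1)] .
    let ?v = "\<lambda>k x. if \<bar>u x\<bar> > 2 * ((real k + 1) * L) then u x else 0"
    have v: "sqint (?v k)" "(nrm (?v k))\<^sup>2 \<le> 4 * D\<^sup>2 * (1/2)^k" for k :: nat
    proof -
      have "\<bar>av ((1/2)^k) u x\<bar> \<le> (real k + 1) * L" for x
      proof -
        have "\<bar>av ((1/2)^k) u x\<bar> \<le> M + real k * D" by (rule av_log_bound[OF t])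
        also have "\<dots> \<le> (real k + 1) * L" using M D by (simp add: L_def algebra_simps)
        finally show ?thesis .
      qed
      note lb = level_set_bound[OF t _ this]
      show "sqint (?v k)" by (rule lb(1)) simp
      have "nrm (?v k) \<le> 2 * D * sqrt ((1/2)^k)" by (rule lb(2)) simp
      then have "(nrm (?v k))\<^sup>2 \<le> (2 * D * sqrt ((1/2)^k))\<^sup>2" by (intro power_mono) auto
      then show "(nrm (?v k))\<^sup>2 \<le> 4 * D\<^sup>2 * (1/2)^k" by (simp add: power_mult_distrib)
    qed
    have e: "ennreal ((2 * (real k + 2) * L) powr (q - 2) * (if \<bar>u x\<bar> > 2 * ((real k + 1) * L) then (u x)\<^sup>2 else 0))
       = ennreal ((2 * (real k + 2) * L) powr (q - 2)) * ennreal ((norm (?v k x))\<^sup>2)" for k x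
      by (simp add: ennreal_mult)
    have "(\<integral>\<^sup>+x. ennreal (\<bar>u x\<bar> powr q) \<partial>lborel) \<le> (\<integral>\<^sup>+x. (ennreal ((2 * L) powr (q - 2) * (u x)\<^sup>2)
        + (\<Sum>k. ennreal ((2 * (real k + 2) * L) powr (q - 2)) * ennreal ((norm (?v k x))\<^sup>2))) \<partial>lborel)"
      unfolding e[symmetric] by (intro nn_integral_mono sobolev_pointwise[OF L q])
    also have "\<dots> = (\<integral>\<^sup>+x. ennreal ((2 * L) powr (q - 2) * (u x)\<^sup>2) \<partial>lborel)
        + (\<integral>\<^sup>+x. (\<Sum>k. ennreal ((2 * (real k + 2) * L) powr (q - 2)) * ennreal ((norm (?v k x))\<^sup>2)) \<partial>lborel)"
      by (rule nn_integral_add) measurable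
    also have "(\<integral>\<^sup>+x. (\<Sum>k. ennreal ((2 * (real k + 2) * L) powr (q - 2)) * ennreal ((norm (?v k x))\<^sup>2)) \<partial>lborel)
       = (\<Sum>k. \<integral>\<^sup>+x. ennreal ((2 * (real k + 2) * L) powr (q - 2)) * ennreal ((norm (?v k x))\<^sup>2) \<partial>lborel)"
      by (rule nn_integral_suminf) measurable
    also have "\<dots> \<le> (\<Sum>k. ennreal (c k))"
    proof (rule suminf_le)
      fix k
      have "(\<integral>\<^sup>+x. ennreal ((2 * (real k + 2) * L) powr (q - 2)) * ennreal ((norm (?v k x))\<^sup>2) \<partial>lborel)
         = ennreal ((2 * (real k + 2) * L) powr (q - 2)) * (\<integral>\<^sup>+x. ennreal ((norm (?v k x))\<^sup>2) \<partial>lborel)"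
        by (rule nn_integral_cmult) measurable
      also have "\<dots> = ennreal ((2 * (real k + 2) * L) powr (q - 2) * (nrm (?v k))\<^sup>2)"
        by (simp only: nn_integral_sqint[OF v(1)] ennreal_mult powr_ge_zero zero_le_power2)
      also have "\<dots> \<le> ennreal (c k)" unfolding c_def by (intro ennreal_leI mult_left_mono v(2)) simp
      finally show "(\<integral>\<^sup>+x. ennreal ((2 * (real k + 2) * L) powr (q - 2)) * ennreal ((norm (?v k x))\<^sup>2) \<partial>lborel) \<le> ennreal (c k)" .
    qed auto
    also have "(\<Sum>k. ennreal (c k)) = ennreal (suminf c)" by (rule suminf_ennreal2[OF c0 cs])
    also have "(\<integral>\<^sup>+x. ennreal ((2 * L) powr (q - 2) * (u x)\<^sup>2) \<partial>lborel) \<le> ennreal ((2 * L) powr (q - 2) * M\<^sup>2)"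
    proof -
      have "(\<integral>\<^sup>+x. ennreal ((2 * L) powr (q - 2) * (u x)\<^sup>2) \<partial>lborel) = (\<integral>\<^sup>+x. ennreal ((2 * L) powr (q - 2)) * ennreal ((norm (u x))\<^sup>2) \<partial>lborel)"
        by (simp add: ennreal_mult)
      also have "\<dots> = ennreal ((2 * L) powr (q - 2)) * (\<integral>\<^sup>+x. ennreal ((norm (u x))\<^sup>2) \<partial>lborel)"
        by (rule nn_integral_cmult) measurable
      also have "\<dots> = ennreal ((2 * L) powr (q - 2) * (nrm u)\<^sup>2)"
        by (simp only: nn_integral_sqint[OF u(1)] ennreal_mult powr_ge_zero zero_le_power2)
      also have "\<dots> \<le> ennreal ((2 * L) powr (q - 2) * M\<^sup>2)"
        by (intro ennreal_leI mult_left_mono power_mono u(2)) auto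
      finally show ?thesis .
    qed
    finally show ?thesis unfolding C_def using suminf_nonneg[OF cs c0] by (simp add: ennreal_plus add_right_mono)
  qed
  have int: "integrable lborel (\<lambda>x. \<bar>u x\<bar> powr q)" if t: "tbound M D u" for u
  proof (rule integrableI_nonneg)
    have [measurable]: "u \<in> borel_measurable borel" using t sqint_meas unfolding tbound_def by auto
    show "(\<lambda>x. \<bar>u x\<bar> powr q) \<in> borel_measurable lborel" by measurable
    show "(\<integral>\<^sup>+x. ennreal (\<bar>u x\<bar> powr q) \<partial>lborel) < \<infinity>" using main[OF t] by (auto simp: order_le_less_trans)
  qed simp
  have "(LBINT x. \<bar>u x\<bar> powr q) \<le> C" if t: "tbound M D u" for u
    using main[OF t] nn_integral_eq_integral[OF int[OF t]] C by simp
  then show ?thesis using that C int by blast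
qed

text \<open>If all averages at scale \<open>d\<close> are at most \<open>\<eta>\<close>, the part of
  \<open>u\<close> with |u| <= 2 \<open>\<eta>\<close> contributes at most (2
  \<open>\<eta>\<close>)^{q-2} M^2. The rest has norm at most 2 D sqrt d and is paired with
  |u|^{q-1}, which is in L^2 by the embedding with exponent 2 q - 2 > 2. Both contributions are made
  smaller than e / 4 by choices that do not involve \<open>u\<close>.\<close>

theorem nonvanishing:
  assumes q: "(q::real) > 2" and M: "M \<ge> 0" and D: "D \<ge> 0" and e: "e > 0"
  obtains d \<eta> where "d > 0" "\<eta> > 0"
    "\<And>u. tbound M D u \<Longrightarrow> (LBINT x. \<bar>u x\<bar> powr q) \<ge> e \<Longrightarrow> \<exists>y. \<bar>av d u y\<bar> \<ge> \<eta>"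
proof -
  have q2: "2 * q - 2 > 2" using q by simp
  obtain C where C: "C \<ge> 0" "\<And>u. tbound M D u \<Longrightarrow> integrable lborel (\<lambda>x. \<bar>u x\<bar> powr (2 * q - 2))"
    "\<And>u. tbound M D u \<Longrightarrow> (LBINT x. \<bar>u x\<bar> powr (2 * q - 2)) \<le> C"
    using sobolev_embedding[OF q2 M D] by blast
  obtain C' where C': "\<And>u. tbound M D u \<Longrightarrow> integrable lborel (\<lambda>x. \<bar>u x\<bar> powr q)"
    using sobolev_embedding[OF q M D] by blast
  have "((\<lambda>d. 2 * D * sqrt d * sqrt C) \<longlongrightarrow> 2 * D * sqrt 0 * sqrt C) (at_right 0)" by (intro tendsto_intros)
  then have "\<forall>\<^sub>F d in at_right 0. 2 * D * sqrt d * sqrt C < e / 4"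
    by (rule order_tendstoD) (use e in simp)
  then have "\<forall>\<^sub>F d in at_right 0. d > 0 \<and> 2 * D * sqrt d * sqrt C < e / 4"
    using eventually_at_right_less[of "0::real"] by eventually_elim auto
  then obtain d where d: "d > 0" "2 * D * sqrt d * sqrt C < e / 4"
    using eventually_happens'[OF trivial_limit_at_right_real] by blast
  have "((\<lambda>\<eta>. (2 * \<eta>) powr (q - 2) * M\<^sup>2) \<longlongrightarrow> (2 * 0) powr (q - 2) * M\<^sup>2) (at_right 0)"
    using q by (intro tendsto_intros) (auto intro!: eventually_mono[OF eventually_at_right_less])
  then have "\<forall>\<^sub>F \<eta> in at_right 0. (2 * \<eta>) powr (q - 2) * M\<^sup>2 < e / 4"
    by (rule order_tendstoD) (use e in simp)
  then have "\<forall>\<^sub>F \<eta> in at_right 0. \<eta> > 0 \<and> (2 * \<eta>) powr (q - 2) * M\<^sup>2 < e / 4"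
    using eventually_at_right_less[of "0::real"] by eventually_elim auto
  then obtain \<eta> where \<eta>: "\<eta> > 0" "(2 * \<eta>) powr (q - 2) * M\<^sup>2 < e / 4"
    using eventually_happens'[OF trivial_limit_at_right_real] by blast
  have "\<exists>y. \<bar>av d u y\<bar> \<ge> \<eta>" if t: "tbound M D u" and ge: "(LBINT x. \<bar>u x\<bar> powr q) \<ge> e" for u
  proof (rule ccontr)
    assume "\<not> (\<exists>y. \<bar>av d u y\<bar> \<ge> \<eta>)"
    then have l: "\<And>y. \<bar>av d u y\<bar> \<le> \<eta>" by (meson linear)
    have u: "sqint u" "nrm u \<le> M" using t unfolding tbound_def by auto
    have [measurable]: "u \<in> borel_measurable borel" using sqint_meas[OF u(1)] .
    define v where "v x = (if \<bar>u x\<bar> > 2 * \<eta> then u x else 0)" for x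
    have v: "sqint v" "nrm v \<le> 2 * D * sqrt d"
      using level_set_bound[OF t d(1) l] unfolding v_def by auto
    define w where "w x = \<bar>u x\<bar> powr (q - 1)" for x
    have w2: "(norm (w x))\<^sup>2 = \<bar>u x\<bar> powr (2 * q - 2)" for x
      by (simp add: w_def power2_eq_square flip: powr_add)
    have [measurable]: "w \<in> borel_measurable borel" unfolding w_def by measurable
    have w: "sqint w" unfolding sqint_def w2 using C(2)[OF t] by simp
    have nw: "nrm w \<le> sqrt C" unfolding nrm_def w2 using C(3)[OF t] by simp
    have pt: "\<bar>u x\<bar> powr q \<le> (2 * \<eta>) powr (q - 2) * (norm (u x))\<^sup>2 + norm (v x) * norm (w x)" for x
    proof (cases "u x = 0")
      case False
      show ?thesis
      proof (cases "\<bar>u x\<bar> > 2 * \<eta>")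
        case True
        have "\<bar>u x\<bar> powr q = \<bar>u x\<bar> powr 1 * \<bar>u x\<bar> powr (q - 1)" using powr_add[of "\<bar>u x\<bar>" 1 "q - 1"] by simp
        then have "\<bar>u x\<bar> powr q = norm (v x) * norm (w x)" using True by (simp add: v_def w_def)
        then show ?thesis by simp
      next
        case le: False
        have "\<bar>u x\<bar> powr q = \<bar>u x\<bar> powr (q - 2) * \<bar>u x\<bar> powr 2" using powr_add[of "\<bar>u x\<bar>" "q - 2" 2] by simp
        also have "\<bar>u x\<bar> powr 2 = (norm (u x))\<^sup>2" using False by simp
        also have "\<bar>u x\<bar> powr (q - 2) * (norm (u x))\<^sup>2 \<le> (2 * \<eta>) powr (q - 2) * (norm (u x))\<^sup>2"
          using q le by (intro mult_right_mono powr_mono2) auto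
        finally show ?thesis by (simp add: add_increasing2)
      qed
    qed (use q in simp)
    have "(LBINT x. \<bar>u x\<bar> powr q) \<le> (LBINT x. (2 * \<eta>) powr (q - 2) * (norm (u x))\<^sup>2 + norm (v x) * norm (w x))"
      by (rule integral_mono) (use C'[OF t] sqint_int[OF u(1)] integrable_norm_prod[OF v(1) w] pt in auto)
    also have "\<dots> = (2 * \<eta>) powr (q - 2) * (nrm u)\<^sup>2 + (LBINT x. norm (v x) * norm (w x))"
      using sqint_int[OF u(1)] integrable_norm_prod[OF v(1) w] by (simp add: nrm_sq)
    also have "\<dots> \<le> (2 * \<eta>) powr (q - 2) * M\<^sup>2 + 2 * D * sqrt d * sqrt C"
    proof (rule add_mono)
      show "(2 * \<eta>) powr (q - 2) * (nrm u)\<^sup>2 \<le> (2 * \<eta>) powr (q - 2) * M\<^sup>2"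
        by (intro mult_left_mono power_mono u(2)) auto
      have "(LBINT x. norm (v x) * norm (w x)) \<le> nrm v * nrm w" by (rule Cauchy_Schwarz_norm[OF v(1) w])
      also have "\<dots> \<le> 2 * D * sqrt d * sqrt C" using v(2) nw d D by (intro mult_mono) auto
      finally show "(LBINT x. norm (v x) * norm (w x)) \<le> 2 * D * sqrt d * sqrt C" .
    qed
    also have "\<dots> < e" using d(2) \<eta>(2) e by linarith
    finally show False using ge by simp
  qed
  then show ?thesis using that d(1) \<eta>(1) by blast
qed

text \<open>A diagonal subsequence makes all dyadic averages converge at rational points; their
  common Hoelder bound extends this to every point. At a fixed scale the averages are bounded, so
  with a Gaussian weight they converge in L^2, and \<open>av_approx\<close> makes them uniformly
  close to the functions. Hence the functions are Cauchy in weighted L^2.\<close>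

theorem local_compactness:
  fixes u :: "nat \<Rightarrow> real \<Rightarrow> real"
  assumes t: "\<And>n. tbound M D (u n)"
  obtains r v where "strict_mono r" "v \<in> borel_measurable borel" "AE x in lborel. (\<lambda>n. u (r n) x) \<longlonglongrightarrow> v x"
proof -
  have u: "\<And>n. sqint (u n)" using t unfolding tbound_def by auto
  have [measurable]: "\<And>n. u n \<in> borel_measurable borel" using u sqint_meas by auto
  have M: "M \<ge> 0" and D: "D \<ge> 0" using tbound_nonneg[OF t] by auto
  let ?d = "\<lambda>k::nat. (1/2::real)^k"
  have cS: "countable (\<rat> \<times> (UNIV :: nat set) :: (real \<times> nat) set)" by (intro countable_SIGMA countable_rat) auto
  \<comment> \<open>The diagonal argument needs one bound for all scales; dividing by k + 1 absorbs
    the linear growth of the averages.\<close>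
  have bS: "norm (case p of (x, k) \<Rightarrow> av (?d k) (u n) x / (real k + 1)) \<le> M + D" for p n
  proof (cases p)
    case (Pair x k)
    have "\<bar>av (?d k) (u n) x\<bar> \<le> M + real k * D" by (rule av_log_bound[OF t])
    also have "\<dots> \<le> (M + D) * (real k + 1)" using M D by (simp add: algebra_simps)
    finally show ?thesis using Pair by (simp add: field_simps)
  qed
  define f where "f n p = (case p of (x, k) \<Rightarrow> av (?d k) (u n) x / (real k + 1))" for n and p :: "real \<times> nat"
  obtain r where r: "strict_mono (r::nat\<Rightarrow>nat)"
    and rl: "\<And>p. p \<in> \<rat> \<times> UNIV \<Longrightarrow> \<exists>l. (\<lambda>n. f (r n) p) \<longlonglongrightarrow> l"
  proof (rule function_convergent_subsequence[OF cS, of f "M + D"])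
    show "norm (f n p) \<le> M + D" for n p unfolding f_def by (rule bS)
  qed blast
  have conv_rat: "convergent (\<lambda>n. av (?d k) (u (r n)) x)" if rat: "x \<in> \<rat>" for x k
  proof -
    obtain l where "(\<lambda>n. av (?d k) (u (r n)) x / (real k + 1)) \<longlonglongrightarrow> l" using rl[of "(x, k)"] rat unfolding f_def by auto
    from tendsto_mult[OF this tendsto_const[of "real k + 1"]]
    have "(\<lambda>n. av (?d k) (u (r n)) x / (real k + 1) * (real k + 1)) \<longlonglongrightarrow> l * (real k + 1)" .
    moreover have "y / (real k + 1) * (real k + 1) = y" for y by (simp add: add_nonneg_eq_0_iff)
    ultimately have "(\<lambda>n. av (?d k) (u (r n)) x) \<longlonglongrightarrow> l * (real k + 1)" by simp
    then show ?thesis by (auto simp: convergent_def)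
  qed
  \<comment> \<open>At a fixed scale the averages are equicontinuous in x, uniformly in n, so a
    nearby rational point controls each real one.\<close>
  have conv: "convergent (\<lambda>n. av (?d k) (u (r n)) x)" for x k
  proof -
    have "Cauchy (\<lambda>n. av (?d k) (u (r n)) x)"
    proof (rule metric_CauchyI)
      fix e :: real assume e: "e > 0"
      have "((\<lambda>s. D * sqrt s / sqrt (?d k)) \<longlongrightarrow> D * sqrt 0 / sqrt (?d k)) (at_right 0)" by (intro tendsto_intros) simp
      then have "\<forall>\<^sub>F s in at_right 0. D * sqrt s / sqrt (?d k) < e / 3" by (rule order_tendstoD) (use e in simp)
      then have "\<forall>\<^sub>F s in at_right 0. s > 0 \<and> D * sqrt s / sqrt (?d k) < e / 3"
        using eventually_at_right_less[of "0::real"] by eventually_elim auto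
      then obtain s where s: "s > 0" "D * sqrt s / sqrt (?d k) < e / 3"
        using eventually_happens'[OF trivial_limit_at_right_real] by blast
      obtain y where y: "y \<in> \<rat>" "x < y" "y < x + s" using Rats_dense_in_real[of x "x + s"] s(1) by auto
      have close: "\<bar>av (?d k) (u (r n)) x - av (?d k) (u (r n)) y\<bar> < e / 3" for n
      proof -
        have "\<bar>av (?d k) (u (r n)) x - av (?d k) (u (r n)) y\<bar> \<le> D * sqrt \<bar>x - y\<bar> / sqrt (?d k)"
          by (rule av_diff_shift[OF t]) simp
        also have "\<dots> \<le> D * sqrt s / sqrt (?d k)" using y D by (intro divide_right_mono mult_left_mono real_sqrt_le_mono) auto
        finally show ?thesis using s(2) by (rule order_le_less_trans)
      qed
      have "Cauchy (\<lambda>n. av (?d k) (u (r n)) y)" using conv_rat[OF y(1)] by (rule convergent_Cauchy)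
      from metric_CauchyD[OF this, of "e/3"] obtain N where
        N: "\<And>m n. m \<ge> N \<Longrightarrow> n \<ge> N \<Longrightarrow> \<bar>av (?d k) (u (r m)) y - av (?d k) (u (r n)) y\<bar> < e / 3"
        using e by (auto simp: dist_real_def)
      have "dist (av (?d k) (u (r m)) x) (av (?d k) (u (r n)) x) < e" if "m \<ge> N" "n \<ge> N" for m n
        using close[of m] close[of n] N[OF that] unfolding dist_real_def by linarith
      then show "\<exists>M. \<forall>m\<ge>M. \<forall>n\<ge>M. dist (av (?d k) (u (r m)) x) (av (?d k) (u (r n)) x) < e" by blast
    qed
    then show ?thesis by (rule Cauchy_convergent)
  qed
  let ?s = "std_normal_density"
  have s1: "\<bar>?s x\<bar> \<le> 1" for x using std_normal_density_le_1 by simp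
  have sq_s: "sqint (\<lambda>x. ?s x * z x)" "nrm (\<lambda>x. ?s x * z x) \<le> nrm z" if "sqint z" for z :: "real \<Rightarrow> real"
  proof -
    have [measurable]: "z \<in> borel_measurable borel" using that sqint_meas by auto
    have le: "norm (?s x * z x) \<le> norm (z x)" for x
      using mult_right_mono[OF s1[of x], of "norm (z x)"] by (simp add: abs_mult)
    show "sqint (\<lambda>x. ?s x * z x)" by (rule sqint_bound[OF that]) (use le in auto)
    then show "nrm (\<lambda>x. ?s x * z x) \<le> nrm z" by (intro nrm_mono[OF that]) (use le in auto)
  qed
  have C: "\<exists>N. \<forall>i\<ge>N. \<forall>j\<ge>N. nrm (\<lambda>x. ?s x *\<^sub>R (u (r i) x - u (r j) x)) < e" if e: "e > 0" for e
  proof -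
    have "(\<lambda>k. D * sqrt (?d k)) \<longlonglongrightarrow> D * sqrt 0" by (intro tendsto_intros LIMSEQ_realpow_zero) auto
    then have "\<forall>\<^sub>F k in sequentially. D * sqrt (?d k) < e / 4" by (rule order_tendstoD) (use e in simp)
    then obtain k where k: "D * sqrt (?d k) < e / 4" using eventually_happens'[OF sequentially_bot] by blast
    define a where "a n = av (?d k) (u (r n))" for n
    have [measurable]: "a n \<in> borel_measurable borel" for n unfolding a_def by measurable
    have ab: "\<bar>a n x\<bar> \<le> M + real k * D" for n x unfolding a_def by (rule av_log_bound[OF t])
    define b where "b x = lim (\<lambda>n. a n x)" for x
    have al: "(\<lambda>n. a n x) \<longlonglongrightarrow> b x" for x
      unfolding b_def a_def using conv by (simp add: convergent_LIMSEQ_iff)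
    have [measurable]: "b \<in> borel_measurable borel" unfolding b_def by (rule borel_measurable_lim_metric) measurable
    have bb: "\<bar>b x\<bar> \<le> M + real k * D" for x
      by (rule LIMSEQ_le_const2[OF tendsto_rabs[OF al]]) (use ab in auto)
    let ?B = "M + real k * D"
    have gs: "sqint (\<lambda>x. ?B * ?s x)" by (rule sqint_mult_left[OF gaussian_sqint])
    have sa: "sqint (\<lambda>x. ?s x * a n x)" for n
      by (rule sqint_bound[OF gs]) (use ab in \<open>auto simp: abs_mult mult.commute[of "?s _"] intro!: mult_right_mono order_trans[OF ab]\<close>)
    have sb: "sqint (\<lambda>x. ?s x * b x)"
      by (rule sqint_bound[OF gs]) (use bb in \<open>auto simp: abs_mult mult.commute[of "?s _"] intro!: mult_right_mono order_trans[OF bb]\<close>)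
    have "(\<lambda>n. LBINT x. (norm (?s x * a n x - ?s x * b x))\<^sup>2) \<longlonglongrightarrow> (LBINT x. (norm (?s x * b x - ?s x * b x))\<^sup>2)"
    proof (rule integral_dominated_convergence[where w="\<lambda>x. (norm (2 * (?B * ?s x)))\<^sup>2"])
      show "integrable lborel (\<lambda>x. (norm (2 * (?B * ?s x)))\<^sup>2)" by (rule sqint_int[OF sqint_mult_left[OF gs]])
      show "AE x in lborel. (\<lambda>n. (norm (?s x * a n x - ?s x * b x))\<^sup>2) \<longlonglongrightarrow> (norm (?s x * b x - ?s x * b x))\<^sup>2"
        by (rule AE_I2) (intro tendsto_intros al)
      show "AE x in lborel. norm ((norm (?s x * a n x - ?s x * b x))\<^sup>2) \<le> (norm (2 * (?B * ?s x)))\<^sup>2" for n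
      proof (rule AE_I2)
        fix x
        have "\<bar>?s x * a n x - ?s x * b x\<bar> = \<bar>?s x\<bar> * \<bar>a n x - b x\<bar>" by (simp add: abs_mult flip: right_diff_distrib)
        also have "\<dots> \<le> \<bar>?s x\<bar> * (2 * ?B)" using ab[of n x] bb[of x] by (intro mult_left_mono) (auto simp: abs_le_iff)
        also have "\<dots> \<le> \<bar>2 * (?B * ?s x)\<bar>" using M D by (simp add: abs_mult algebra_simps)
        finally show "norm ((norm (?s x * a n x - ?s x * b x))\<^sup>2) \<le> (norm (2 * (?B * ?s x)))\<^sup>2"
          by (simp only: real_norm_def abs_power2 power2_abs) (simp add: abs_le_square_iff)
      qed
    qed measurable
    from tendsto_real_sqrt[OF this] have "(\<lambda>n. nrm (\<lambda>x. ?s x * a n x - ?s x * b x)) \<longlonglongrightarrow> 0" by (simp add: nrm_def)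
    from L2_limit_Cauchy[OF sa sb this, of "e/4"] e obtain N where
      N: "\<And>i j. i \<ge> N \<Longrightarrow> j \<ge> N \<Longrightarrow> nrm (\<lambda>x. ?s x * a i x - ?s x * a j x) < e / 4" by auto
    have su: "sqint (\<lambda>x. ?s x * u (r i) x)" for i by (rule sq_s(1)[OF u])
    have ua: "nrm (\<lambda>x. ?s x * u (r i) x - ?s x * a i x) < e / 4" for i
    proof -
      have "nrm (\<lambda>x. ?s x * u (r i) x - ?s x * a i x) = nrm (\<lambda>x. ?s x * (u (r i) x - av (?d k) (u (r i)) x))"
        unfolding a_def by (simp add: right_diff_distrib)
      also have "\<dots> \<le> nrm (\<lambda>x. u (r i) x - av (?d k) (u (r i)) x)" by (rule sq_s(2)[OF av_approx(1)[OF t]]) simp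
      also have "\<dots> \<le> D * sqrt (?d k)" by (rule av_approx(2)[OF t]) simp
      finally show ?thesis using k by simp
    qed
    have "nrm (\<lambda>x. ?s x *\<^sub>R (u (r i) x - u (r j) x)) < e" if ij: "i \<ge> N" "j \<ge> N" for i j
    proof -
      have "nrm (\<lambda>x. ?s x *\<^sub>R (u (r i) x - u (r j) x)) = nrm (\<lambda>x. ?s x * u (r i) x - ?s x * u (r j) x)"
        by (simp add: right_diff_distrib)
      then show ?thesis
        using nrm_triangle_diff[OF su[of i] sa[of i] su[of j]] nrm_triangle_diff[OF sa[of i] sa[of j] su[of j]]
          ua[of i] ua[of j] N[OF ij] nrm_minus_commute[of "\<lambda>x. ?s x * a j x" "\<lambda>x. ?s x * u (r j) x"] e
        by linarith
    qed
    then show ?thesis by blast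
  qed
  obtain r' v where r': "strict_mono r'" "v \<in> borel_measurable borel" "AE x in lborel. (\<lambda>n. u (r (r' n)) x) \<longlonglongrightarrow> v x"
    using L2_Cauchy_AE_subseq[OF u C] by blast
  show ?thesis
    by (rule that[of "r \<circ> r'" v]) (use r r' in \<open>auto intro: strict_mono_o\<close>)
qed

section \<open>Splitting lemmas under almost everywhere convergence\<close>

text \<open>The core of the Brezis-Lieb argument: the positive part of |g_n| - e a_n tends to 0 and
  is dominated by the fixed function |b|, so its integral vanishes in the limit, while the part
  removed costs at most e A.\<close>

lemma integral_tendsto_0_splitting:
  fixes g :: "nat \<Rightarrow> real \<Rightarrow> real"
  assumes g [measurable]: "\<And>n. g n \<in> borel_measurable borel" and lim: "AE x in lborel. (\<lambda>n. g n x) \<longlonglongrightarrow> 0"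
    and a: "\<And>n. integrable lborel (a n)" "\<And>n x. 0 \<le> a n x" "\<And>n. (LBINT x. a n x) \<le> A"
    and b: "\<And>e. e > 0 \<Longrightarrow> \<exists>b. integrable lborel b \<and> (\<forall>n x. \<bar>g n x\<bar> \<le> e * a n x + b x)"
  shows "(\<lambda>n. LBINT x. g n x) \<longlonglongrightarrow> 0"
proof -
  have gi: "integrable lborel (g n)" for n
  proof -
    obtain b' where b': "integrable lborel b'" "\<And>n x. \<bar>g n x\<bar> \<le> 1 * a n x + b' x" using b[of 1] by auto
    show ?thesis
      by (rule Bochner_Integration.integrable_bound[OF Bochner_Integration.integrable_add[OF a(1)[of n] b'(1)]])
        (use b'(2)[of n] in \<open>auto intro!: AE_I2 order_trans[OF _ abs_ge_self]\<close>)
  qed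
  have A: "A \<ge> 0" using order_trans[OF integral_nonneg_AE a(3)[of 0]] a(2) by simp
  show ?thesis
  proof (rule LIMSEQ_I)
    fix e :: real assume e: "e > 0"
    define e' where "e' = e / (2 * (A + 1))"
    have e': "e' > 0" "e' * A \<le> e / 2" using e A by (auto simp: e'_def field_simps)
    obtain b' where b': "integrable lborel b'" "\<And>n x. \<bar>g n x\<bar> \<le> e' * a n x + b' x" using b[OF e'(1)] by auto
    have [measurable]: "b' \<in> borel_measurable borel" "\<And>n. a n \<in> borel_measurable borel"
      using borel_measurable_integrable[OF b'(1)] borel_measurable_integrable[OF a(1)] by auto
    define h where "h n x = max 0 (\<bar>g n x\<bar> - e' * a n x)" for n x
    have [measurable]: "h n \<in> borel_measurable borel" for n unfolding h_def by measurable
    have hb: "\<bar>h n x\<bar> \<le> \<bar>b' x\<bar>" for n x using b'(2)[of n x] by (auto simp: h_def)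
    have hg: "\<bar>h n x\<bar> \<le> \<bar>g n x\<bar>" for n x using mult_nonneg_nonneg[OF less_imp_le[OF e'(1)] a(2)[of n x]] by (auto simp: h_def)
    have "(\<lambda>n. LBINT x. h n x) \<longlonglongrightarrow> (\<integral>x. 0 \<partial>(lborel :: real measure))"
    proof (rule integral_dominated_convergence[where w="\<lambda>x. \<bar>b' x\<bar>"])
      show "AE x in lborel. (\<lambda>n. h n x) \<longlonglongrightarrow> 0"
        using lim
      proof eventually_elim
        fix x assume "(\<lambda>n. g n x) \<longlonglongrightarrow> 0"
        then show "(\<lambda>n. h n x) \<longlonglongrightarrow> 0"
          by (rule Lim_null_comparison[OF _ tendsto_rabs_zero, rotated]) (use hg in simp)
      qed
    qed (use b' hb in auto)
    then have "(\<lambda>n. LBINT x. h n x) \<longlonglongrightarrow> 0" by simp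
    from LIMSEQ_D[OF this, of "e/2"] e obtain N where N: "\<And>n. n \<ge> N \<Longrightarrow> \<bar>LBINT x. h n x\<bar> < e/2" by auto
    have hi: "integrable lborel (h n)" for n
      by (rule Bochner_Integration.integrable_bound[OF b'(1)]) (use hb in auto)
    have "norm ((LBINT x. g n x) - 0) < e" if "n \<ge> N" for n
    proof -
      have "\<bar>LBINT x. g n x\<bar> \<le> (LBINT x. \<bar>g n x\<bar>)" by (rule integral_abs_bound)
      also have "\<dots> \<le> (LBINT x. h n x + e' * a n x)"
        by (rule integral_mono) (use gi hi a in \<open>auto simp: h_def\<close>)
      also have "\<dots> = (LBINT x. h n x) + e' * (LBINT x. a n x)" using hi a by simp
      also have "\<dots> \<le> (LBINT x. h n x) + e' * A" using a(3) e' by (intro add_left_mono mult_left_mono) auto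
      also have "\<dots> < e" using N[OF that] e'(2) by linarith
      finally show ?thesis by simp
    qed
    then show "\<exists>no. \<forall>n\<ge>no. norm ((LBINT x. g n x) - 0) < e" by blast
  qed
qed

text \<open>An instance of the splitting lemma with a_n = |u_n - v|^2, which has bounded integral;
  Young's inequality with parameter e puts the rest on the fixed function |w|^2 / e.\<close>

lemma weak_convergence_AE:
  fixes u :: "nat \<Rightarrow> real \<Rightarrow> real"
  assumes u: "\<And>n. sqint (u n)" "\<And>n. nrm (u n) \<le> M" and lim: "AE x in lborel. (\<lambda>n. u n x) \<longlonglongrightarrow> v x"
    and v: "sqint v" and w: "sqint w"
  shows "(\<lambda>n. LBINT x. u n x * w x) \<longlonglongrightarrow> (LBINT x. v x * w x)"
proof -
  have [measurable]: "\<And>n. u n \<in> borel_measurable borel" "v \<in> borel_measurable borel" "w \<in> borel_measurable borel"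
    using u v w sqint_meas by auto
  have d: "sqint (\<lambda>x. u n x - v x)" for n using u v sqint_diff by blast
  have "(\<lambda>n. LBINT x. (u n x - v x) * w x) \<longlonglongrightarrow> 0"
  proof (rule integral_tendsto_0_splitting)
    show "AE x in lborel. (\<lambda>n. (u n x - v x) * w x) \<longlonglongrightarrow> 0"
      using lim by eventually_elim (auto intro!: tendsto_mult_left_zero simp: LIM_zero)
    show "integrable lborel (\<lambda>x. (norm (u n x - v x))\<^sup>2)" for n using d sqint_int by blast
    show "(LBINT x. (norm (u n x - v x))\<^sup>2) \<le> (M + nrm v)\<^sup>2" for n
    proof -
      have "nrm (\<lambda>x. u n x - v x) \<le> M + nrm v"
        using nrm_triangle[OF u(1) sqint_uminus[OF v], of n] u(2)[of n] by (simp add: nrm_uminus)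
      then show ?thesis unfolding nrm_sq[symmetric] by (intro power_mono) auto
    qed
    fix e :: real assume e: "e > 0"
    have "\<bar>(u n x - v x) * w x\<bar> \<le> e * (norm (u n x - v x))\<^sup>2 + 1 / e * (norm (w x))\<^sup>2" for n x
    proof -
      have "2 * e * \<bar>(u n x - v x) * w x\<bar> \<le> (e * \<bar>u n x - v x\<bar>)\<^sup>2 + \<bar>w x\<bar>\<^sup>2"
        using sum_squares_bound[of "e * \<bar>u n x - v x\<bar>" "\<bar>w x\<bar>"] by (simp add: abs_mult mult.assoc)
      also have "\<dots> = e * (e * (norm (u n x - v x))\<^sup>2 + 1 / e * (norm (w x))\<^sup>2)"
        using e by (simp add: power_mult_distrib distrib_left) (simp add: power2_eq_square)
      finally have "e * (2 * \<bar>(u n x - v x) * w x\<bar>) \<le> e * (e * (norm (u n x - v x))\<^sup>2 + 1 / e * (norm (w x))\<^sup>2)"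
        by (simp only: mult.left_commute mult.assoc)
      then have "2 * \<bar>(u n x - v x) * w x\<bar> \<le> e * (norm (u n x - v x))\<^sup>2 + 1 / e * (norm (w x))\<^sup>2"
        using e by (simp only: mult_le_cancel_left_pos)
      then show ?thesis by linarith
    qed
    then show "\<exists>b. integrable lborel b \<and> (\<forall>n x. \<bar>(u n x - v x) * w x\<bar> \<le> e * (norm (u n x - v x))\<^sup>2 + b x)"
      using sqint_int[OF w] by (intro exI[of _ "\<lambda>x. 1 / e * (norm (w x))\<^sup>2"]) auto
  qed auto
  moreover have "(LBINT x. (u n x - v x) * w x) = (LBINT x. u n x * w x) - (LBINT x. v x * w x)" for n
    using integrable_inner[OF u(1) w, of n] integrable_inner[OF v w] by (simp add: left_diff_distrib)
  ultimately show ?thesis by (simp add: LIM_zero_iff)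
qed

lemma tbound_diff:
  assumes "tbound M D u" "tbound M' D' v" shows "tbound (M + M') (D + D') (\<lambda>x. u x - v x)"
proof -
  have s: "sqint u" "sqint v" using assms unfolding tbound_def by auto
  have n: "nrm (\<lambda>x. a x - b x) \<le> nrm a + nrm b" if "sqint a" "sqint b" for a b :: "real \<Rightarrow> real"
    using nrm_triangle[OF that(1) sqint_uminus[OF that(2)]] by (simp add: nrm_uminus)
  show ?thesis
    unfolding tbound_def
  proof (intro conjI allI)
    show "sqint (\<lambda>x. u x - v x)" using s by (rule sqint_diff)
    show "nrm (\<lambda>x. u x - v x) \<le> M + M'" using n[OF s] assms unfolding tbound_def by linarith
    fix h
    have "(\<lambda>x. u (x + h) - v (x + h) - (u x - v x)) = (\<lambda>x. (u (x + h) - u x) - (v (x + h) - v x))" by auto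
    then have "nrm (\<lambda>x. u (x + h) - v (x + h) - (u x - v x)) \<le> nrm (\<lambda>x. u (x + h) - u x) + nrm (\<lambda>x. v (x + h) - v x)"
      using n[OF sqint_diff[OF sqint_translate[OF s(1), of h] s(1)] sqint_diff[OF sqint_translate[OF s(2), of h] s(2)]] by simp
    also have "\<dots> \<le> D * sqrt \<bar>h\<bar> + D' * sqrt \<bar>h\<bar>" using assms unfolding tbound_def by (intro add_mono) auto
    finally show "nrm (\<lambda>x. u (x + h) - v (x + h) - (u x - v x)) \<le> (D + D') * sqrt \<bar>h\<bar>" by (simp add: distrib_right)
  qed
qed

section \<open>Homogeneous nonlinearities and the Brezis-Lieb lemma\<close>

locale homogeneous_nonlinearity =
  fixes p :: real and f F :: "real \<Rightarrow> real"
  assumes p: "p > 1" and f_cont: "continuous_on UNIV f"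
    and f_hom: "\<And>l s. l > 0 \<Longrightarrow> f (l * s) = l powr p * f s"
    and F_anti: "\<And>s. (F has_real_derivative f s) (at s)" and F0: "F 0 = 0"
begin

definition "q = p + 1"

lemma q: "q > 2" using p by (simp add: q_def)

lemma f_0: "f 0 = 0"
proof -
  have "f 0 = 2 powr p * f 0" using f_hom[of 2 0] by simp
  moreover have "(2::real) powr p > 1" using p by (intro gr_one_powr) auto
  ultimately show ?thesis using p by auto
qed

text \<open>Homogeneity of \<open>f\<close> makes the derivatives of both sides in \<open>s\<close>
  agree, and both sides vanish at 0; integration raises the degree by one.\<close>

lemma F_hom: assumes l: "l > 0" shows "F (l * s) = l powr q * F s"
proof -
  have "((\<lambda>s. F (l * s) - l powr q * F s) has_real_derivative 0) (at s)" for s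
  proof -
    have "((\<lambda>s. F (l * s) - l powr q * F s) has_real_derivative f (l * s) * l - l powr q * f s) (at s)"
      by (auto intro!: derivative_eq_intros DERIV_chain2[OF F_anti] F_anti)
    moreover have "f (l * s) * l - l powr q * f s = 0"
      using l by (simp add: f_hom q_def powr_add)
    ultimately show ?thesis by simp
  qed
  then have "F (l * s) - l powr q * F s = F (l * 0) - l powr q * F 0"
    using DERIV_isconst_all[of "\<lambda>s. F (l * s) - l powr q * F s" s 0] by blast
  then show ?thesis using F0 by simp
qed

text \<open>A homogeneous function on the line is determined by its values at 1 and -1, one for each
  half-line.\<close>

definition "Cf = \<bar>f 1\<bar> + \<bar>f (-1)\<bar>"
definition "CF = \<bar>F 1\<bar> + \<bar>F (-1)\<bar>"

lemma Cf_nonneg: "0 \<le> Cf" and CF_nonneg: "0 \<le> CF" by (auto simp: Cf_def CF_def)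

lemma f_bound: "\<bar>f s\<bar> \<le> Cf * \<bar>s\<bar> powr p"
proof (cases s "0::real" rule: linorder_cases)
  case less
  have "f s = (-s) powr p * f (-1)" using f_hom[of "-s" "-1"] less by simp
  then show ?thesis using less by (simp add: abs_mult Cf_def mult.commute[of "_ + _"] mult_left_mono)
next
  case greater
  have "f s = s powr p * f 1" using f_hom[of s 1] greater by simp
  then show ?thesis using greater by (simp add: abs_mult Cf_def mult.commute[of "_ + _"] mult_left_mono)
qed (simp add: f_0)

lemma F_bound: "\<bar>F s\<bar> \<le> CF * \<bar>s\<bar> powr q"
proof (cases s "0::real" rule: linorder_cases)
  case less
  have "F s = (-s) powr q * F (-1)" using F_hom[of "-s" "-1"] less by simp
  then show ?thesis using less by (simp add: abs_mult CF_def mult.commute[of "_ + _"] mult_left_mono)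
next
  case greater
  have "F s = s powr q * F 1" using F_hom[of s 1] greater by simp
  then show ?thesis using greater by (simp add: abs_mult CF_def mult.commute[of "_ + _"] mult_left_mono)
qed (simp add: F0)

lemma F_cont: "continuous_on UNIV F"
  using F_anti by (meson DERIV_continuous_on has_field_derivative_at_within)

lemma F_meas [measurable]: "F \<in> borel_measurable borel"
  using F_cont by (rule borel_measurable_continuous_onI)

lemma f_meas [measurable]: "f \<in> borel_measurable borel"
  using f_cont by (rule borel_measurable_continuous_onI)

lemma F_diff: "\<bar>F (a + b) - F a\<bar> \<le> Cf * (\<bar>a\<bar> + \<bar>b\<bar>) powr p * \<bar>b\<bar>"
proof -
  have "norm (F (a + b) - F a) \<le> Cf * (\<bar>a\<bar> + \<bar>b\<bar>) powr p * norm (a + b - a)"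
  proof (rule field_differentiable_bound[where S="{min a (a+b)..max a (a+b)}" and f'=f])
    fix z assume z: "z \<in> {min a (a+b)..max a (a+b)}"
    show "(F has_field_derivative f z) (at z within {min a (a+b)..max a (a+b)})"
      using F_anti by (rule has_field_derivative_at_within)
    have "\<bar>z\<bar> \<le> \<bar>a\<bar> + \<bar>b\<bar>" using z by auto
    then have "\<bar>z\<bar> powr p \<le> (\<bar>a\<bar> + \<bar>b\<bar>) powr p" using p by (intro powr_mono2) auto
    then show "norm (f z) \<le> Cf * (\<bar>a\<bar> + \<bar>b\<bar>) powr p"
      using f_bound[of z] Cf_nonneg mult_left_mono[of _ _ Cf] by (fastforce intro: order_trans)
  qed auto
  then show ?thesis by simp
qed

text \<open>The mean value bound on F(a + b) - F(a) is treated in two regimes. For |b| <= d |a| it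
  is at most d Cf 2^p |a|^q, and \<open>d\<close> is chosen to make this at most e |a|^q. Otherwise
  |a| < |b| / d and everything is charged to |b|^q.\<close>

lemma F_split:
  assumes e: "e > 0"
  obtains C where "C \<ge> 0" "\<And>a b. \<bar>F (a + b) - F a - F b\<bar> \<le> e * \<bar>a\<bar> powr q + C * \<bar>b\<bar> powr q"
proof -
  define d where "d = min 1 (e / (Cf * 2 powr p + 1))"
  have k: "Cf * 2 powr p + 1 > 0" using Cf_nonneg by (simp add: add_nonneg_pos)
  have d: "d > 0" "d \<le> 1" "d * (Cf * 2 powr p) \<le> e"
  proof -
    show "d > 0" "d \<le> 1" using e k by (auto simp: d_def)
    have "d * (Cf * 2 powr p) \<le> (e / (Cf * 2 powr p + 1)) * (Cf * 2 powr p + 1)"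
      using Cf_nonneg e k by (intro mult_mono) (auto simp: d_def)
    then show "d * (Cf * 2 powr p) \<le> e" using k by simp
  qed
  define C where "C = Cf * (1 / d + 1) powr p + CF"
  have C: "C \<ge> 0" using Cf_nonneg CF_nonneg by (simp add: C_def)
  have pq: "y powr p * y = y powr q" if "y \<ge> 0" for y
    using that by (cases "y = 0") (simp_all add: q_def powr_add)
  have "\<bar>F (a + b) - F a - F b\<bar> \<le> e * \<bar>a\<bar> powr q + C * \<bar>b\<bar> powr q" for a b
  proof -
    have "Cf * (\<bar>a\<bar> + \<bar>b\<bar>) powr p * \<bar>b\<bar> \<le> e * \<bar>a\<bar> powr q + Cf * (1 / d + 1) powr p * \<bar>b\<bar> powr q"
    proof (cases "\<bar>b\<bar> \<le> d * \<bar>a\<bar>")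
      case True
      have "d * \<bar>a\<bar> \<le> 1 * \<bar>a\<bar>" using d by (intro mult_right_mono) auto
      then have "\<bar>a\<bar> + \<bar>b\<bar> \<le> 2 * \<bar>a\<bar>" using True by simp
      then have "(\<bar>a\<bar> + \<bar>b\<bar>) powr p \<le> (2 * \<bar>a\<bar>) powr p" using p by (intro powr_mono2) auto
      then have "Cf * (\<bar>a\<bar> + \<bar>b\<bar>) powr p * \<bar>b\<bar> \<le> Cf * (2 * \<bar>a\<bar>) powr p * (d * \<bar>a\<bar>)"
        using True Cf_nonneg by (intro mult_mono) auto
      also have "\<dots> = (d * (Cf * 2 powr p)) * (\<bar>a\<bar> powr p * \<bar>a\<bar>)" by (simp add: powr_mult)
      also have "\<dots> \<le> e * \<bar>a\<bar> powr q" unfolding pq[OF abs_ge_zero] using d(3) by (intro mult_right_mono) auto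
      finally show ?thesis using Cf_nonneg by (simp add: add_increasing2)
    next
      case False
      then have "\<bar>a\<bar> + \<bar>b\<bar> \<le> (1 / d + 1) * \<bar>b\<bar>" using d by (simp add: field_simps)
      then have "(\<bar>a\<bar> + \<bar>b\<bar>) powr p \<le> ((1 / d + 1) * \<bar>b\<bar>) powr p" using p by (intro powr_mono2) auto
      then have "Cf * (\<bar>a\<bar> + \<bar>b\<bar>) powr p * \<bar>b\<bar> \<le> Cf * ((1 / d + 1) * \<bar>b\<bar>) powr p * \<bar>b\<bar>"
        using Cf_nonneg by (intro mult_right_mono mult_left_mono) auto
      also have "\<dots> = Cf * (1 / d + 1) powr p * (\<bar>b\<bar> powr p * \<bar>b\<bar>)" using d by (simp add: powr_mult)
      finally show ?thesis unfolding pq[OF abs_ge_zero] using e by (simp add: add_increasing)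
    qed
    then show ?thesis using F_diff[of a b] F_bound[of b] unfolding C_def distrib_right by linarith
  qed
  then show ?thesis using that C by blast
qed

lemma F_integrable: assumes "tbound M D u" shows "integrable lborel (\<lambda>x. F (u x))"
proof -
  obtain C where "integrable lborel (\<lambda>x. \<bar>u x\<bar> powr q)"
    using sobolev_embedding[OF q tbound_nonneg[OF assms]] assms by metis
  then have i: "integrable lborel (\<lambda>x. CF * \<bar>u x\<bar> powr q)" by simp
  have [measurable]: "u \<in> borel_measurable borel" using assms sqint_meas unfolding tbound_def by auto
  from i show ?thesis
    by (rule Bochner_Integration.integrable_bound) (use F_bound CF_nonneg in \<open>auto simp: abs_mult\<close>)
qed

text \<open>\<open>F_split\<close> with a = u_n - v and b = v provides the majorants for the
  splitting lemma; the embedding bounds the L^q norms of the differences.\<close>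

theorem Brezis_Lieb:
  assumes u: "\<And>n. tbound M D (u n)" and v: "tbound M' D' v" and lim: "AE x in lborel. (\<lambda>n. u n x) \<longlonglongrightarrow> v x"
  shows "(\<lambda>n. (LBINT x. F (u n x)) - (LBINT x. F (u n x - v x))) \<longlonglongrightarrow> (LBINT x. F (v x))"
proof -
  have [measurable]: "\<And>n. u n \<in> borel_measurable borel" "v \<in> borel_measurable borel"
    using u v sqint_meas unfolding tbound_def by auto
  have w: "tbound (M + M') (D + D') (\<lambda>x. u n x - v x)" for n by (rule tbound_diff[OF u v])
  obtain C where C: "\<And>w. tbound (M + M') (D + D') w \<Longrightarrow> integrable lborel (\<lambda>x. \<bar>w x\<bar> powr q)"
    "\<And>w. tbound (M + M') (D + D') w \<Longrightarrow> (LBINT x. \<bar>w x\<bar> powr q) \<le> C"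
    using sobolev_embedding[OF q tbound_nonneg[OF w]] by metis
  obtain C' where C': "integrable lborel (\<lambda>x. \<bar>v x\<bar> powr q)"
    using sobolev_embedding[OF q tbound_nonneg[OF v]] v by metis
  have "(\<lambda>n. LBINT x. F (u n x) - F (u n x - v x) - F (v x)) \<longlonglongrightarrow> 0"
  proof (rule integral_tendsto_0_splitting)
    show "AE x in lborel. (\<lambda>n. F (u n x) - F (u n x - v x) - F (v x)) \<longlonglongrightarrow> 0"
      using lim
    proof eventually_elim
      fix x assume l: "(\<lambda>n. u n x) \<longlonglongrightarrow> v x"
      have c: "isCont F y" for y using F_anti DERIV_isCont by blast
      have "(\<lambda>n. F (u n x) - F (u n x - v x) - F (v x)) \<longlonglongrightarrow> F (v x) - F (v x - v x) - F (v x)"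
        by (intro tendsto_intros isCont_tendsto_compose[OF c] l)
      then show "(\<lambda>n. F (u n x) - F (u n x - v x) - F (v x)) \<longlonglongrightarrow> 0" by (simp add: F0)
    qed
    show "integrable lborel (\<lambda>x. \<bar>u n x - v x\<bar> powr q)" for n by (rule C(1)[OF w])
    show "(LBINT x. \<bar>u n x - v x\<bar> powr q) \<le> C" for n by (rule C(2)[OF w])
    fix e :: real assume "e > 0"
    then obtain B where B: "\<And>a b. \<bar>F (a + b) - F a - F b\<bar> \<le> e * \<bar>a\<bar> powr q + B * \<bar>b\<bar> powr q" using F_split by metis
    show "\<exists>b. integrable lborel b \<and> (\<forall>n x. \<bar>F (u n x) - F (u n x - v x) - F (v x)\<bar> \<le> e * \<bar>u n x - v x\<bar> powr q + b x)"
    proof (intro exI[of _ "\<lambda>x. B * \<bar>v x\<bar> powr q"] conjI allI)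
      show "integrable lborel (\<lambda>x. B * \<bar>v x\<bar> powr q)" using C' by simp
      show "\<bar>F (u n x) - F (u n x - v x) - F (v x)\<bar> \<le> e * \<bar>u n x - v x\<bar> powr q + B * \<bar>v x\<bar> powr q" for n x
        using B[of "u n x - v x" "v x"] by simp
    qed
  qed auto
  moreover have "(LBINT x. F (u n x) - F (u n x - v x) - F (v x))
     = (LBINT x. F (u n x)) - (LBINT x. F (u n x - v x)) - (LBINT x. F (v x))" for n
    using F_integrable[OF u] F_integrable[OF v] F_integrable[OF w] by simp
  ultimately show ?thesis by (simp add: LIM_zero_iff)
qed

end

section \<open>The space $H^{1/2}$\<close>

abbreviation cr :: "(real \<Rightarrow> real) \<Rightarrow> real \<Rightarrow> complex" where
  "cr u \<equiv> \<lambda>x. complex_of_real (u x)"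

lemma L2_iff_sqint: "L2 u \<longleftrightarrow> sqint u"
  by (simp add: L2_def sqint_iff_nn)

lemma fourier_trunc_eq: "fourier_trunc u R = ft (cr (\<lambda>x. indicator {-R..R} x * u x))"
  unfolding fourier_trunc_def ft_def set_lebesgue_integral_def
  by (intro ext Bochner_Integration.integral_cong) (auto simp: indicator_def)

lemma trunc_interval:
  fixes u :: "real \<Rightarrow> real"
  assumes u: "sqint u"
  shows "sqint (\<lambda>x. indicator {-R..R} x * u x)" "integrable lborel (\<lambda>x. indicator {-R..R} x * u x)"
proof -
  have [measurable]: "u \<in> borel_measurable borel" using u sqint_meas by auto
  show "sqint (\<lambda>x. indicator {-R..R} x * u x)" by (rule sqint_bound[OF u]) (auto simp: indicator_def)
  show "integrable lborel (\<lambda>x. indicator {-R..R} x * u x)"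
    using integrable_inner[OF sqint_indicator[of "-R" R] u] by simp
qed

lemma Fr_fourier_trunc:
  assumes u: "sqint u" shows "Fr (cr (\<lambda>x. indicator {-R..R} x * u x)) (fourier_trunc u R)"
  unfolding fourier_trunc_eq
proof (rule Fr_ft)
  show "sqint (cr (\<lambda>x. indicator {-R..R} x * u x))" using trunc_interval(1)[OF u] unfolding sqint_of_real .
  show "integrable lborel (cr (\<lambda>x. indicator {-R..R} x * u x))"
    using trunc_interval(2)[OF u] by (rule integrable_of_real)
qed

lemma trunc_interval_tendsto:
  fixes u :: "real \<Rightarrow> real"
  assumes u: "sqint u" shows "((\<lambda>R. nrm (\<lambda>x. indicator {-R..R} x * u x - u x)) \<longlongrightarrow> 0) at_top"
proof -
  have [measurable]: "u \<in> borel_measurable borel" using u sqint_meas by auto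
  have "((\<lambda>R. LBINT x. (norm (indicator {-R..R} x * u x - u x))\<^sup>2) \<longlongrightarrow> (\<integral>x. 0 \<partial>(lborel::real measure))) at_top"
  proof (rule integral_dominated_convergence_at_top[where w="\<lambda>x. (norm (u x))\<^sup>2"])
    show "AE x in lborel. ((\<lambda>R. (norm (indicator {-R..R} x * u x - u x))\<^sup>2) \<longlongrightarrow> 0) at_top"
    proof (rule AE_I2)
      fix x
      show "((\<lambda>R. (norm (indicator {-R..R} x * u x - u x))\<^sup>2) \<longlongrightarrow> 0) at_top"
        by (rule tendsto_eventually, rule eventually_mono[OF eventually_ge_at_top[of "\<bar>x\<bar>"]]) (auto simp: indicator_def abs_le_iff)
    qed
    show "\<forall>\<^sub>F R in at_top. AE x in lborel. norm ((norm (indicator {-R..R} x * u x - u x))\<^sup>2) \<le> (norm (u x))\<^sup>2"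
      by (auto simp: indicator_def)
  qed (use sqint_int[OF u] in measurable)
  from tendsto_real_sqrt[OF this] show ?thesis unfolding nrm_def by simp
qed

text \<open>The bridge from the given definition to \<open>Fr\<close>. In one direction the isometry
  converts the tail of \<open>u\<close> into the distance of the transforms; in the other,
  closedness of \<open>Fr\<close> applies along integer radii.\<close>

lemma is_fourier_iff_Fr: "is_fourier u g \<longleftrightarrow> Fr (cr u) g"
proof
  assume g: "Fr (cr u) g"
  have u: "sqint u" using Fr_sqint(1)[OF g] unfolding sqint_of_real .
  have d: "Fr (\<lambda>x. cr (\<lambda>x. indicator {-R..R} x * u x) x - cr u x) (\<lambda>\<xi>. fourier_trunc u R \<xi> - g \<xi>)" for R
    by (rule Fr_diff[OF Fr_fourier_trunc[OF u] g])
  have n: "nrm (\<lambda>x. cr (\<lambda>x. indicator {-R..R} x * u x) x - cr u x) = nrm (\<lambda>x. indicator {-R..R} x * u x - u x)" for R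
    unfolding of_real_diff[symmetric] by (rule nrm_of_real)
  have "((\<lambda>R. ennreal (2 * pi * (nrm (\<lambda>x. indicator {-R..R} x * u x - u x))\<^sup>2)) \<longlongrightarrow> ennreal (2 * pi * 0\<^sup>2)) at_top"
    by (intro tendsto_ennrealI tendsto_intros trunc_interval_tendsto u)
  moreover have "(\<integral>\<^sup>+ \<xi>. ennreal ((cmod (fourier_trunc u R \<xi> - g \<xi>))\<^sup>2) \<partial>lborel) = ennreal (2 * pi * (nrm (\<lambda>x. indicator {-R..R} x * u x - u x))\<^sup>2)" for R
    using nn_integral_sqint[OF Fr_sqint(2)[OF d]] Fr_nrm_sq[OF d] n by simp
  ultimately show "is_fourier u g"
    unfolding is_fourier_def L2_iff_sqint using u sqint_meas[OF Fr_sqint(2)[OF g]] by simp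
next
  assume i: "is_fourier u g"
  have u: "sqint u" and gm [measurable]: "g \<in> borel_measurable borel"
    using i unfolding is_fourier_def L2_iff_sqint by auto
  have lim: "((\<lambda>R. \<integral>\<^sup>+ \<xi>. ennreal ((cmod (fourier_trunc u R \<xi> - g \<xi>))\<^sup>2) \<partial>lborel) \<longlongrightarrow> 0) at_top"
    using i unfolding is_fourier_def by auto
  have lim': "(\<lambda>n. \<integral>\<^sup>+ \<xi>. ennreal ((cmod (fourier_trunc u (real n) \<xi> - g \<xi>))\<^sup>2) \<partial>lborel) \<longlonglongrightarrow> 0"
    by (rule filterlim_compose[OF lim filterlim_real_sequentially])
  have ts: "sqint (fourier_trunc u R)" for R by (rule Fr_sqint(2)[OF Fr_fourier_trunc[OF u]])
  have tm [measurable]: "fourier_trunc u R \<in> borel_measurable borel" for R using ts sqint_meas by blast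
  have "\<forall>\<^sub>F n in sequentially. (\<integral>\<^sup>+ \<xi>. ennreal ((cmod (fourier_trunc u (real n) \<xi> - g \<xi>))\<^sup>2) \<partial>lborel) < 1"
    by (rule order_tendstoD[OF lim']) simp
  then obtain n where "(\<integral>\<^sup>+ \<xi>. ennreal ((cmod (fourier_trunc u (real n) \<xi> - g \<xi>))\<^sup>2) \<partial>lborel) < 1"
    using eventually_happens'[OF sequentially_bot] by blast
  \<comment> \<open>\<open>is_fourier\<close> asks only for measurability of \<open>g\<close>;
    finite distance to one truncated transform supplies square integrability.\<close>
  then have "sqint (\<lambda>\<xi>. fourier_trunc u (real n) \<xi> - g \<xi>)"
    unfolding sqint_iff_nn by (auto intro: less_trans[of _ 1])
  from sqint_diff[OF ts[of "real n"] this] have g: "sqint g" by simp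
  have "(\<lambda>n. ennreal ((nrm (\<lambda>\<xi>. fourier_trunc u (real n) \<xi> - g \<xi>))\<^sup>2)) \<longlonglongrightarrow> ennreal 0"
    using lim' nn_integral_sqint[OF sqint_diff[OF ts g]] by simp
  then have "(\<lambda>n. (nrm (\<lambda>\<xi>. fourier_trunc u (real n) \<xi> - g \<xi>))\<^sup>2) \<longlonglongrightarrow> 0"
    by (subst (asm) tendsto_ennreal_iff) auto
  from tendsto_real_sqrt[OF this] have l2: "(\<lambda>n. nrm (\<lambda>\<xi>. fourier_trunc u (real n) \<xi> - g \<xi>)) \<longlonglongrightarrow> 0" by simp
  have n: "nrm (\<lambda>x. cr (\<lambda>x. indicator {-R..R} x * u x) x - cr u x) = nrm (\<lambda>x. indicator {-R..R} x * u x - u x)" for R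
    unfolding of_real_diff[symmetric] by (rule nrm_of_real)
  have l1: "(\<lambda>k. nrm (\<lambda>x. cr (\<lambda>x. indicator {-real k..real k} x * u x) x - cr u x)) \<longlonglongrightarrow> 0"
    unfolding n by (rule filterlim_compose[OF trunc_interval_tendsto[OF u] filterlim_real_sequentially])
  show "Fr (cr u) g"
    by (rule Fr_closed[OF Fr_fourier_trunc[OF u] _ g l1 l2]) (use u sqint_of_real in blast)
qed

lemma Fr_fourier: assumes "sqint u" shows "Fr (cr u) (fourier u)"
proof -
  have "sqint (cr u)" using assms unfolding sqint_of_real .
  from Fr_exists[OF this] obtain g where "Fr (cr u) g" .
  then show ?thesis unfolding fourier_def is_fourier_iff_Fr by (rule someI[of "Fr (cr u)"])
qed

lemma fourier_eqI: assumes "Fr (cr u) g" shows "AE \<xi> in lborel. fourier u \<xi> = g \<xi>"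
proof -
  have "sqint u" using Fr_sqint(1)[OF assms] unfolding sqint_of_real .
  from Fr_unique[OF Fr_fourier[OF this] assms] show ?thesis by simp
qed

lemma fourier_sqint: "sqint u \<Longrightarrow> sqint (fourier u)"
  using Fr_fourier Fr_sqint(2) by blast

lemma fourier_meas: "sqint u \<Longrightarrow> fourier u \<in> borel_measurable borel"
  using fourier_sqint sqint_meas by blast

text \<open>A Hermitian symbol preserves the symmetry that characterizes transforms of real
  functions, so the product is again such a transform.\<close>

lemma multiplier_real:
  assumes u: "sqint u" and m: "\<And>\<xi>. cnj (m (- \<xi>)) = m \<xi>" and s: "sqint (\<lambda>\<xi>. m \<xi> * fourier u \<xi>)"
  obtains w where "Fr (cr w) (\<lambda>\<xi>. m \<xi> * fourier u \<xi>)"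
proof -
  have "AE \<xi> in lborel. cnj (m (- \<xi>) * fourier u (- \<xi>)) = m \<xi> * fourier u \<xi>"
    using Fr_real_herm[OF Fr_fourier[OF u]] by eventually_elim (simp add: m)
  from Fr_surj_real[OF s this] show ?thesis using that .
qed

lemma Parseval:
  assumes "Fr (cr u) g" "Fr (cr v) h" shows "(LBINT \<xi>. g \<xi> \<bullet> h \<xi>) = 2 * pi * (LBINT x. u x * v x)"
  using Fr_inner[OF assms] by (simp add: inner_complex_def)

lemma nrm_fourier: "Fr (cr u) g \<Longrightarrow> (nrm g)\<^sup>2 = 2 * pi * (nrm u)\<^sup>2"
  using Fr_nrm_sq[of "cr u" g] by (simp add: nrm_of_real)

lemma H12_iff: "H12 u \<longleftrightarrow> sqint u \<and> sqint (\<lambda>\<xi>. complex_of_real (sqrt \<bar>\<xi>\<bar>) * fourier u \<xi>)"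
proof -
  have ex: "(\<exists>g. is_fourier u g) \<longleftrightarrow> sqint u"
    using Fr_fourier Fr_sqint(1)[of "cr u"] unfolding is_fourier_iff_Fr sqint_of_real by blast
  have "(cmod (complex_of_real (sqrt \<bar>\<xi>\<bar>) * fourier u \<xi>))\<^sup>2 = \<bar>\<xi>\<bar> * (cmod (fourier u \<xi>))\<^sup>2" for \<xi>
    by (simp add: norm_mult power_mult_distrib)
  then show ?thesis unfolding H12_def ex sqint_iff_nn[of "\<lambda>\<xi>. complex_of_real (sqrt \<bar>\<xi>\<bar>) * fourier u \<xi>"]
    using fourier_meas[of u] by auto
qed

lemma H12_sqint: "H12 u \<Longrightarrow> sqint u" by (simp add: H12_iff)

lemma sqint_bounded_mult:
  fixes g :: "real \<Rightarrow> complex"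
  assumes g: "sqint g" and [measurable]: "m \<in> borel_measurable borel" and b: "\<And>\<xi>. norm (m \<xi>) \<le> B"
  shows "sqint (\<lambda>\<xi>. m \<xi> * g \<xi>)"
proof (rule sqint_bound[OF sqint_mult_left[OF g, of "complex_of_real B"]])
  have [measurable]: "g \<in> borel_measurable borel" using g sqint_meas by auto
  show "(\<lambda>\<xi>. m \<xi> * g \<xi>) \<in> borel_measurable borel" by measurable
  have "norm (m \<xi>) \<le> \<bar>B\<bar>" for \<xi> using b[of \<xi>] by linarith
  then show "AE x in lborel. norm (m x * g x) \<le> norm (complex_of_real B * g x)"
    by (auto simp: norm_mult intro!: mult_right_mono)
qed

section \<open>The energy Q and its quadratic form\<close>

locale bo_weight =
  fixes b c :: real
  assumes b: "b > 0" and c: "c < 0"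
begin

definition wt :: "real \<Rightarrow> real" where "wt \<xi> = sqrt (b * \<bar>\<xi>\<bar> - c)"

lemma wt_meas [measurable]: "wt \<in> borel_measurable borel"
  unfolding wt_def by measurable

lemma wt_arg_pos: "b * \<bar>\<xi>\<bar> - c > 0"
  using b c by (simp add: add_nonneg_pos diff_conv_add_uminus del: add_uminus_conv_diff)

lemma wt_sq: "(wt \<xi>)\<^sup>2 = b * \<bar>\<xi>\<bar> - c"
  unfolding wt_def using wt_arg_pos[of \<xi>] by simp

lemma wt_pos: "wt \<xi> > 0"
  unfolding wt_def using wt_arg_pos[of \<xi>] by simp

lemma wt_even: "wt (- \<xi>) = wt \<xi>" by (simp add: wt_def)

lemma wt_ge_root: "sqrt b * sqrt \<bar>\<xi>\<bar> \<le> wt \<xi>"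
  unfolding wt_def real_sqrt_mult[symmetric] using c by (intro real_sqrt_le_mono) simp

text \<open>The square root of the energy symbol times the transform. Up to the factor 2 pi, Q
  becomes a squared L^2 norm and \<open>Bf\<close> an L^2 inner product, so the Hilbert space facts
  of L^2 apply directly.\<close>

definition En :: "(real \<Rightarrow> real) \<Rightarrow> real \<Rightarrow> complex" where
  "En u \<xi> = complex_of_real (wt \<xi>) * fourier u \<xi>"

definition Q :: "(real \<Rightarrow> real) \<Rightarrow> real" where "Q u = (nrm (En u))\<^sup>2 / (2 * pi)"

lemma Q_nonneg: "Q u \<ge> 0" by (simp add: Q_def)

lemma nrm_En: "nrm (En u) = sqrt (2 * pi * Q u)"
  by (simp add: Q_def)

lemma En_meas: "sqint u \<Longrightarrow> En u \<in> borel_measurable borel"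
  unfolding En_def using fourier_meas[of u] by measurable

lemma norm_En_sq: "(norm (En u \<xi>))\<^sup>2 = b * (norm (complex_of_real (sqrt \<bar>\<xi>\<bar>) * fourier u \<xi>))\<^sup>2 - c * (norm (fourier u \<xi>))\<^sup>2"
  unfolding En_def by (simp add: norm_mult power_mult_distrib wt_sq left_diff_distrib)

lemma H12_iff_En: "H12 u \<longleftrightarrow> sqint u \<and> sqint (En u)"
proof
  assume "H12 u"
  then have u: "sqint u" and h: "sqint (\<lambda>\<xi>. complex_of_real (sqrt \<bar>\<xi>\<bar>) * fourier u \<xi>)" unfolding H12_iff by auto
  have "integrable lborel (\<lambda>\<xi>. (norm (En u \<xi>))\<^sup>2)"
    unfolding norm_En_sq using sqint_int[OF h] sqint_int[OF fourier_sqint[OF u]] by simp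
  then show "sqint u \<and> sqint (En u)" using u En_meas[OF u] by (simp add: sqint_def)
next
  assume a: "sqint u \<and> sqint (En u)"
  then have u: "sqint u" by simp
  note fourier_meas[OF u, measurable]
  have "sqint (\<lambda>\<xi>. complex_of_real (sqrt \<bar>\<xi>\<bar>) * fourier u \<xi>)"
  proof (rule sqint_bound[OF sqint_mult_left[of "En u" "complex_of_real (1 / sqrt b)"]])
    show "sqint (En u)" using a by simp
    have k: "sqrt \<bar>\<xi>\<bar> \<le> 1 / sqrt b * wt \<xi>" for \<xi> using wt_ge_root[of \<xi>] b by (simp add: field_simps)
    have "norm (complex_of_real (sqrt \<bar>\<xi>\<bar>) * fourier u \<xi>) \<le> norm (complex_of_real (1 / sqrt b) * En u \<xi>)" for \<xi>
    proof -
      have "norm (complex_of_real (sqrt \<bar>\<xi>\<bar>) * fourier u \<xi>) = sqrt \<bar>\<xi>\<bar> * norm (fourier u \<xi>)" by (simp add: norm_mult)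
      also have "\<dots> \<le> 1 / sqrt b * wt \<xi> * norm (fourier u \<xi>)" by (rule mult_right_mono[OF k]) simp
      also have "\<dots> = norm (complex_of_real (1 / sqrt b) * En u \<xi>)"
        unfolding En_def norm_mult norm_of_real using wt_pos[of \<xi>] b by simp
      finally show ?thesis .
    qed
    then show "AE \<xi> in lborel. norm (complex_of_real (sqrt \<bar>\<xi>\<bar>) * fourier u \<xi>) \<le> norm (complex_of_real (1 / sqrt b) * En u \<xi>)"
      by simp
  qed measurable
  then show "H12 u" unfolding H12_iff using u by simp
qed

lemma H12_En: "H12 u \<Longrightarrow> sqint (En u)" by (simp add: H12_iff_En)

lemma Q_eq:
  assumes "H12 u"
  shows "2 * pi * Q u = b * (nrm (\<lambda>\<xi>. complex_of_real (sqrt \<bar>\<xi>\<bar>) * fourier u \<xi>))\<^sup>2 - c * (2 * pi * (nrm u)\<^sup>2)"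
proof -
  have u: "sqint u" and h: "sqint (\<lambda>\<xi>. complex_of_real (sqrt \<bar>\<xi>\<bar>) * fourier u \<xi>)" using assms unfolding H12_iff by auto
  have "2 * pi * Q u = (LBINT \<xi>. (norm (En u \<xi>))\<^sup>2)" by (simp add: Q_def nrm_sq)
  also have "\<dots> = b * (nrm (\<lambda>\<xi>. complex_of_real (sqrt \<bar>\<xi>\<bar>) * fourier u \<xi>))\<^sup>2 - c * (nrm (fourier u))\<^sup>2"
    unfolding norm_En_sq nrm_sq using sqint_int[OF h] sqint_int[OF fourier_sqint[OF u]] by simp
  finally show ?thesis using nrm_fourier[OF Fr_fourier[OF u]] by simp
qed

lemma nrm_le_Q: assumes "H12 u" shows "- c * (nrm u)\<^sup>2 \<le> Q u"
proof -
  have "2 * pi * (- c * (nrm u)\<^sup>2) \<le> 2 * pi * Q u" using Q_eq[OF assms] b by simp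
  then show ?thesis by (rule mult_left_le_imp_le) simp
qed

lemma H12_norm_le: assumes "H12 u" shows "(H12_norm u)\<^sup>2 \<le> Q u / min b (- c)"
proof -
  let ?m = "min b (- c)"
  have m: "?m > 0" using b c by simp
  have u: "sqint u" using H12_sqint[OF assms] .
  note fourier_meas[OF u, measurable]
  have "(\<integral>\<^sup>+ \<xi>. ennreal ((1 + \<bar>\<xi>\<bar>) * (cmod (fourier u \<xi>))\<^sup>2) \<partial>lborel) \<le> (\<integral>\<^sup>+ \<xi>. ennreal (1 / ?m) * ennreal ((norm (En u \<xi>))\<^sup>2) \<partial>lborel)"
  proof (rule nn_integral_mono)
    fix \<xi>
    have "?m * (1 + \<bar>\<xi>\<bar>) \<le> b * \<bar>\<xi>\<bar> - c"
      using mult_right_mono[of ?m b "\<bar>\<xi>\<bar>"] by (simp add: distrib_left)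
    then have "(1 + \<bar>\<xi>\<bar>) * (cmod (fourier u \<xi>))\<^sup>2 \<le> 1 / ?m * (b * \<bar>\<xi>\<bar> - c) * (cmod (fourier u \<xi>))\<^sup>2"
      using m by (intro mult_right_mono) (simp_all add: field_simps)
    also have "\<dots> = 1 / ?m * (norm (En u \<xi>))\<^sup>2"
      unfolding En_def by (simp add: norm_mult power_mult_distrib wt_sq)
    finally show "ennreal ((1 + \<bar>\<xi>\<bar>) * (cmod (fourier u \<xi>))\<^sup>2) \<le> ennreal (1 / ?m) * ennreal ((norm (En u \<xi>))\<^sup>2)"
      using m by (simp add: ennreal_leI flip: ennreal_mult)
  qed
  also have "\<dots> = ennreal (1 / ?m) * ennreal ((nrm (En u))\<^sup>2)"
    by (subst nn_integral_cmult) (use En_meas[OF u] nn_integral_sqint[OF H12_En[OF assms]] in auto)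
  also have "\<dots> = ennreal (1 / ?m * (2 * pi * Q u))" using m by (simp add: Q_def flip: ennreal_mult)
  finally have "enn2real (\<integral>\<^sup>+ \<xi>. ennreal ((1 + \<bar>\<xi>\<bar>) * (cmod (fourier u \<xi>))\<^sup>2) \<partial>lborel) \<le> 1 / ?m * (2 * pi * Q u)"
    by (rule enn2real_leI[rotated]) (use m Q_nonneg in simp)
  then have "enn2real (\<integral>\<^sup>+ \<xi>. ennreal ((1 + \<bar>\<xi>\<bar>) * (cmod (fourier u \<xi>))\<^sup>2) \<partial>lborel) / (2 * pi) \<le> 1 / ?m * (2 * pi * Q u) / (2 * pi)"
    by (rule divide_right_mono) simp
  then show ?thesis unfolding H12_norm_def by simp
qed

text \<open>Linearity holds only almost everywhere, because \<open>fourier\<close> picks a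
  representative for each function separately.\<close>

lemma H12_lin:
  assumes "H12 u" "H12 v"
  shows "H12 (\<lambda>x. s * u x + t * v x)"
    "AE \<xi> in lborel. En (\<lambda>x. s * u x + t * v x) \<xi> = complex_of_real s * En u \<xi> + complex_of_real t * En v \<xi>"
proof -
  have u: "sqint u" "sqint (En u)" and v: "sqint v" "sqint (En v)" using assms unfolding H12_iff_En by auto
  have F: "Fr (cr (\<lambda>x. s * u x + t * v x)) (\<lambda>\<xi>. complex_of_real s * fourier u \<xi> + complex_of_real t * fourier v \<xi>)"
    using Fr_add[OF Fr_cmult[OF Fr_fourier[OF u(1)], of "complex_of_real s"] Fr_cmult[OF Fr_fourier[OF v(1)], of "complex_of_real t"]] by simp
  show ae: "AE \<xi> in lborel. En (\<lambda>x. s * u x + t * v x) \<xi> = complex_of_real s * En u \<xi> + complex_of_real t * En v \<xi>"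
    using fourier_eqI[OF F] by eventually_elim (simp add: En_def algebra_simps)
  have w: "sqint (\<lambda>x. s * u x + t * v x)" by (intro sqint_add sqint_mult_left u v)
  have "sqint (En (\<lambda>x. s * u x + t * v x))"
  proof (rule sqint_cong_AE[OF sqint_add[OF sqint_mult_left[OF u(2), of "complex_of_real s"] sqint_mult_left[OF v(2), of "complex_of_real t"]] En_meas[OF w]])
    show "AE \<xi> in lborel. complex_of_real s * En u \<xi> + complex_of_real t * En v \<xi> = En (\<lambda>x. s * u x + t * v x) \<xi>"
      using ae by eventually_elim simp
  qed
  then show "H12 (\<lambda>x. s * u x + t * v x)" unfolding H12_iff_En using w by simp
qed

definition Bf :: "(real \<Rightarrow> real) \<Rightarrow> (real \<Rightarrow> real) \<Rightarrow> real" where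
  "Bf u v = (LBINT \<xi>. En u \<xi> \<bullet> En v \<xi>) / (2 * pi)"

lemma Q_lin:
  assumes "H12 u" "H12 v"
  shows "Q (\<lambda>x. s * u x + t * v x) = s\<^sup>2 * Q u + 2 * s * t * Bf u v + t\<^sup>2 * Q v"
proof -
  let ?a = "\<lambda>\<xi>. complex_of_real s * En u \<xi>" and ?b = "\<lambda>\<xi>. complex_of_real t * En v \<xi>"
  have a: "sqint ?a" and b: "sqint ?b" using H12_En assms by (auto intro: sqint_mult_left)
  have "nrm (En (\<lambda>x. s * u x + t * v x)) = nrm (\<lambda>\<xi>. ?a \<xi> + ?b \<xi>)"
    by (rule nrm_cong_AE[OF _ _ H12_lin(2)[OF assms]])
      (use H12_En[OF H12_lin(1)[OF assms]] sqint_add[OF a b] sqint_meas in auto)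
  then have "(nrm (En (\<lambda>x. s * u x + t * v x)))\<^sup>2 = (nrm ?a)\<^sup>2 + 2 * (LBINT \<xi>. ?a \<xi> \<bullet> ?b \<xi>) + (nrm ?b)\<^sup>2"
    using nrm_add_sq[OF a b] by simp
  also have "(LBINT \<xi>. ?a \<xi> \<bullet> ?b \<xi>) = (LBINT \<xi>. s * t * (En u \<xi> \<bullet> En v \<xi>))"
    by (rule Bochner_Integration.integral_cong) (auto simp: inner_complex_def algebra_simps)
  finally show ?thesis unfolding Q_def Bf_def by (simp add: nrm_mult_left power_mult_distrib field_simps)
qed

text \<open>The geometric mean of the bounds 2 and |t|; this is how half a derivative becomes a
  modulus of continuity of order 1/2.\<close>

lemma norm_exp_minus_1_le: "norm (exp (\<i> * complex_of_real t) - 1) \<le> sqrt (2 * \<bar>t\<bar>)"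
proof -
  have e: "norm (exp (\<i> * complex_of_real t) - 1) = 2 * \<bar>sin (t / 2)\<bar>"
    using dist_exp_i_1[of t] by simp
  have s: "\<bar>sin (t/2)\<bar> \<le> \<bar>t/2\<bar>" by (rule abs_sin_x_le_abs_x)
  have "(2 * \<bar>sin (t / 2)\<bar>)\<^sup>2 = 4 * (\<bar>sin (t / 2)\<bar> * \<bar>sin (t / 2)\<bar>)" by (simp add: power2_eq_square)
  also have "\<dots> \<le> 4 * (\<bar>sin (t / 2)\<bar> * 1)" by (intro mult_left_mono) auto
  also have "\<dots> \<le> 2 * \<bar>t\<bar>" using s by simp
  finally show ?thesis unfolding e by (rule real_le_rsqrt)
qed

text \<open>A translation by y multiplies the transform by a unimodular factor differing from 1 by
  at most sqrt (2 |\<xi>| |y|). The factor sqrt |\<xi>| is absorbed by the weight at the price 1 /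
  sqrt b, which explains the constant 2 E / b; the other constant comes from -c |u|^2 <= Q
  u.\<close>

lemma H12_tbound:
  assumes h: "H12 u" and E: "Q u \<le> E"
  shows "tbound (sqrt (E / (- c))) (sqrt (2 * E / b)) u"
  unfolding tbound_def
proof (intro conjI allI)
  show u: "sqint u" using H12_sqint[OF h] .
  have "(nrm u)\<^sup>2 \<le> E / (- c)" using nrm_le_Q[OF h] E c by (simp add: field_simps)
  then show "nrm u \<le> sqrt (E / (- c))" by (rule real_le_rsqrt)
  fix y :: real
  have F: "Fr (\<lambda>x. cr u (x + y) - cr u x) (\<lambda>\<xi>. exp (\<i> * complex_of_real (\<xi> * y)) * fourier u \<xi> - fourier u \<xi>)"
    by (rule Fr_diff[OF Fr_translate[OF Fr_fourier[OF u]] Fr_fourier[OF u]])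
  let ?k = "sqrt (2 * \<bar>y\<bar> / b)"
  have "nrm (\<lambda>\<xi>. exp (\<i> * complex_of_real (\<xi> * y)) * fourier u \<xi> - fourier u \<xi>) \<le> nrm (\<lambda>\<xi>. complex_of_real ?k * En u \<xi>)"
  proof (rule nrm_mono[OF sqint_mult_left[OF H12_En[OF h]] Fr_sqint(2)[OF F]], rule AE_I2)
    fix \<xi>
    have "norm (exp (\<i> * complex_of_real (\<xi> * y)) * fourier u \<xi> - fourier u \<xi>) = norm (exp (\<i> * complex_of_real (\<xi> * y)) - 1) * norm (fourier u \<xi>)"
      by (simp add: left_diff_distrib flip: norm_mult)
    also have "\<dots> \<le> sqrt (2 * \<bar>\<xi> * y\<bar>) * norm (fourier u \<xi>)" by (intro mult_right_mono norm_exp_minus_1_le) simp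
    also have "sqrt (2 * \<bar>\<xi> * y\<bar>) = ?k * (sqrt b * sqrt \<bar>\<xi>\<bar>)"
      using b by (simp add: abs_mult flip: real_sqrt_mult)
    also have "\<dots> * norm (fourier u \<xi>) \<le> ?k * wt \<xi> * norm (fourier u \<xi>)"
      by (intro mult_right_mono mult_left_mono wt_ge_root) (use b in auto)
    also have "\<dots> = norm (complex_of_real ?k * En u \<xi>)"
      unfolding En_def norm_mult using wt_pos[of \<xi>] b by simp
    finally show "norm (exp (\<i> * complex_of_real (\<xi> * y)) * fourier u \<xi> - fourier u \<xi>) \<le> norm (complex_of_real ?k * En u \<xi>)" .
  qed
  also have "\<dots> = ?k * sqrt (2 * pi * Q u)" unfolding nrm_mult_left nrm_En using b by simp
  finally have "sqrt (2 * pi) * nrm (\<lambda>x. cr u (x + y) - cr u x) \<le> sqrt (2 * pi) * (?k * sqrt (Q u))"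
    unfolding Fr_nrm[OF F] real_sqrt_mult by (simp add: mult_ac)
  then have "nrm (\<lambda>x. cr u (x + y) - cr u x) \<le> ?k * sqrt (Q u)" by (rule mult_left_le_imp_le) simp
  also have "\<dots> \<le> ?k * sqrt E" using E b by (intro mult_left_mono) auto
  also have "\<dots> = sqrt (2 * E / b) * sqrt \<bar>y\<bar>" by (simp add: mult_ac flip: real_sqrt_mult)
  finally show "nrm (\<lambda>x. u (x + y) - u x) \<le> sqrt (2 * E / b) * sqrt \<bar>y\<bar>"
    unfolding of_real_diff[symmetric] nrm_of_real .
qed

lemma H12_translate:
  assumes h: "H12 u" shows "H12 (\<lambda>x. u (x + y))" "Q (\<lambda>x. u (x + y)) = Q u"
proof -
  have u: "sqint u" using H12_sqint[OF h] .
  have ut: "sqint (\<lambda>x. u (x + y))" using u by (rule sqint_translate)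
  have F: "Fr (cr (\<lambda>x. u (x + y))) (\<lambda>\<xi>. exp (\<i> * complex_of_real (\<xi> * y)) * fourier u \<xi>)"
    by (rule Fr_translate[OF Fr_fourier[OF u]])
  have ae: "AE \<xi> in lborel. En (\<lambda>x. u (x + y)) \<xi> = exp (\<i> * complex_of_real (\<xi> * y)) * En u \<xi>"
    using fourier_eqI[OF F] by eventually_elim (simp add: En_def)
  have s: "sqint (\<lambda>\<xi>. exp (\<i> * complex_of_real (\<xi> * y)) * En u \<xi>)" by (rule sqint_exp_mult[OF H12_En[OF h]])
  have "sqint (En (\<lambda>x. u (x + y)))"
    by (rule sqint_cong_AE[OF s En_meas[OF ut]]) (use ae in \<open>eventually_elim, simp\<close>)
  then show "H12 (\<lambda>x. u (x + y))" unfolding H12_iff_En using ut by simp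
  have "nrm (En (\<lambda>x. u (x + y))) = nrm (\<lambda>\<xi>. exp (\<i> * complex_of_real (\<xi> * y)) * En u \<xi>)"
    by (rule nrm_cong_AE[OF En_meas[OF ut] sqint_meas[OF s] ae])
  also have "\<dots> = nrm (En u)" unfolding nrm_def norm_mult norm_exp_ii' by simp
  finally show "Q (\<lambda>x. u (x + y)) = Q u" unfolding Q_def by simp
qed

end

lemma inner_of_real_mult: "(complex_of_real s * a) \<bullet> (complex_of_real t * z) = s * t * (a \<bullet> z)"
  by (simp add: inner_complex_def algebra_simps)

context bo_weight
begin

lemma H12_diff:
  assumes "H12 u" "H12 v"
  shows "H12 (\<lambda>x. u x - v x)" "Q (\<lambda>x. u x - v x) = Q u - 2 * Bf u v + Q v"
    "AE \<xi> in lborel. En (\<lambda>x. u x - v x) \<xi> = En u \<xi> - En v \<xi>"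
  using H12_lin[OF assms, of 1 "-1"] Q_lin[OF assms, of 1 "-1"] by auto

text \<open>The integral splits only when its summands are integrable, so it is first checked that
  the functions selected by \<open>Dhalf\<close> and \<open>dinv\<close> exist and are square
  integrable; the rest is Plancherel.\<close>

lemma Ifun_eq:
  assumes u: "u \<in> Xsp" shows "Ifun u b c \<gamma> = Q u + \<gamma> * (nrm (dinv u))\<^sup>2"
proof -
  have h: "H12 u" and ex: "\<exists>v. has_L2_antideriv u v" using u unfolding Xsp_def by auto
  have su: "sqint u" and sh: "sqint (\<lambda>\<xi>. complex_of_real (sqrt \<bar>\<xi>\<bar>) * fourier u \<xi>)" using h unfolding H12_iff by auto
  have "has_L2_antideriv u (dinv u)" unfolding dinv_def using ex by (rule someI_ex)
  then have "\<exists>g. Fr (cr (dinv u)) g" unfolding has_L2_antideriv_def is_fourier_iff_Fr by auto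
  then have sd: "sqint (dinv u)" using Fr_sqint(1) unfolding sqint_of_real[symmetric] by auto
  obtain w where "Fr (cr w) (\<lambda>\<xi>. complex_of_real (sqrt \<bar>\<xi>\<bar>) * fourier u \<xi>)"
    using multiplier_real[OF su, of "\<lambda>\<xi>. complex_of_real (sqrt \<bar>\<xi>\<bar>)"] sh by auto
  then have FD: "Fr (cr (Dhalf u)) (\<lambda>\<xi>. complex_of_real (sqrt \<bar>\<xi>\<bar>) * fourier u \<xi>)"
    unfolding Dhalf_def is_fourier_iff_Fr by (rule someI[of "\<lambda>w. Fr (cr w) (\<lambda>\<xi>. complex_of_real (sqrt \<bar>\<xi>\<bar>) * fourier u \<xi>)"])
  have sD: "sqint (Dhalf u)" using Fr_sqint(1)[OF FD] unfolding sqint_of_real .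
  have "Ifun u b c \<gamma> = (LBINT x. b * (norm (Dhalf u x))\<^sup>2 - c * (norm (u x))\<^sup>2 + \<gamma> * (norm (dinv u x))\<^sup>2)"
    unfolding Ifun_def by simp
  also have "\<dots> = b * (nrm (Dhalf u))\<^sup>2 - c * (nrm u)\<^sup>2 + \<gamma> * (nrm (dinv u))\<^sup>2"
    unfolding nrm_sq using sqint_int[OF sD] sqint_int[OF su] sqint_int[OF sd] by simp
  also have "b * (nrm (Dhalf u))\<^sup>2 - c * (nrm u)\<^sup>2 = Q u"
  proof -
    have "2 * pi * (b * (nrm (Dhalf u))\<^sup>2 - c * (nrm u)\<^sup>2) = 2 * pi * Q u"
      unfolding Q_eq[OF h] nrm_fourier[OF FD] by (simp add: algebra_simps)
    then show ?thesis by simp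
  qed
  finally show ?thesis .
qed

text \<open>Frequencies up to 1 / (j + 1) are removed. On the remaining ones the symbol of the
  inverse derivative is bounded by j + 1, so the cut function has an antiderivative in L^2.\<close>

lemma Xsp_dense:
  assumes h: "H12 u"
  obtains w where "\<And>j. w j \<in> Xsp" "(\<lambda>j. Q (\<lambda>x. w j x - u x)) \<longlonglongrightarrow> 0"
proof -
  have su: "sqint u" and se: "sqint (En u)" using h unfolding H12_iff_En by auto
  note fourier_meas[OF su, measurable] En_meas[OF su, measurable]
  define i where "i j \<xi> = (if \<bar>\<xi>\<bar> > 1 / real (Suc j) then 1 else 0 :: complex)" for j \<xi>
  have im [measurable]: "i j \<in> borel_measurable borel" for j unfolding i_def by measurable
  have ib: "norm (i j \<xi>) \<le> 1" for j \<xi> by (simp add: i_def)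
  have "\<exists>w. Fr (cr w) (\<lambda>\<xi>. i j \<xi> * fourier u \<xi>)" for j
  proof -
    have "cnj (i j (- \<xi>)) = i j \<xi>" for \<xi> by (simp add: i_def)
    from multiplier_real[OF su this sqint_bounded_mult[OF fourier_sqint[OF su] im ib]] show ?thesis by blast
  qed
  then obtain w where w: "\<And>j. Fr (cr (w j)) (\<lambda>\<xi>. i j \<xi> * fourier u \<xi>)" by metis
  have sw: "sqint (w j)" for j using Fr_sqint(1)[OF w] unfolding sqint_of_real .
  have Ew: "AE \<xi> in lborel. En (w j) \<xi> = i j \<xi> * En u \<xi>" for j
    using fourier_eqI[OF w[of j]] by eventually_elim (simp add: En_def)
  have sie: "sqint (\<lambda>\<xi>. i j \<xi> * En u \<xi>)" for j by (rule sqint_bounded_mult[OF se im ib])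
  have hw: "H12 (w j)" for j
    unfolding H12_iff_En
  proof
    show "sqint (En (w j))"
      by (rule sqint_cong_AE[OF sie[of j] En_meas[OF sw]]) (use Ew[of j] in \<open>eventually_elim, simp\<close>)
  qed (rule sw)
  have X: "w j \<in> Xsp" for j
  proof -
    let ?m = "\<lambda>\<xi>. i j \<xi> / (\<i> * complex_of_real \<xi>)"
    have mb: "norm (?m \<xi>) \<le> real (Suc j)" for \<xi>
    proof (cases "\<bar>\<xi>\<bar> > 1 / real (Suc j)")
      case True
      then have "\<bar>\<xi>\<bar> > 0" by (rule less_trans[rotated]) simp
      moreover have "1 < real (Suc j) * \<bar>\<xi>\<bar>" using True by (simp add: field_simps)
      ultimately have "1 / \<bar>\<xi>\<bar> \<le> real (Suc j)" by (simp add: pos_divide_le_eq del: of_nat_Suc)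
      then show ?thesis using True by (simp add: i_def norm_divide norm_mult)
    qed (simp add: i_def)
    have "cnj (?m (- \<xi>)) = ?m \<xi>" for \<xi> by (simp add: i_def)
    moreover have "sqint (\<lambda>\<xi>. ?m \<xi> * fourier u \<xi>)"
      by (rule sqint_bounded_mult[OF fourier_sqint[OF su] _ mb]) measurable
    ultimately obtain v where v: "Fr (cr v) (\<lambda>\<xi>. ?m \<xi> * fourier u \<xi>)"
      using multiplier_real[OF su, of ?m] by blast
    have "AE \<xi> in lborel. ?m \<xi> * fourier u \<xi> * (\<i> * complex_of_real \<xi>) = fourier (w j) \<xi>"
      using fourier_eqI[OF w[of j]]
    proof eventually_elim
      fix \<xi> assume "fourier (w j) \<xi> = i j \<xi> * fourier u \<xi>"
      then show "?m \<xi> * fourier u \<xi> * (\<i> * complex_of_real \<xi>) = fourier (w j) \<xi>"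
        by (cases "\<xi> = 0") (auto simp: i_def)
    qed
    then have "has_L2_antideriv (w j) v" unfolding has_L2_antideriv_def is_fourier_iff_Fr using v by blast
    then show ?thesis unfolding Xsp_def using hw by blast
  qed
  have "(\<lambda>j. LBINT \<xi>. (norm (i j \<xi> * En u \<xi> - En u \<xi>))\<^sup>2) \<longlonglongrightarrow> (\<integral>\<xi>. 0 \<partial>(lborel :: real measure))"
  proof (rule integral_dominated_convergence[where w="\<lambda>\<xi>. (norm (En u \<xi>))\<^sup>2"])
    show "AE \<xi> in lborel. (\<lambda>j. (norm (i j \<xi> * En u \<xi> - En u \<xi>))\<^sup>2) \<longlonglongrightarrow> 0"
      \<comment> \<open>At frequency 0 the cutoff vanishes for every \<open>j\<close>; convergence
        holds at all other points.\<close>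
      using AE_lborel_singleton[of "0::real"]
    proof eventually_elim
      fix \<xi> :: real assume "\<xi> \<noteq> 0"
      then obtain N where N: "inverse (real (Suc N)) < \<bar>\<xi>\<bar>" using reals_Archimedean[of "\<bar>\<xi>\<bar>"] by auto
      have "i j \<xi> = 1" if "j \<ge> N" for j
      proof -
        have "1 / real (Suc j) \<le> inverse (real (Suc N))" using that by (simp add: field_simps)
        then show ?thesis using N by (simp add: i_def)
      qed
      then show "(\<lambda>j. (norm (i j \<xi> * En u \<xi> - En u \<xi>))\<^sup>2) \<longlonglongrightarrow> 0"
        by (intro tendsto_eventually eventually_sequentiallyI[of N]) simp
    qed
    show "AE \<xi> in lborel. norm ((norm (i j \<xi> * En u \<xi> - En u \<xi>))\<^sup>2) \<le> (norm (En u \<xi>))\<^sup>2" for j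
      by (auto simp: i_def)
  qed (use sqint_int[OF se] in measurable)
  then have lim: "(\<lambda>j. (nrm (\<lambda>\<xi>. i j \<xi> * En u \<xi> - En u \<xi>))\<^sup>2) \<longlonglongrightarrow> 0" by (simp add: nrm_sq)
  have "nrm (En (\<lambda>x. w j x - u x)) = nrm (\<lambda>\<xi>. i j \<xi> * En u \<xi> - En u \<xi>)" for j
  proof (rule nrm_cong_AE)
    show "AE \<xi> in lborel. En (\<lambda>x. w j x - u x) \<xi> = i j \<xi> * En u \<xi> - En u \<xi>"
      using H12_diff(3)[OF hw[of j] h] Ew[of j] by eventually_elim simp
  qed (use En_meas[OF sqint_diff[OF sw su]] in measurable)
  then have "(\<lambda>j. Q (\<lambda>x. w j x - u x)) \<longlonglongrightarrow> 0" unfolding Q_def using tendsto_divide[OF lim tendsto_const, of "2 * pi"] by simp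
  then show ?thesis using that X by blast
qed

lemma Bf_bound: assumes "H12 u" "H12 v" shows "\<bar>Bf u v\<bar> \<le> sqrt (Q u) * sqrt (Q v)"
proof -
  have "\<bar>Bf u v\<bar> \<le> nrm (En u) * nrm (En v) / (2 * pi)"
    unfolding Bf_def using Cauchy_Schwarz_inner[OF H12_En[OF assms(1)] H12_En[OF assms(2)]]
    by (simp add: abs_divide divide_right_mono)
  also have "\<dots> = sqrt (Q u) * sqrt (Q v)"
  proof -
    have "(k * x) * (k * y) / k\<^sup>2 = x * y" if "k > 0" for k x y :: real using that by (simp add: power2_eq_square)
    from this[of "sqrt (2 * pi)"] show ?thesis unfolding nrm_En real_sqrt_mult[of "2 * pi"] by simp
  qed
  finally show ?thesis .
qed

text \<open>Almost everywhere convergence lives in space, the energy in frequency. After restricting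
  the test function to |\<xi>| <= R its squared weight is a bounded even symbol, so the energy
  pairing is an ordinary L^2 pairing with a fixed real function, where
  \<open>weak_convergence_AE\<close> applies. R is sent to infinity only afterwards.\<close>

theorem weak_limit_H12:
  assumes h: "\<And>n. H12 (u n)" and B: "\<And>n. Q (u n) \<le> B" and vm: "v \<in> borel_measurable borel"
    and lim: "AE x in lborel. (\<lambda>n. u n x) \<longlonglongrightarrow> v x"
  shows "H12 v" "\<And>z. H12 z \<Longrightarrow> (\<lambda>n. Bf (u n) z) \<longlonglongrightarrow> Bf v z"
proof -
  have su: "\<And>n. sqint (u n)" using h H12_sqint by blast
  have nu: "nrm (u n) \<le> sqrt (B / (- c))" for n using H12_tbound[OF h B] unfolding tbound_def by blast
  have sv: "sqint v" using sqint_Fatou(1)[OF su _ lim vm] nu by (metis always_eventually)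
  have B0: "B \<ge> 0" using order_trans[OF Q_nonneg B] .
  define I where "I R \<xi> = (indicator {-R..R} \<xi> :: real)" for R \<xi> :: real
  have Im [measurable]: "I R \<in> borel_measurable borel" for R unfolding I_def by measurable
  have II: "I R \<xi> * I R \<xi> = I R \<xi>" for R \<xi> by (simp add: I_def indicator_def)
  define cE where "cE R y \<xi> = complex_of_real (I R \<xi>) * En y \<xi>" for R y \<xi>
  have wtI: "\<bar>(wt \<xi>)\<^sup>2 * I R \<xi>\<bar> \<le> b * \<bar>R\<bar> - c" for R \<xi>
  proof (cases "\<xi> \<in> {-R..R}")
    case True
    then have "b * \<bar>\<xi>\<bar> \<le> b * \<bar>R\<bar>" using b by (intro mult_left_mono) auto
    then show ?thesis using True wt_arg_pos[of \<xi>] by (simp add: I_def wt_sq)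
  qed (use wt_arg_pos[of R] in \<open>simp add: I_def\<close>)
  have scE: "sqint (cE R y)" if "sqint y" for R y
  proof -
    have "norm (complex_of_real (I R \<xi> * wt \<xi>)) \<le> sqrt (b * \<bar>R\<bar> - c)" for \<xi>
    proof -
      have "(I R \<xi> * wt \<xi>)\<^sup>2 = (wt \<xi>)\<^sup>2 * I R \<xi>" using II[of R \<xi>] by (auto simp: power2_eq_square)
      also have "\<dots> \<le> b * \<bar>R\<bar> - c" using wtI[of \<xi> R] by simp
      finally show ?thesis unfolding norm_of_real by (intro real_le_rsqrt) simp
    qed
    from sqint_bounded_mult[OF fourier_sqint[OF that] _ this]
    have "sqint (\<lambda>\<xi>. complex_of_real (I R \<xi> * wt \<xi>) * fourier y \<xi>)" by measurable
    then show ?thesis unfolding cE_def En_def by (simp add: mult.assoc)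
  qed
  have wk: "(\<lambda>n. LBINT \<xi>. En (u n) \<xi> \<bullet> cE R z \<xi>) \<longlonglongrightarrow> (LBINT \<xi>. En v \<xi> \<bullet> cE R z \<xi>)" if z: "sqint z" for R z
  proof -
    let ?m = "\<lambda>\<xi>. complex_of_real ((wt \<xi>)\<^sup>2 * I R \<xi>)"
    have mb: "norm (?m \<xi>) \<le> b * \<bar>R\<bar> - c" for \<xi> unfolding norm_of_real by (rule wtI)
    have "sqint (\<lambda>\<xi>. ?m \<xi> * fourier z \<xi>)"
      by (rule sqint_bounded_mult[OF fourier_sqint[OF z] _ mb]) measurable
    moreover have "cnj (?m (- \<xi>)) = ?m \<xi>" for \<xi> by (auto simp: I_def wt_even indicator_def)
    ultimately obtain w where w: "Fr (cr w) (\<lambda>\<xi>. ?m \<xi> * fourier z \<xi>)" using multiplier_real[OF z, of ?m] by blast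
    have sw: "sqint w" using Fr_sqint(1)[OF w] unfolding sqint_of_real .
    have e: "(LBINT \<xi>. En y \<xi> \<bullet> cE R z \<xi>) = 2 * pi * (LBINT x. y x * w x)" if y: "sqint y" for y
    proof -
      have "En y \<xi> \<bullet> cE R z \<xi> = fourier y \<xi> \<bullet> (?m \<xi> * fourier z \<xi>)" for \<xi>
        by (simp add: En_def cE_def inner_complex_def algebra_simps power2_eq_square)
      then show ?thesis using Parseval[OF Fr_fourier[OF y] w] by simp
    qed
    show ?thesis unfolding e[OF su] e[OF sv]
      by (intro tendsto_intros weak_convergence_AE[OF su nu lim sv sw])
  qed
  \<comment> \<open>Testing with the cut limit itself bounds its squared norm by a constant times
    its norm; the constant is independent of R, so Fatou gives finite energy of the limit.\<close>
  have cut_le: "nrm (cE R v) \<le> sqrt (2 * pi * B)" for R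
  proof -
    have "\<bar>LBINT \<xi>. En (u n) \<xi> \<bullet> cE R v \<xi>\<bar> \<le> sqrt (2 * pi * B) * nrm (cE R v)" for n
    proof -
      have "\<bar>LBINT \<xi>. En (u n) \<xi> \<bullet> cE R v \<xi>\<bar> \<le> nrm (En (u n)) * nrm (cE R v)"
        by (rule Cauchy_Schwarz_inner[OF H12_En[OF h] scE[OF sv]])
      also have "\<dots> \<le> sqrt (2 * pi * B) * nrm (cE R v)"
        unfolding nrm_En using B by (intro mult_right_mono real_sqrt_le_mono) auto
      finally show ?thesis .
    qed
    then have "\<bar>LBINT \<xi>. En v \<xi> \<bullet> cE R v \<xi>\<bar> \<le> sqrt (2 * pi * B) * nrm (cE R v)"
      by (intro LIMSEQ_le_const2[OF tendsto_rabs[OF wk[OF sv]]]) auto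
    moreover have "En v \<xi> \<bullet> cE R v \<xi> = (norm (cE R v \<xi>))\<^sup>2" for \<xi>
      by (simp add: cE_def norm_mult power2_norm_eq_inner[symmetric] I_def indicator_def)
    ultimately have "(nrm (cE R v))\<^sup>2 \<le> sqrt (2 * pi * B) * nrm (cE R v)" by (simp add: nrm_sq)
    then show ?thesis using B0
      by (cases "nrm (cE R v) = 0") (simp_all add: power2_eq_square mult_le_cancel_right order_less_le)
  qed
  have "sqint (En v)"
  proof (rule sqint_Fatou(1))
    show "sqint (cE (real n) v)" for n by (rule scE[OF sv])
    show "\<forall>\<^sub>F n in sequentially. nrm (cE (real n) v) \<le> sqrt (2 * pi * B)" using cut_le by simp
    show "AE \<xi> in lborel. (\<lambda>n. cE (real n) v \<xi>) \<longlonglongrightarrow> En v \<xi>"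
    proof (rule AE_I2)
      fix \<xi> :: real
      obtain N where "\<bar>\<xi>\<bar> \<le> real N" using real_arch_simple by blast
      then show "(\<lambda>n. cE (real n) v \<xi>) \<longlonglongrightarrow> En v \<xi>"
        by (intro tendsto_eventually eventually_sequentiallyI[of N]) (auto simp: cE_def I_def indicator_def abs_le_iff)
    qed
    show "En v \<in> borel_measurable borel" by (rule En_meas[OF sv])
  qed
  then show hv: "H12 v" unfolding H12_iff_En using sv by simp
  fix z assume z: "H12 z"
  have sz: "sqint z" and ez: "sqint (En z)" using z unfolding H12_iff_En by auto
  note En_meas[OF sz, measurable]
  \<comment> \<open>High frequencies of the fixed \<open>z\<close> are uniformly negligible against
    the bounded energies of the sequence.\<close>
  have tail: "(\<lambda>k. nrm (\<lambda>\<xi>. En z \<xi> - cE (real k) z \<xi>)) \<longlonglongrightarrow> 0"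
  proof -
    have "(\<lambda>k. LBINT \<xi>. (norm (En z \<xi> - cE (real k) z \<xi>))\<^sup>2) \<longlonglongrightarrow> (\<integral>\<xi>. 0 \<partial>(lborel :: real measure))"
    proof (rule integral_dominated_convergence[where w="\<lambda>\<xi>. (norm (En z \<xi>))\<^sup>2"])
      show "AE \<xi> in lborel. (\<lambda>k. (norm (En z \<xi> - cE (real k) z \<xi>))\<^sup>2) \<longlonglongrightarrow> 0"
      proof (rule AE_I2)
        fix \<xi> :: real
        obtain N where "\<bar>\<xi>\<bar> \<le> real N" using real_arch_simple by blast
        then show "(\<lambda>n. (norm (En z \<xi> - cE (real n) z \<xi>))\<^sup>2) \<longlonglongrightarrow> 0"
          by (intro tendsto_eventually eventually_sequentiallyI[of N]) (auto simp: cE_def I_def indicator_def abs_le_iff)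
      qed
      show "AE \<xi> in lborel. norm ((norm (En z \<xi> - cE (real k) z \<xi>))\<^sup>2) \<le> (norm (En z \<xi>))\<^sup>2" for k
        by (auto simp: cE_def I_def indicator_def)
    qed (use sqint_int[OF ez] in \<open>auto simp: cE_def\<close>)
    from tendsto_real_sqrt[OF this] show ?thesis unfolding nrm_def by simp
  qed
  have near: "\<bar>(LBINT \<xi>. En y \<xi> \<bullet> En z \<xi>) - (LBINT \<xi>. En y \<xi> \<bullet> cE R z \<xi>)\<bar> \<le> nrm (En y) * nrm (\<lambda>\<xi>. En z \<xi> - cE R z \<xi>)"
    if y: "H12 y" for y R
    using Cauchy_Schwarz_inner[OF H12_En[OF y] sqint_diff[OF ez scE[OF sz]], of R]
    by (simp add: inner_diff_right integrable_inner[OF H12_En[OF y] ez] integrable_inner[OF H12_En[OF y] scE[OF sz]])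
  have "(\<lambda>n. LBINT \<xi>. En (u n) \<xi> \<bullet> En z \<xi>) \<longlonglongrightarrow> (LBINT \<xi>. En v \<xi> \<bullet> En z \<xi>)"
  proof (rule LIMSEQ_I)
    fix e :: real assume e: "e > 0"
    define S where "S = sqrt (2 * pi * B) + nrm (En v) + 1"
    have S: "S > 0" "\<And>n. nrm (En (u n)) \<le> S" "nrm (En v) \<le> S"
    proof -
      have "sqrt (2 * pi * B) \<ge> 0" using B0 by simp
      then show "S > 0" "nrm (En v) \<le> S" unfolding S_def using nrm_nonneg[of "En v"] by linarith+
      show "nrm (En (u n)) \<le> S" for n
      proof -
        have "nrm (En (u n)) \<le> sqrt (2 * pi * B)" unfolding nrm_En using B by (intro real_sqrt_le_mono) simp
        then show ?thesis unfolding S_def using nrm_nonneg[of "En v"] by linarith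
      qed
    qed
    have "e / (3 * S) > 0" using e S by simp
    from LIMSEQ_D[OF tail this] obtain k where k: "nrm (\<lambda>\<xi>. En z \<xi> - cE (real k) z \<xi>) < e / (3 * S)" by force
    have nr: "\<bar>(LBINT \<xi>. En y \<xi> \<bullet> En z \<xi>) - (LBINT \<xi>. En y \<xi> \<bullet> cE (real k) z \<xi>)\<bar> \<le> e / 3" if y: "H12 y" "nrm (En y) \<le> S" for y
    proof -
      have "nrm (En y) * nrm (\<lambda>\<xi>. En z \<xi> - cE (real k) z \<xi>) \<le> S * (e / (3 * S))"
        using k y(2) S(1) by (intro mult_mono) auto
      also have "\<dots> = e / 3" using S(1) by simp
      finally show ?thesis using near[OF y(1), of "real k"] by linarith
    qed
    obtain N where N: "\<And>n. n \<ge> N \<Longrightarrow> \<bar>(LBINT \<xi>. En (u n) \<xi> \<bullet> cE (real k) z \<xi>) - (LBINT \<xi>. En v \<xi> \<bullet> cE (real k) z \<xi>)\<bar> < e / 3"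
      using LIMSEQ_D[OF wk[OF sz, of "real k"], of "e/3"] e by auto
    have "norm ((LBINT \<xi>. En (u n) \<xi> \<bullet> En z \<xi>) - (LBINT \<xi>. En v \<xi> \<bullet> En z \<xi>)) < e" if "n \<ge> N" for n
      using N[OF that] nr[OF h S(2), of n] nr[OF hv S(3)] unfolding real_norm_def by linarith
    then show "\<exists>no. \<forall>n\<ge>no. norm ((LBINT \<xi>. En (u n) \<xi> \<bullet> En z \<xi>) - (LBINT \<xi>. En v \<xi> \<bullet> En z \<xi>)) < e" by blast
  qed
  then show "(\<lambda>n. Bf (u n) z) \<longlonglongrightarrow> Bf v z" unfolding Bf_def by (intro tendsto_intros) auto
qed

end

section \<open>Test functions\<close>

lemma test_fun_support:
  assumes "test_fun \<phi>"
  obtains R \<phi>' where "R > 0" "\<And>x. (\<phi> has_real_derivative \<phi>' x) (at x)" "continuous_on UNIV \<phi>'"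
    "\<And>x. \<bar>x\<bar> > R \<Longrightarrow> \<phi> x = 0" "\<And>x. \<bar>x\<bar> > R \<Longrightarrow> \<phi>' x = 0" "deriv \<phi> = \<phi>'"
proof -
  obtain d where d0: "d 0 = \<phi>" and d: "\<And>k x. (d k has_real_derivative d (Suc k) x) (at x)" and bd: "bounded {x. \<phi> x \<noteq> 0}"
    using assms unfolding test_fun_def by blast
  obtain R where R: "R > 0" "\<And>x. \<phi> x \<noteq> 0 \<Longrightarrow> \<bar>x\<bar> \<le> R" using bd unfolding bounded_pos by auto
  have D: "(\<phi> has_real_derivative d 1 x) (at x)" for x using d[of 0 x] d0 by simp
  have z: "\<phi> x = 0" if "\<bar>x\<bar> > R" for x using R(2)[of x] that by force
  have "d 1 x = 0" if x: "\<bar>x\<bar> > R" for x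
  proof -
    have op: "open {y::real. \<bar>y\<bar> > R}" by (intro open_Collect_less continuous_intros)
    have "(\<phi> has_real_derivative 0) (at x)"
    proof (rule has_field_derivative_transform_within_open[OF _ op])
      show "((\<lambda>x. 0) has_real_derivative 0) (at x)" by simp
    qed (use x z in auto)
    then show ?thesis using D DERIV_unique by blast
  qed
  moreover have "continuous_on UNIV (d 1)"
    using d[of 1] by (meson DERIV_continuous_on has_field_derivative_at_within)
  moreover have "deriv \<phi> = d 1" using D DERIV_imp_deriv by blast
  ultimately show ?thesis using that[of R "d 1"] R(1) D z by blast
qed

lemma compact_support_BL1:
  assumes g: "continuous_on UNIV g" and s: "\<And>x. \<bar>x\<bar> > R \<Longrightarrow> g x = 0"
  shows "BL1 (cr g)" "\<exists>B. \<forall>x. \<bar>g x\<bar> \<le> B"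
proof -
  have "compact (g ` {-R..R})" using g by (intro compact_continuous_image) (auto intro: continuous_on_subset)
  then obtain B where "B > 0" and B: "\<And>x. x \<in> {-R..R} \<Longrightarrow> \<bar>g x\<bar> \<le> B" using compact_imp_bounded bounded_pos by (metis (no_types, lifting) image_eqI real_norm_def)
  have Bb: "\<bar>g x\<bar> \<le> B" for x using B[of x] s[of x] \<open>B > 0\<close> by (cases "x \<in> {-R..R}") auto
  then show "\<exists>B. \<forall>x. \<bar>g x\<bar> \<le> B" by blast
  have [measurable]: "g \<in> borel_measurable borel" using g by (rule borel_measurable_continuous_onI)
  have "integrable lborel g"
  proof (rule integrableI_bounded_set[where A="{-R..R}" and B=B])
    have "\<bar>x\<bar> > R" if "x \<notin> {-R..R}" for x using that by auto
    then show "AE x in lborel. x \<notin> {-R..R} \<longrightarrow> g x = 0" using s by auto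
  qed (use Bb in \<open>auto simp: emeasure_lborel_Icc_eq\<close>)
  then show "BL1 (cr g)" unfolding BL1_def using Bb by (auto intro!: exI[of _ B] integrable_of_real)
qed

text \<open>Integration by parts, written as the fundamental theorem for the product of
  \<open>\<phi>\<close> with the exponential.\<close>

lemma ft_deriv:
  assumes D: "\<And>x. (\<phi> has_real_derivative \<phi>' x) (at x)" and c: "continuous_on UNIV \<phi>'"
    and z: "\<And>x. \<bar>x\<bar> > R \<Longrightarrow> \<phi> x = 0" "\<And>x. \<bar>x\<bar> > R \<Longrightarrow> \<phi>' x = 0" and R: "R > 0"
  shows "ft (cr \<phi>') \<xi> = \<i> * complex_of_real \<xi> * ft (cr \<phi>) \<xi>"
proof -
  have c0: "continuous_on UNIV \<phi>" using D by (meson DERIV_continuous_on has_field_derivative_at_within)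
  have i: "integrable lborel (cr \<phi>)" "integrable lborel (cr \<phi>')"
    using compact_support_BL1(1)[OF c0, of R] compact_support_BL1(1)[OF c, of R] z BL1_integrable by blast+
  let ?e = "\<lambda>x. exp (- \<i> * complex_of_real (\<xi> * x))"
  let ?G = "\<lambda>x. ?e x * cr \<phi> x"
  let ?g = "\<lambda>x. ?e x * cr \<phi>' x - \<i> * complex_of_real \<xi> * (?e x * cr \<phi> x)"
  have G: "(?G has_vector_derivative ?g x) (at x within S)" for x S
  proof -
    have 1: "(cr \<phi> has_vector_derivative cr \<phi>' x) (at x within S)"
      using D[of x] by (intro has_vector_derivative_of_real has_vector_derivative_at_within) (simp add: has_real_derivative_iff_has_vector_derivative)
    have 2: "(?e has_vector_derivative (- \<i> * complex_of_real \<xi>) * ?e x) (at x within S)"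
    proof -
      have "((\<lambda>z. exp (- \<i> * (complex_of_real \<xi> * z))) has_field_derivative (- \<i> * complex_of_real \<xi>) * exp (- \<i> * (complex_of_real \<xi> * complex_of_real x))) (at (complex_of_real x))"
        by (auto intro!: derivative_eq_intros)
      from has_vector_derivative_real_field[OF this] show ?thesis by simp
    qed
    show ?thesis using has_vector_derivative_mult[OF 2 1] by (simp add: algebra_simps)
  qed
  have cg: "continuous_on {-(R+1)..R+1} ?g"
    by (intro continuous_intros continuous_on_subset[OF c] continuous_on_subset[OF c0]) auto
  \<comment> \<open>The boundary terms must vanish, but \<open>\<phi>\<close> is known to be 0 only
    for |x| > R; hence the interval is enlarged by 1.\<close>
  have "(LBINT x. indicator {-(R+1)..R+1} x *\<^sub>R ?g x) = ?G (R+1) - ?G (-(R+1))"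
    by (rule integral_FTC_atLeastAtMost[OF _ G cg]) (use R in simp)
  also have "\<dots> = 0" using z(1)[of "R+1"] z(1)[of "-(R+1)"] R by simp
  also have "(LBINT x. indicator {-(R+1)..R+1} x *\<^sub>R ?g x) = (LBINT x. ?g x)"
  proof (rule Bochner_Integration.integral_cong[OF refl])
    fix x show "indicator {-(R+1)..R+1} x *\<^sub>R ?g x = ?g x"
      using z[of x] by (cases "\<bar>x\<bar> > R") (auto simp: indicator_def)
  qed
  also have "\<dots> = ft (cr \<phi>') \<xi> - \<i> * complex_of_real \<xi> * ft (cr \<phi>) \<xi>"
    unfolding ft_def by (subst Bochner_Integration.integral_diff) (auto intro: ft_integrand[OF i(1), simplified] ft_integrand[OF i(2), simplified])
  finally show ?thesis by simp
qed

context bo_weight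
begin

text \<open>Membership follows from sqrt |\<xi>| <= 1 + |\<xi>|, as \<open>\<phi>\<close> and its
  derivative are in L^2. For the form, pairing the symbol -i sgn \<xi> of the Hilbert transform with
  the symbol i \<xi> of the derivative produces -|\<xi>|, so Parseval turns the energy pairing into
  the distributional expression of \<open>BO_solution\<close>.\<close>

lemma test_fun_H12:
  assumes t: "test_fun \<phi>"
  shows "H12 \<phi>"
    "\<And>u. H12 u \<Longrightarrow> Bf u \<phi> = - c * (LBINT x. u x * \<phi> x) - b * (LBINT x. hilbert u x * deriv \<phi> x)"
proof -
  obtain R \<phi>' where R: "R > 0" and D: "\<And>x. (\<phi> has_real_derivative \<phi>' x) (at x)" and c': "continuous_on UNIV \<phi>'"
    and z: "\<And>x. \<bar>x\<bar> > R \<Longrightarrow> \<phi> x = 0" "\<And>x. \<bar>x\<bar> > R \<Longrightarrow> \<phi>' x = 0" and dv: "deriv \<phi> = \<phi>'"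
    using test_fun_support[OF t] by blast
  have c0: "continuous_on UNIV \<phi>" using D by (meson DERIV_continuous_on has_field_derivative_at_within)
  have bl: "BL1 (cr \<phi>)" "BL1 (cr \<phi>')"
    using compact_support_BL1(1)[OF c0, of R] compact_support_BL1(1)[OF c', of R] z by blast+
  have s: "sqint \<phi>" "sqint \<phi>'" using BL1_sqint[OF bl(1)] BL1_sqint[OF bl(2)] unfolding sqint_of_real by auto
  have ae: "AE \<xi> in lborel. fourier \<phi> \<xi> = ft (cr \<phi>) \<xi>" by (rule fourier_eqI[OF Fr_BL1[OF bl(1)]])
  have F': "Fr (cr \<phi>') (\<lambda>\<xi>. \<i> * complex_of_real \<xi> * ft (cr \<phi>) \<xi>)"
  proof -
    have "ft (cr \<phi>') = (\<lambda>\<xi>. \<i> * complex_of_real \<xi> * ft (cr \<phi>) \<xi>)"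
      by (rule ext, rule ft_deriv[OF D c' _ _ R]) (use z in auto)
    then show ?thesis using Fr_BL1[OF bl(2)] by simp
  qed
  note fourier_meas[OF s(1), measurable]
  have "sqint (\<lambda>\<xi>. complex_of_real (sqrt \<bar>\<xi>\<bar>) * fourier \<phi> \<xi>)"
  proof (rule sqint_bound)
    have n: "sqint (\<lambda>\<xi>. norm (g \<xi>))" if "sqint g" for g :: "real \<Rightarrow> complex"
      using that by (auto simp: sqint_def)
    show "sqint (\<lambda>\<xi>. norm (fourier \<phi> \<xi>) + norm (\<i> * complex_of_real \<xi> * ft (cr \<phi>) \<xi>))"
      by (intro sqint_add n fourier_sqint s Fr_sqint(2)[OF F'])
    show "AE \<xi> in lborel. norm (complex_of_real (sqrt \<bar>\<xi>\<bar>) * fourier \<phi> \<xi>) \<le> norm (norm (fourier \<phi> \<xi>) + norm (\<i> * complex_of_real \<xi> * ft (cr \<phi>) \<xi>))"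
      using ae
    proof eventually_elim
      fix \<xi> assume e: "fourier \<phi> \<xi> = ft (cr \<phi>) \<xi>"
      have "sqrt \<bar>\<xi>\<bar> \<le> 1 + \<bar>\<xi>\<bar>" by (rule real_le_lsqrt) (auto simp: power2_eq_square algebra_simps)
      from mult_right_mono[OF this, of "norm (ft (cr \<phi>) \<xi>)"]
      show "norm (complex_of_real (sqrt \<bar>\<xi>\<bar>) * fourier \<phi> \<xi>) \<le> norm (norm (fourier \<phi> \<xi>) + norm (\<i> * complex_of_real \<xi> * ft (cr \<phi>) \<xi>))"
        unfolding e by (simp add: norm_mult algebra_simps)
    qed
  qed measurable
  then show h\<phi>: "H12 \<phi>" unfolding H12_iff using s by simp
  fix u assume h: "H12 u"
  have u: "sqint u" using H12_sqint[OF h] .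
  let ?m = "\<lambda>\<xi>. - \<i> * complex_of_real (sgn \<xi>)"
  have "cnj (?m (- \<xi>)) = ?m \<xi>" for \<xi> by (simp add: sgn_minus)
  moreover have "sqint (\<lambda>\<xi>. ?m \<xi> * fourier u \<xi>)"
    by (rule sqint_bounded_mult[OF fourier_sqint[OF u], of _ 1]) (measurable, simp add: norm_mult sgn_if)
  ultimately obtain w where "Fr (cr w) (\<lambda>\<xi>. ?m \<xi> * fourier u \<xi>)" using multiplier_real[OF u, of ?m] by blast
  then have FH: "Fr (cr (hilbert u)) (\<lambda>\<xi>. ?m \<xi> * fourier u \<xi>)"
    unfolding hilbert_def is_fourier_iff_Fr by (rule someI[of "\<lambda>w. Fr (cr w) (\<lambda>\<xi>. ?m \<xi> * fourier u \<xi>)"])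
  have 1: "(LBINT \<xi>. (?m \<xi> * fourier u \<xi>) \<bullet> (\<i> * complex_of_real \<xi> * ft (cr \<phi>) \<xi>)) = 2 * pi * (LBINT x. hilbert u x * \<phi>' x)"
    by (rule Parseval[OF FH F'])
  have 2: "(LBINT \<xi>. fourier u \<xi> \<bullet> ft (cr \<phi>) \<xi>) = 2 * pi * (LBINT x. u x * \<phi> x)"
    by (rule Parseval[OF Fr_fourier[OF u] Fr_BL1[OF bl(1)]])
  have "(LBINT \<xi>. En u \<xi> \<bullet> En \<phi> \<xi>)
     = (LBINT \<xi>. - b * ((?m \<xi> * fourier u \<xi>) \<bullet> (\<i> * complex_of_real \<xi> * ft (cr \<phi>) \<xi>)) - c * (fourier u \<xi> \<bullet> ft (cr \<phi>) \<xi>))"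
  proof (rule integral_cong_AE)
    show "AE \<xi> in lborel. En u \<xi> \<bullet> En \<phi> \<xi> = - b * ((?m \<xi> * fourier u \<xi>) \<bullet> (\<i> * complex_of_real \<xi> * ft (cr \<phi>) \<xi>)) - c * (fourier u \<xi> \<bullet> ft (cr \<phi>) \<xi>)"
      using ae
    proof eventually_elim
      fix \<xi> assume e: "fourier \<phi> \<xi> = ft (cr \<phi>) \<xi>"
      have i: "(?m \<xi> * a) \<bullet> (\<i> * complex_of_real \<xi> * y) = - \<bar>\<xi>\<bar> * (a \<bullet> y)" for a y
        by (simp add: inner_complex_def sgn_if algebra_simps)
      show "En u \<xi> \<bullet> En \<phi> \<xi> = - b * ((?m \<xi> * fourier u \<xi>) \<bullet> (\<i> * complex_of_real \<xi> * ft (cr \<phi>) \<xi>)) - c * (fourier u \<xi> \<bullet> ft (cr \<phi>) \<xi>)"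
        unfolding En_def inner_of_real_mult i e power2_eq_square[symmetric] wt_sq by (simp add: algebra_simps)
    qed
  qed (use En_meas[OF u] En_meas[OF s(1)] fourier_meas[OF u] sqint_meas[OF Fr_sqint(2)[OF Fr_BL1[OF bl(1)]]] in measurable)
  also have "\<dots> = - b * (2 * pi * (LBINT x. hilbert u x * \<phi>' x)) - c * (2 * pi * (LBINT x. u x * \<phi> x))"
    unfolding 1[symmetric] 2[symmetric]
    using integrable_inner[OF Fr_sqint(2)[OF FH] Fr_sqint(2)[OF F']]
      integrable_inner[OF fourier_sqint[OF u] Fr_sqint(2)[OF Fr_BL1[OF bl(1)]]] by simp
  finally show "Bf u \<phi> = - c * (LBINT x. u x * \<phi> x) - b * (LBINT x. hilbert u x * deriv \<phi> x)"
    unfolding Bf_def dv by (simp add: field_simps)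
qed

end

section \<open>The limiting variational problem\<close>

lemma L2_AE_subseq:
  fixes u :: "nat \<Rightarrow> real \<Rightarrow> 'a::euclidean_space"
  assumes u: "\<And>n. sqint (u n)" and v: "sqint v" and lim: "(\<lambda>n. nrm (\<lambda>x. u n x - v x)) \<longlonglongrightarrow> 0"
  obtains r where "strict_mono r" "AE x in lborel. (\<lambda>n. u (r n) x) \<longlonglongrightarrow> v x"
proof -
  obtain r w where r: "strict_mono r" "sqint w" "AE x in lborel. (\<lambda>n. u (r n) x) \<longlonglongrightarrow> w x"
    and w: "(\<lambda>n. nrm (\<lambda>x. u n x - w x)) \<longlonglongrightarrow> 0"
    using L2_complete[OF u L2_limit_Cauchy[OF u v lim]] by blast
  have "nrm (\<lambda>x. v x - w x) \<le> nrm (\<lambda>x. u n x - v x) + nrm (\<lambda>x. u n x - w x)" for n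
    using nrm_triangle_diff[OF v u[of n] r(2)] nrm_minus_commute[of v "u n"] by simp
  then have "nrm (\<lambda>x. v x - w x) \<le> 0 + 0"
    by (intro tendsto_lowerbound[OF tendsto_add[OF lim w]]) auto
  then have "nrm (\<lambda>x. v x - w x) = 0" using nrm_nonneg[of "\<lambda>x. v x - w x"] by linarith
  then have "AE x in lborel. w x = v x" using sqint_diff[OF v r(2)] by (subst (asm) nrm_eq_0_iff) auto
  with r(3) have "AE x in lborel. (\<lambda>n. u (r n) x) \<longlonglongrightarrow> v x" by eventually_elim simp
  then show ?thesis using that r(1) by blast
qed

lemma convergent_real_bounded:
  fixes X :: "nat \<Rightarrow> real"
  assumes "X \<longlonglongrightarrow> L" obtains B where "\<And>n. X n \<le> B"
proof -
  obtain B where "\<forall>n. norm (X n) \<le> B" using convergent_imp_Bseq[OF convergentI[OF assms]] by (auto elim: BseqE)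
  then have "X n \<le> B" for n using abs_ge_self[of "X n"] by (force intro: order_trans)
  then show ?thesis using that by blast
qed

section \<open>The functional K and its relation to Q\<close>

locale bo_problem = bo_weight b c + homogeneous_nonlinearity p f F
  for b c p :: real and f F :: "real \<Rightarrow> real"
begin

definition K :: "(real \<Rightarrow> real) \<Rightarrow> real" where "K u = - q * (LBINT x. F (u x))"

lemma Kfun_eq: "Kfun p F = K"
  by (rule ext) (simp add: Kfun_def K_def q_def)

lemma K_translate: "K (\<lambda>x. u (x + h)) = K u"
  unfolding K_def using integral_translate[of "\<lambda>x. F (u x)" h] by simp

lemma K_le_integral:
  assumes t: "tbound M D u" shows "\<bar>K u\<bar> \<le> q * (CF + 1) * (LBINT x. \<bar>u x\<bar> powr q)"
proof -
  have iu: "integrable lborel (\<lambda>x. \<bar>u x\<bar> powr q)"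
    using sobolev_embedding[OF q tbound_nonneg[OF t]] t by metis
  have "\<bar>LBINT x. F (u x)\<bar> \<le> (LBINT x. \<bar>F (u x)\<bar>)" by (rule integral_abs_bound)
  also have "\<dots> \<le> (LBINT x. (CF + 1) * \<bar>u x\<bar> powr q)"
  proof (rule integral_mono)
    show "\<bar>F (u x)\<bar> \<le> (CF + 1) * \<bar>u x\<bar> powr q" for x using F_bound[of "u x"] by (simp add: distrib_right add_increasing2)
  qed (use iu F_integrable[OF t] in auto)
  finally have "\<bar>LBINT x. F (u x)\<bar> \<le> (CF + 1) * (LBINT x. \<bar>u x\<bar> powr q)" by simp
  then have "q * \<bar>LBINT x. F (u x)\<bar> \<le> q * ((CF + 1) * (LBINT x. \<bar>u x\<bar> powr q))"
    using q by (intro mult_left_mono) auto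
  then show ?thesis using q by (simp add: K_def abs_mult mult.assoc)
qed

lemma H12_scale: assumes "H12 u" shows "H12 (\<lambda>x. s * u x)" "Q (\<lambda>x. s * u x) = s\<^sup>2 * Q u"
  using H12_lin(1)[OF assms assms, of s 0] Q_lin[OF assms assms, of s 0] by auto

lemma K_scale: "s > 0 \<Longrightarrow> K (\<lambda>x. s * u x) = s powr q * K u"
  by (simp add: K_def F_hom)

lemma Q_0_imp: assumes "H12 u" "Q u = 0" shows "AE x in lborel. u x = 0"
proof -
  have "- c * (nrm u)\<^sup>2 \<le> 0" using nrm_le_Q[OF assms(1)] assms(2) by simp
  then have "- c * (nrm u)\<^sup>2 \<le> - c * 0" by simp
  then have "(nrm u)\<^sup>2 \<le> 0" by (rule mult_left_le_imp_le) (use c in simp)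
  then show ?thesis using nrm_eq_0_iff[OF H12_sqint[OF assms(1)]] by simp
qed

lemma K_AE_0: assumes "u \<in> borel_measurable borel" "AE x in lborel. u x = 0" shows "K u = 0"
proof -
  have "(LBINT x. F (u x)) = (\<integral>x. 0 \<partial>(lborel :: real measure))"
    by (rule integral_cong_AE) (use assms F0 in auto)
  then show ?thesis by (simp add: K_def)
qed

text \<open>The embedding gives a bound on the set Q <= 1; rescaling to Q = 1 extends it, since K
  has degree q and Q has degree 2. The added 1 makes the constant strictly positive.\<close>

lemma K_bound:
  obtains C where "C > 0" "\<And>u. H12 u \<Longrightarrow> \<bar>K u\<bar> \<le> C * Q u powr (q / 2)"
proof -
  let ?M = "sqrt (1 / (- c))" and ?D = "sqrt (2 * 1 / b)"
  have MD: "?M \<ge> 0" "?D \<ge> 0" using b c by auto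
  obtain C where C: "C \<ge> 0" "\<And>u. tbound ?M ?D u \<Longrightarrow> (LBINT x. \<bar>u x\<bar> powr q) \<le> C"
    using sobolev_embedding[OF q MD] by metis
  let ?C = "q * (CF + 1) * C + 1"
  have k: "q * (CF + 1) \<ge> 0" using q CF_nonneg by simp
  have C0: "?C > 0" using k C by (simp add: add_nonneg_pos)
  have "\<bar>K u\<bar> \<le> ?C * Q u powr (q / 2)" if h: "H12 u" for u
  proof (cases "Q u = 0")
    case True
    then show ?thesis using K_AE_0[OF sqint_meas[OF H12_sqint[OF h]] Q_0_imp[OF h True]] by simp
  next
    case False
    then have Qp: "Q u > 0" using Q_nonneg[of u] by simp
    define s where "s = 1 / sqrt (Q u)"
    have s: "s > 0" using Qp by (simp add: s_def)
    have hs: "H12 (\<lambda>x. s * u x)" and Qs: "Q (\<lambda>x. s * u x) \<le> 1"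
      using H12_scale[OF h, of s] Qp by (auto simp: s_def power_divide)
    note t = H12_tbound[OF hs Qs]
    have "\<bar>K (\<lambda>x. s * u x)\<bar> \<le> q * (CF + 1) * (LBINT x. \<bar>s * u x\<bar> powr q)" by (rule K_le_integral[OF t])
    also have "\<dots> \<le> q * (CF + 1) * C" by (rule mult_left_mono[OF C(2)[OF t] k])
    finally have "s powr q * \<bar>K u\<bar> \<le> ?C" unfolding K_scale[OF s] by (simp add: abs_mult)
    moreover have "s powr q = 1 / Q u powr (q / 2)"
      using Qp by (simp add: s_def powr_divide powr_half_sqrt[symmetric] powr_powr)
    ultimately show ?thesis using Qp by (simp add: field_simps)
  qed
  then show ?thesis using that C0 by blast
qed

text \<open>Bounded energy is all that is asked of the sequence: the part of K lost in the limit is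
  carried by the differences, whether or not these tend to 0.\<close>

lemma K_splitting:
  assumes h: "\<And>n. H12 (u n)" and B: "\<And>n. Q (u n) \<le> B" and v: "H12 v"
    and lim: "AE x in lborel. (\<lambda>n. u n x) \<longlonglongrightarrow> v x"
  shows "(\<lambda>n. K (u n) - K (\<lambda>x. u n x - v x)) \<longlonglongrightarrow> K v"
proof -
  have "(\<lambda>n. - q * ((LBINT x. F (u n x)) - (LBINT x. F (u n x - v x)))) \<longlonglongrightarrow> - q * (LBINT x. F (v x))"
    by (intro tendsto_intros Brezis_Lieb[OF H12_tbound[OF h B] H12_tbound[OF v order_refl] lim])
  then show ?thesis by (simp add: K_def algebra_simps)
qed

lemma Q_tendsto:
  assumes h: "\<And>n. H12 (u n)" "H12 v" and lim: "(\<lambda>n. Q (\<lambda>x. u n x - v x)) \<longlonglongrightarrow> 0"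
  shows "(\<lambda>n. Q (u n)) \<longlonglongrightarrow> Q v"
proof (rule LIM_zero_cancel, rule Lim_null_comparison)
  show "\<forall>\<^sub>F n in sequentially. norm (Q (u n) - Q v) \<le> 2 * (sqrt (Q (\<lambda>x. u n x - v x)) * sqrt (Q v)) + Q (\<lambda>x. u n x - v x)"
  proof (rule always_eventually, rule allI)
    fix n
    note d = H12_diff(1)[OF h(1)[of n] h(2)]
    have "Q (u n) = Q (\<lambda>x. 1 * (u n x - v x) + 1 * v x)" by simp
    also have "\<dots> = Q (\<lambda>x. u n x - v x) + 2 * Bf (\<lambda>x. u n x - v x) v + Q v"
      using Q_lin[OF d h(2), of 1 1] by simp
    finally show "norm (Q (u n) - Q v) \<le> 2 * (sqrt (Q (\<lambda>x. u n x - v x)) * sqrt (Q v)) + Q (\<lambda>x. u n x - v x)"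
      using Bf_bound[OF d h(2)] Q_nonneg[of "\<lambda>x. u n x - v x"] by simp
  qed
  have "(\<lambda>n. 2 * (sqrt (Q (\<lambda>x. u n x - v x)) * sqrt (Q v)) + Q (\<lambda>x. u n x - v x)) \<longlonglongrightarrow> 2 * (sqrt 0 * sqrt (Q v)) + 0"
    by (intro tendsto_intros lim)
  then show "(\<lambda>n. 2 * (sqrt (Q (\<lambda>x. u n x - v x)) * sqrt (Q v)) + Q (\<lambda>x. u n x - v x)) \<longlonglongrightarrow> 0" by simp
qed

lemma Bf_self: "Bf u u = Q u"
  unfolding Bf_def Q_def by (simp add: nrm_sq power2_norm_eq_inner)

end

text \<open>An infimum over the empty set carries no information, so existence of a competitor is
  assumed here; the case without one is treated separately at the end.\<close>

locale bo_minimization = bo_problem +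
  assumes admissible: "\<exists>u\<in>Xsp. K u > 0"
begin

text \<open>The competitors are the same as for \<open>mval\<close>, which makes the two infima
  directly comparable; validity on all of H^{1/2} is recovered in \<open>K_le\<close>.\<close>

definition m0 :: real where "m0 = Inf {Q u / K u powr (2 / q) | u. u \<in> Xsp \<and> K u > 0}"

lemma Xsp_H12: "u \<in> Xsp \<Longrightarrow> H12 u" by (simp add: Xsp_def)

lemma m0_le: assumes "u \<in> Xsp" "K u > 0" shows "m0 \<le> Q u / K u powr (2 / q)"
  unfolding m0_def
proof (rule cInf_lower)
  show "bdd_below {Q u / K u powr (2 / q) | u. u \<in> Xsp \<and> K u > 0}"
    using Q_nonneg by (auto intro!: bdd_belowI[of _ 0] divide_nonneg_nonneg)
qed (use assms in blast)

lemma m0_pos: "m0 > 0"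
proof -
  obtain C where C: "C > 0" "\<And>u. H12 u \<Longrightarrow> \<bar>K u\<bar> \<le> C * Q u powr (q / 2)" using K_bound by blast
  have "1 / C powr (2 / q) \<le> m0"
    unfolding m0_def
  proof (rule cInf_greatest)
    show "{Q u / K u powr (2 / q) | u. u \<in> Xsp \<and> K u > 0} \<noteq> {}" using admissible by auto
    fix x assume "x \<in> {Q u / K u powr (2 / q) | u. u \<in> Xsp \<and> K u > 0}"
    then obtain u where u: "x = Q u / K u powr (2 / q)" "u \<in> Xsp" "K u > 0" by auto
    have "K u powr (2 / q) \<le> (C * Q u powr (q / 2)) powr (2 / q)"
      using C(2)[OF Xsp_H12[OF u(2)]] u(3) q by (intro powr_mono2) auto
    also have "\<dots> = C powr (2 / q) * Q u"
      using C(1) q Q_nonneg[of u] by (simp add: powr_mult powr_powr)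
    finally have le: "K u powr (2 / q) \<le> C powr (2 / q) * Q u" .
    have pos: "K u powr (2 / q) > 0" "C powr (2 / q) > 0" using u(3) C(1) by auto
    have "y / z \<le> w / k" if "y * k \<le> z * w" "k > 0" "z > 0" for y z w k :: real
      using that by (simp add: pos_le_divide_eq pos_divide_le_eq mult.commute)
    from this[of 1 "K u powr (2 / q)"] show "1 / C powr (2 / q) \<le> x" unfolding u(1) using le pos by simp
  qed
  moreover have "0 < 1 / C powr (2 / q)" using C(1) by simp
  ultimately show ?thesis by (rule order_less_le_trans[rotated])
qed

text \<open>The common value of Q and K at a normalized minimizer: Q = K = x turns the quotient into
  x^{(q-2)/q}, which equals m0 exactly for this x.\<close>

definition \<L> :: real where "\<L> = m0 powr (q / (q - 2))"

lemma \<L>_pos: "\<L> > 0" using m0_pos by (simp add: \<L>_def)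

lemma \<L>_scaling: "x \<ge> 0 \<Longrightarrow> (x / m0) powr (q / 2) = \<L> * (x / \<L>) powr (q / 2)"
proof -
  assume x: "x \<ge> 0"
  have e: "q / (q - 2) * (q / 2) = q / (q - 2) + q / 2" using q by (simp add: field_simps)
  have "\<L> powr (q / 2) = m0 powr (q / (q - 2)) * m0 powr (q / 2)"
    unfolding \<L>_def powr_powr e by (rule powr_add)
  then have L: "\<L> powr (q / 2) = \<L> * m0 powr (q / 2)" unfolding \<L>_def .
  have "(x / m0) powr (q / 2) = x powr (q / 2) / m0 powr (q / 2)"
    by (rule powr_divide)
  moreover have "(x / \<L>) powr (q / 2) = x powr (q / 2) / (\<L> * m0 powr (q / 2))"
    unfolding L[symmetric] by (rule powr_divide)
  ultimately show ?thesis using \<L>_pos by simp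
qed

text \<open>The definition of m0 as an inequality for K, normalized so that equality holds when Q
  and K both equal \<open>\<L>\<close>.\<close>

lemma K_le_Xsp: assumes "u \<in> Xsp" shows "K u \<le> \<L> * (Q u / \<L>) powr (q / 2)"
proof (cases "K u > 0")
  case True
  have pos: "0 < K u powr (2 / q)" using True by simp
  have "m0 * K u powr (2 / q) \<le> Q u" using m0_le[OF assms True] unfolding pos_le_divide_eq[OF pos] .
  then have le: "K u powr (2 / q) \<le> Q u / m0" unfolding pos_le_divide_eq[OF m0_pos] by (simp only: mult.commute)
  have "2 / q * (q / 2) = 1" using q by simp
  then have "K u = (K u powr (2 / q)) powr (q / 2)" using True by (simp only: powr_powr powr_one less_imp_le)
  also have "\<dots> \<le> (Q u / m0) powr (q / 2)" by (rule powr_mono2[OF _ _ le]) (use q in auto)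
  also have "\<dots> = \<L> * (Q u / \<L>) powr (q / 2)" by (rule \<L>_scaling[OF Q_nonneg])
  finally show ?thesis .
next
  case False
  then have "K u \<le> 0" by simp
  also have "0 \<le> \<L> * (Q u / \<L>) powr (q / 2)" using \<L>_pos by simp
  finally show ?thesis .
qed

text \<open>Approximants from \<open>Xsp\<close> converge in energy, hence almost everywhere along a
  subsequence. Continuity of K along it comes from \<open>K_splitting\<close>, as K of the
  differences is killed by \<open>K_bound\<close>.\<close>

lemma K_le: assumes h: "H12 u" shows "K u \<le> \<L> * (Q u / \<L>) powr (q / 2)"
proof -
  obtain w where w: "\<And>j. w j \<in> Xsp" and lim: "(\<lambda>j. Q (\<lambda>x. w j x - u x)) \<longlonglongrightarrow> 0" using Xsp_dense[OF h] by blast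
  have hw: "\<And>j. H12 (w j)" using w Xsp_H12 by blast
  have d: "\<And>j. H12 (\<lambda>x. w j x - u x)" using H12_diff(1)[OF hw h] .
  have "(\<lambda>j. nrm (\<lambda>x. w j x - u x)) \<longlonglongrightarrow> 0"
  proof (rule Lim_null_comparison)
    show "\<forall>\<^sub>F j in sequentially. norm (nrm (\<lambda>x. w j x - u x)) \<le> sqrt (Q (\<lambda>x. w j x - u x) / (- c))"
      using H12_tbound[OF d order_refl] unfolding tbound_def by auto
    have "(\<lambda>j. sqrt (Q (\<lambda>x. w j x - u x) / (- c))) \<longlonglongrightarrow> sqrt (0 / (- c))"
      using c by (intro tendsto_intros lim) auto
    then show "(\<lambda>j. sqrt (Q (\<lambda>x. w j x - u x) / (- c))) \<longlonglongrightarrow> 0" by simp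
  qed
  from L2_AE_subseq[OF H12_sqint[OF hw] H12_sqint[OF h] this]
  obtain r where r: "strict_mono r" "AE x in lborel. (\<lambda>n. w (r n) x) \<longlonglongrightarrow> u x" by blast
  have limr: "(\<lambda>n. Q (\<lambda>x. w (r n) x - u x)) \<longlonglongrightarrow> 0" using LIMSEQ_subseq_LIMSEQ[OF lim r(1)] by (simp add: comp_def)
  have Qr: "(\<lambda>n. Q (w (r n))) \<longlonglongrightarrow> Q u" by (rule Q_tendsto[OF hw h limr])
  obtain B where B: "\<And>n. Q (w (r n)) \<le> B" using convergent_real_bounded[OF Qr] by blast
  have Kd: "(\<lambda>n. K (w (r n)) - K (\<lambda>x. w (r n) x - u x)) \<longlonglongrightarrow> K u" by (rule K_splitting[OF hw B h r(2)])
  have pw: "(\<lambda>n. \<L> * (Y n / \<L>) powr (q / 2)) \<longlonglongrightarrow> \<L> * (y / \<L>) powr (q / 2)"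
    if "Y \<longlonglongrightarrow> y" "\<And>n. Y n \<ge> 0" for Y y
    by (intro tendsto_intros tendsto_powr' that(1)) (use \<L>_pos q that(2) in auto)
  have le: "K (w (r n)) - K (\<lambda>x. w (r n) x - u x) \<le> \<L> * (Q (w (r n)) / \<L>) powr (q / 2) + \<bar>K (\<lambda>x. w (r n) x - u x)\<bar>" for n
    using K_le_Xsp[OF w, of "r n"] by linarith
  obtain C where C: "C > 0" "\<And>u. H12 u \<Longrightarrow> \<bar>K u\<bar> \<le> C * Q u powr (q / 2)" using K_bound by blast
  have K0: "(\<lambda>n. K (\<lambda>x. w (r n) x - u x)) \<longlonglongrightarrow> 0"
  proof (rule Lim_null_comparison)
    show "\<forall>\<^sub>F n in sequentially. norm (K (\<lambda>x. w (r n) x - u x)) \<le> C * Q (\<lambda>x. w (r n) x - u x) powr (q / 2)"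
      using C(2)[OF d] by simp
    have "(\<lambda>n. C * Q (\<lambda>x. w (r n) x - u x) powr (q / 2)) \<longlonglongrightarrow> C * 0 powr (q / 2)"
      by (intro tendsto_intros tendsto_powr' limr) (use q Q_nonneg in auto)
    then show "(\<lambda>n. C * Q (\<lambda>x. w (r n) x - u x) powr (q / 2)) \<longlonglongrightarrow> 0" by simp
  qed
  have "(\<lambda>n. \<L> * (Q (w (r n)) / \<L>) powr (q / 2) + \<bar>K (\<lambda>x. w (r n) x - u x)\<bar>) \<longlonglongrightarrow> \<L> * (Q u / \<L>) powr (q / 2) + \<bar>0\<bar>"
    by (intro tendsto_add pw Qr tendsto_rabs K0 Q_nonneg)
  then show ?thesis using LIMSEQ_le[OF Kd] le by auto
qed


text \<open>For 0 < x < 1 and s > 1 the power x^s is strictly below x, so two fractions adding up to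
  1 have powers adding up to less.\<close>

lemma powr_split_eq_1:
  fixes a s :: real
  assumes "0 < a" "a \<le> 1" "s > 1" "1 \<le> a powr s + (1 - a) powr s" shows "a = 1"
proof (rule ccontr)
  assume "a \<noteq> 1"
  then have a: "a < 1" using assms by simp
  have "a powr s < a powr 1" by (rule powr_less_mono') (use assms a in auto)
  also have "a powr 1 = a" using assms(1) by (intro powr_one) auto
  finally have 1: "a powr s < a" .
  have "(1 - a) powr s \<le> (1 - a) powr 1" by (rule powr_mono') (use assms a in auto)
  also have "(1 - a) powr 1 = 1 - a" using a by (intro powr_one) auto
  finally show False using 1 assms(4) by linarith
qed

text \<open>Vanishing is excluded because \<open>K\<close> stays away from zero, and dichotomy because splitting the mass
  into fractions \<open>a\<close> and \<open>1 - a\<close> would give \<open>1 \<le> a powr (q / 2) + (1 - a) powr (q / 2)\<close> with \<open>0 < a < 1\<close>.\<close>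
theorem minimizing_sequence_compact:
  assumes h: "\<And>n. H12 (u n)" and Kl: "(\<lambda>n. K (u n)) \<longlonglongrightarrow> \<L>" and QK: "\<And>n. Q (u n) \<le> K (u n)"
  obtains r y v where "strict_mono (r :: nat \<Rightarrow> nat)" "H12 v" "Q v = \<L>" "K v = \<L>"
    "(\<lambda>n. Q (\<lambda>x. u (r n) (x + y n) - v x)) \<longlonglongrightarrow> 0"
proof -
  obtain N where N: "\<And>n. n \<ge> N \<Longrightarrow> K (u n) > \<L> / 2"
    using order_tendstoD(1)[OF Kl, of "\<L> / 2"] \<L>_pos by (auto simp: eventually_sequentially)
  obtain B where B: "\<And>n. K (u n) \<le> B" using convergent_real_bounded[OF Kl] by blast
  have QB: "Q (u n) \<le> B" for n using QK B order_trans by blast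
  let ?M = "sqrt (B / (- c))" and ?D = "sqrt (2 * B / b)"
  have tb: "tbound ?M ?D (u n)" for n by (rule H12_tbound[OF h QB])
  have k: "q * (CF + 1) > 0" using q CF_nonneg by (simp add: add_nonneg_pos)
  \<comment> \<open>K above \<open>\<L>\<close> / 2 forces at least this much L^q mass, by
    \<open>K_le_integral\<close>.\<close>
  define e where "e = \<L> / 2 / (q * (CF + 1))"
  have e: "e > 0" using k \<L>_pos by (simp add: e_def)
  have ge: "e \<le> (LBINT x. \<bar>u n x\<bar> powr q)" if "n \<ge> N" for n
  proof -
    have "\<L> / 2 \<le> q * (CF + 1) * (LBINT x. \<bar>u n x\<bar> powr q)"
      using K_le_integral[OF tb, of n] N[OF that] by linarith
    then show ?thesis unfolding e_def pos_divide_le_eq[OF k] by (simp only: mult.commute)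
  qed
  obtain d \<eta> where d: "d > 0" and \<eta>: "\<eta> > 0"
    and nv: "\<And>u. tbound ?M ?D u \<Longrightarrow> (LBINT x. \<bar>u x\<bar> powr q) \<ge> e \<Longrightarrow> \<exists>y. \<bar>av d u y\<bar> \<ge> \<eta>"
    using nonvanishing[OF q tbound_nonneg[OF tb] e] by blast
  have "\<exists>y. \<bar>av d (u (n + N)) y\<bar> \<ge> \<eta>" for n by (rule nv[OF tb ge]) simp
  then obtain y where y: "\<And>n. \<bar>av d (u (n + N)) (y n)\<bar> \<ge> \<eta>" by metis
  \<comment> \<open>The translation brings the interval with a large average to [0, d]; the shift of
    the index skips the terms where K is still small.\<close>
  define z where "z n x = u (n + N) (x + y n)" for n x
  have hz: "H12 (z n)" and Qz: "Q (z n) = Q (u (n + N))" and Kz: "K (z n) = K (u (n + N))" for n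
    unfolding z_def using H12_translate[OF h] K_translate by auto
  have QzB: "Q (z n) \<le> B" for n using Qz QB by simp
  have tz: "tbound ?M ?D (z n)" for n by (rule H12_tbound[OF hz QzB])
  have avz: "av d (z n) 0 = av d (u (n + N)) (y n)" for n unfolding av_def z_def by (simp add: add.commute[of "y n"])
  obtain r v where r: "strict_mono r" and vm: "v \<in> borel_measurable borel" and lim: "AE x in lborel. (\<lambda>n. z (r n) x) \<longlonglongrightarrow> v x"
    by (rule local_compactness[OF tz])
  note weak = weak_limit_H12[where u="\<lambda>n. z (r n)", OF hz QzB vm lim]
  have hv: "H12 v" by (rule weak(1))
  have Bl: "(\<lambda>n. Bf (z (r n)) v) \<longlonglongrightarrow> Q v" using weak(2)[OF hv] unfolding Bf_self .
  have sv: "sqint v" by (rule H12_sqint[OF hv])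
  \<comment> \<open>The average over [0, d] is a pairing with an indicator, so it passes to the weak
    limit; staying at least \<open>\<eta>\<close> in size, it excludes a null limit.\<close>
  have Qv: "Q v > 0"
  proof (rule ccontr)
    assume "\<not> Q v > 0"
    then have "Q v = 0" using Q_nonneg[of v] by simp
    then have v0: "AE x in lborel. v x = 0" by (rule Q_0_imp[OF hv])
    have "(\<lambda>n. LBINT x. z (r n) x * indicator {0..d} x) \<longlonglongrightarrow> (LBINT x. v x * indicator {0..d} x)"
      by (rule weak_convergence_AE[OF _ _ lim sv sqint_indicator]) (use tz in \<open>auto simp: tbound_def\<close>)
    moreover have "(LBINT x. v x * indicator {0..d} x) = (\<integral>x. 0 \<partial>(lborel :: real measure))"
      by (rule integral_cong_AE) (use v0 vm in auto)
    ultimately have "(\<lambda>n. (LBINT x. z (r n) x * indicator {0..d} x) / d) \<longlonglongrightarrow> 0 / d" by (intro tendsto_intros) (use d in auto)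
    then have "(\<lambda>n. av d (z (r n)) 0) \<longlonglongrightarrow> 0" by (simp add: av_def mult.commute)
    then have "\<eta> \<le> \<bar>0\<bar>" by (intro LIMSEQ_le_const[OF tendsto_rabs]) (use y avz in auto)
    then show False using \<eta> by simp
  qed
  have r': "strict_mono (\<lambda>n. r n + N)" using r by (simp add: strict_mono_def)
  have Klim: "(\<lambda>n. K (z (r n))) \<longlonglongrightarrow> \<L>"
    unfolding Kz using LIMSEQ_subseq_LIMSEQ[OF Kl r'] by (simp add: comp_def)
  define w where "w n x = z (r n) x - v x" for n x
  have hw: "H12 (w n)" and Qw: "Q (w n) = Q (z (r n)) - 2 * Bf (z (r n)) v + Q v" for n
    unfolding w_def using H12_diff(1,2)[OF hz hv] by auto
  \<comment> \<open>Convergence of Q along the sequence is not known yet. The hypothesis Q <= K lets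
    K, whose limit is \<open>\<L>\<close>, take its place as an upper bound.\<close>
  define s where "s n = K (z (r n)) - 2 * Bf (z (r n)) v + Q v" for n
  have ws: "Q (w n) \<le> s n" for n
    unfolding Qw s_def using QK[of "r n + N"] Qz[of "r n"] Kz[of "r n"] by simp
  have s0: "s n \<ge> 0" for n using order_trans[OF Q_nonneg ws] .
  have "s \<longlonglongrightarrow> \<L> - 2 * Q v + Q v" unfolding s_def by (intro tendsto_intros Klim Bl)
  then have sl: "s \<longlonglongrightarrow> \<L> - Q v" by simp
  have le1: "Q v \<le> \<L>" using LIMSEQ_le_const[OF sl, of 0] s0 by auto
  define a where "a = Q v / \<L>"
  have a: "0 < a" "a \<le> 1" using Qv le1 \<L>_pos by (auto simp: a_def)
  have "(\<lambda>n. K (z (r n)) - K (w n)) \<longlonglongrightarrow> K v"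
    unfolding w_def by (rule K_splitting[where u="\<lambda>n. z (r n)", OF hz QzB hv lim])
  from tendsto_diff[OF Klim this] have Kw: "(\<lambda>n. K (w n)) \<longlonglongrightarrow> \<L> - K v" by simp
  have "K (w n) \<le> \<L> * (s n / \<L>) powr (q / 2)" for n
  proof -
    have "(Q (w n) / \<L>) powr (q / 2) \<le> (s n / \<L>) powr (q / 2)"
      using ws[of n] Q_nonneg[of "w n"] \<L>_pos q by (intro powr_mono2 divide_right_mono) auto
    then show ?thesis using K_le[OF hw[of n]] \<L>_pos mult_left_mono[of _ _ \<L>] by (meson less_imp_le order_trans)
  qed
  moreover have "(\<lambda>n. \<L> * (s n / \<L>) powr (q / 2)) \<longlonglongrightarrow> \<L> * ((\<L> - Q v) / \<L>) powr (q / 2)"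
    by (intro tendsto_intros tendsto_powr' sl) (use \<L>_pos q s0 in auto)
  ultimately have "\<L> - K v \<le> \<L> * ((\<L> - Q v) / \<L>) powr (q / 2)" by (intro LIMSEQ_le[OF Kw]) auto
  also have "(\<L> - Q v) / \<L> = 1 - a" using \<L>_pos by (simp add: a_def diff_divide_distrib)
  finally have up: "\<L> - K v \<le> \<L> * (1 - a) powr (q / 2)" .
  have Kv: "K v \<le> \<L> * a powr (q / 2)" using K_le[OF hv] by (simp add: a_def)
  have "\<L> * 1 \<le> \<L> * (a powr (q / 2) + (1 - a) powr (q / 2))" using up Kv by (simp add: distrib_left)
  then have "1 \<le> a powr (q / 2) + (1 - a) powr (q / 2)" using \<L>_pos by (rule mult_left_le_imp_le)
  then have a1: "a = 1" by (intro powr_split_eq_1[OF a]) (use q in auto)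
  have QL: "Q v = \<L>" using a1 \<L>_pos by (simp add: a_def)
  have KL: "K v = \<L>" using up Kv unfolding a1 by simp
  \<comment> \<open>Once no mass is left for the remainders, their majorant \<open>s\<close> tends
    to 0; weak convergence has become strong.\<close>
  have "s \<longlonglongrightarrow> 0" using sl unfolding QL by simp
  then have "(\<lambda>n. Q (w n)) \<longlonglongrightarrow> 0"
    by (rule Lim_null_comparison[rotated]) (use ws Q_nonneg in simp)
  then have "(\<lambda>n. Q (\<lambda>x. u (r n + N) (x + y (r n)) - v x)) \<longlonglongrightarrow> 0" unfolding w_def z_def .
  then show ?thesis by (intro that[of "\<lambda>n. r n + N" v "\<lambda>n. y (r n)"] r' hv QL KL)
qed

section \<open>First variation of K and the Euler-Lagrange equation\<close>

lemma powr_q_integrable: assumes "H12 u" shows "integrable lborel (\<lambda>x. \<bar>u x\<bar> powr q)"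
  using sobolev_embedding[OF q tbound_nonneg[OF H12_tbound[OF assms order_refl]]] H12_tbound[OF assms order_refl] by metis

text \<open>One majorant for both the pairing with f(u) and the difference quotients of K. All
  factors are at most g = |y| + (T + 1) |w|, and g is at most twice its larger summand; T + 1
  instead of T ensures that g also dominates |w| alone.\<close>

lemma dominating_powr:
  fixes y t T w :: real
  assumes "\<bar>t\<bar> \<le> T"
  shows "Cf * (\<bar>y\<bar> + \<bar>t * w\<bar>) powr p * \<bar>w\<bar> \<le> Cf * (\<bar>2 * y\<bar> powr q + \<bar>2 * (T + 1) * w\<bar> powr q)"
proof -
  have T: "T \<ge> 0" using assms by linarith
  define g where "g = \<bar>y\<bar> + (T + 1) * \<bar>w\<bar>"
  have g0: "g \<ge> 0" using T by (simp add: g_def)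
  have 1: "\<bar>y\<bar> + \<bar>t * w\<bar> \<le> g"
    unfolding g_def abs_mult using assms by (intro add_left_mono mult_right_mono) auto
  have 2: "\<bar>w\<bar> \<le> g" unfolding g_def using T by (simp add: distrib_right add_increasing)
  have "(\<bar>y\<bar> + \<bar>t * w\<bar>) powr p * \<bar>w\<bar> \<le> g powr p * g"
    using 1 2 p g0 by (intro mult_mono powr_mono2) auto
  also have "\<dots> = g powr q" using g0 by (cases "g = 0") (simp_all add: q_def powr_add)
  also have "\<dots> \<le> \<bar>2 * y\<bar> powr q + \<bar>2 * (T + 1) * w\<bar> powr q"
  proof (cases "\<bar>y\<bar> \<ge> (T + 1) * \<bar>w\<bar>")
    case True
    then have "g powr q \<le> \<bar>2 * y\<bar> powr q" using g0 q by (intro powr_mono2) (auto simp: g_def)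
    then show ?thesis by (simp add: add_increasing2)
  next
    case False
    moreover have "\<bar>2 * (T + 1) * w\<bar> = 2 * ((T + 1) * \<bar>w\<bar>)" using T by (simp add: abs_mult)
    ultimately have "g \<le> \<bar>2 * (T + 1) * w\<bar>" unfolding g_def by linarith
    then have "g powr q \<le> \<bar>2 * (T + 1) * w\<bar> powr q" using g0 q by (intro powr_mono2) auto
    then show ?thesis by (simp add: add_increasing)
  qed
  finally show ?thesis using Cf_nonneg by (simp add: mult.assoc mult_left_mono)
qed

lemma dominating_integrable:
  assumes "H12 u" "H12 v"
  shows "integrable lborel (\<lambda>x. Cf * (\<bar>2 * u x\<bar> powr q + \<bar>2 * (T + 1) * v x\<bar> powr q))"
  using powr_q_integrable[OF H12_scale(1)[OF assms(1), of 2]] powr_q_integrable[OF H12_scale(1)[OF assms(2), of "2 * (T + 1)"]]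
  by (intro integrable_mult_right Bochner_Integration.integrable_add) auto

lemma f_integrable:
  assumes "H12 u" "H12 v" shows "integrable lborel (\<lambda>x. f (u x) * v x)"
proof (rule Bochner_Integration.integrable_bound[OF dominating_integrable[OF assms, of 0]])
  have [measurable]: "u \<in> borel_measurable borel" "v \<in> borel_measurable borel"
    using assms H12_sqint sqint_meas by auto
  show "(\<lambda>x. f (u x) * v x) \<in> borel_measurable lborel" by measurable
  show "AE x in lborel. norm (f (u x) * v x) \<le> norm (Cf * (\<bar>2 * u x\<bar> powr q + \<bar>2 * (0 + 1) * v x\<bar> powr q))"
  proof (rule AE_I2)
    fix x
    have "norm (f (u x) * v x) \<le> Cf * (\<bar>u x\<bar> + \<bar>0 * v x\<bar>) powr p * \<bar>v x\<bar>"
      using f_bound[of "u x"] by (simp add: abs_mult mult_right_mono)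
    also have "\<dots> \<le> Cf * (\<bar>2 * u x\<bar> powr q + \<bar>2 * (0 + 1) * v x\<bar> powr q)" by (rule dominating_powr) simp
    finally show "norm (f (u x) * v x) \<le> norm (Cf * (\<bar>2 * u x\<bar> powr q + \<bar>2 * (0 + 1) * v x\<bar> powr q))" by simp
  qed
qed

lemma K_has_derivative:
  assumes u: "H12 u" and v: "H12 v"
  shows "((\<lambda>t. K (\<lambda>x. u x + t * v x)) has_real_derivative - q * (LBINT x. f (u x) * v x)) (at 0)"
proof -
  have [measurable]: "u \<in> borel_measurable borel" "v \<in> borel_measurable borel"
    using u v H12_sqint sqint_meas by auto
  have Fi: "integrable lborel (\<lambda>x. F (u x + t * v x))" for t
    using F_integrable[OF H12_tbound[OF H12_lin(1)[OF u v, of 1 t] order_refl]] by simp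
  have "((\<lambda>t. LBINT x. F (u x + t * v x)) has_real_derivative (LBINT x. f (u x) * v x)) (at 0)"
    unfolding has_field_derivative_iff tendsto_at_iff_sequentially
  proof (intro allI impI)
    \<comment> \<open>Passing to sequences makes dominated convergence applicable; a convergent
      sequence of parameters is bounded by some \<open>T\<close>, which fixes the majorant.\<close>
    fix X :: "nat \<Rightarrow> real" assume X: "\<forall>i. X i \<in> UNIV - {0}" "X \<longlonglongrightarrow> 0"
    have X0: "X i \<noteq> 0" for i using X by auto
    obtain T where T: "\<And>i. \<bar>X i\<bar> \<le> T" using convergent_real_bounded[OF tendsto_rabs[OF X(2)]] by blast
    have lim: "(\<lambda>i. LBINT x. (F (u x + X i * v x) - F (u x)) / X i) \<longlonglongrightarrow> (LBINT x. f (u x) * v x)"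
    proof (rule integral_dominated_convergence[OF _ _ dominating_integrable[OF u v, of T]])
      show "AE x in lborel. (\<lambda>i. (F (u x + X i * v x) - F (u x)) / X i) \<longlonglongrightarrow> f (u x) * v x"
      proof (rule AE_I2)
        fix x
        have "((\<lambda>t. F (u x + t * v x)) has_real_derivative f (u x + 0 * v x) * (0 + 1 * v x)) (at 0)"
          by (rule DERIV_chain2[OF F_anti]) (auto intro!: derivative_eq_intros)
        then have "((\<lambda>t. F (u x + t * v x)) has_real_derivative f (u x) * v x) (at 0)" by simp
        then show "(\<lambda>i. (F (u x + X i * v x) - F (u x)) / X i) \<longlonglongrightarrow> f (u x) * v x"
          unfolding has_field_derivative_iff tendsto_at_iff_sequentially using X by (auto simp: comp_def)
      qed
      show "AE x in lborel. norm ((F (u x + X i * v x) - F (u x)) / X i) \<le> Cf * (\<bar>2 * u x\<bar> powr q + \<bar>2 * (T + 1) * v x\<bar> powr q)" for i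
      proof (rule AE_I2)
        fix x
        have "norm ((F (u x + X i * v x) - F (u x)) / X i) = \<bar>F (u x + X i * v x) - F (u x)\<bar> / \<bar>X i\<bar>" by (simp add: abs_divide)
        also have "\<dots> \<le> (Cf * (\<bar>u x\<bar> + \<bar>X i * v x\<bar>) powr p * \<bar>X i * v x\<bar>) / \<bar>X i\<bar>"
          by (rule divide_right_mono[OF F_diff]) simp
        also have "\<dots> = Cf * (\<bar>u x\<bar> + \<bar>X i * v x\<bar>) powr p * \<bar>v x\<bar>" using X0[of i] by (simp add: abs_mult)
        also have "\<dots> \<le> Cf * (\<bar>2 * u x\<bar> powr q + \<bar>2 * (T + 1) * v x\<bar> powr q)" by (rule dominating_powr[OF T])
        finally show "norm ((F (u x + X i * v x) - F (u x)) / X i) \<le> Cf * (\<bar>2 * u x\<bar> powr q + \<bar>2 * (T + 1) * v x\<bar> powr q)" .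
      qed
    qed measurable
    have e: "(LBINT x. (F (u x + X i * v x) - F (u x)) / X i)
       = ((LBINT x. F (u x + X i * v x)) - (LBINT x. F (u x + 0 * v x))) / (X i - 0)" for i
      using Fi[of "X i"] Fi[of 0] by simp
    show "((\<lambda>y. ((LBINT x. F (u x + y * v x)) - (LBINT x. F (u x + 0 * v x))) / (y - 0)) \<circ> X)
        \<longlonglongrightarrow> (LBINT x. f (u x) * v x)"
      using lim unfolding e comp_def .
  qed
  then show ?thesis unfolding K_def by (rule DERIV_cmult)
qed

text \<open>Along the line v + t w the gap in \<open>K_le\<close> is nonnegative and vanishes at t =
  0, so its derivative there is 0. Because Q v = K v = \<open>\<L>\<close>, both parts of this
  derivative carry the same factor q, and no multiplier is left.\<close>

theorem Euler_Lagrange: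
  assumes v: "H12 v" "Q v = \<L>" "K v = \<L>" and w: "H12 w"
  shows "Bf v w + (LBINT x. f (v x) * w x) = 0"
proof -
  define h where "h t = \<L> * (Q (\<lambda>x. v x + t * w x) / \<L>) powr (q / 2) - K (\<lambda>x. v x + t * w x)" for t
  have Qt: "Q (\<lambda>x. v x + t * w x) = \<L> + 2 * t * Bf v w + t\<^sup>2 * Q w" for t
    using Q_lin[OF v(1) w, of 1 t] v(2) by simp
  have h0: "h 0 = 0" unfolding h_def Qt using v(3) \<L>_pos by simp
  have hp: "h t \<ge> 0" for t
    unfolding h_def using K_le[OF H12_lin(1)[OF v(1) w, of 1 t]] by simp
  have "((\<lambda>t. (\<L> + 2 * t * Bf v w + t\<^sup>2 * Q w) / \<L>) has_real_derivative 2 * Bf v w / \<L>) (at 0)"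
    using \<L>_pos by (auto intro!: derivative_eq_intros)
  from DERIV_fun_powr[OF this, of "q / 2"]
  have "((\<lambda>t. ((\<L> + 2 * t * Bf v w + t\<^sup>2 * Q w) / \<L>) powr (q / 2)) has_real_derivative q / 2 * (2 * Bf v w / \<L>)) (at 0)"
    using \<L>_pos by simp
  from DERIV_cmult[OF this, of \<L>]
  have "((\<lambda>t. \<L> * (Q (\<lambda>x. v x + t * w x) / \<L>) powr (q / 2)) has_real_derivative q * Bf v w) (at 0)"
    unfolding Qt using \<L>_pos by simp
  from DERIV_diff[OF this K_has_derivative[OF v(1) w]]
  have D: "(h has_real_derivative q * Bf v w + q * (LBINT x. f (v x) * w x)) (at 0)"
    unfolding h_def[abs_def] by simp
  have "q * Bf v w + q * (LBINT x. f (v x) * w x) = 0"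
    by (rule DERIV_local_min[OF D zero_less_one]) (simp add: h0 hp)
  then have "q * (Bf v w + (LBINT x. f (v x) * w x)) = 0" by (simp add: distrib_left)
  then show ?thesis using q by simp
qed

lemma minimizer_BO_solution:
  assumes v: "H12 v" "Q v = \<L>" "K v = \<L>" shows "BO_solution f b c v"
  unfolding BO_solution_def
proof (intro allI impI)
  fix \<phi> assume t: "test_fun \<phi>"
  note h = test_fun_H12(1)[OF t]
  have i: "integrable lborel (\<lambda>x. v x * \<phi> x)" using integrable_inner[OF H12_sqint[OF v(1)] H12_sqint[OF h]] by simp
  have "(LBINT x. (- c * v x + f (v x)) * \<phi> x) = (LBINT x. - c * (v x * \<phi> x) + f (v x) * \<phi> x)"
    by (simp add: algebra_simps)
  also have "\<dots> = - c * (LBINT x. v x * \<phi> x) + (LBINT x. f (v x) * \<phi> x)"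
    using i f_integrable[OF v(1) h] by simp
  finally show "(LBINT x. (- c * v x + f (v x)) * \<phi> x) - b * (LBINT x. hilbert v x * deriv \<phi> x) = 0"
    using Euler_Lagrange[OF v h] test_fun_H12(2)[OF t v(1)] by simp
qed

section \<open>Behaviour of the infimum as gamma tends to 0\<close>

lemma mval_ge: assumes "\<gamma> > 0" shows "m0 \<le> mval p F b c \<gamma>"
  unfolding mval_def
proof (rule cInf_greatest)
  show "{Ifun u b c \<gamma> / (Kfun p F u) powr (2 / (p + 1)) | u. u \<in> Xsp \<and> Kfun p F u > 0} \<noteq> {}"
    unfolding Kfun_eq using admissible by auto
  fix x assume "x \<in> {Ifun u b c \<gamma> / (Kfun p F u) powr (2 / (p + 1)) | u. u \<in> Xsp \<and> Kfun p F u > 0}"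
  then obtain u where u: "x = Ifun u b c \<gamma> / K u powr (2 / q)" "u \<in> Xsp" "K u > 0"
    unfolding Kfun_eq q_def[symmetric] by auto
  have "m0 \<le> Q u / K u powr (2 / q)" by (rule m0_le[OF u(2,3)])
  also have "\<dots> \<le> x" unfolding u(1) Ifun_eq[OF u(2)] using assms by (intro divide_right_mono) auto
  finally show "m0 \<le> x" .
qed

lemma mval_le:
  assumes "\<gamma> > 0" "u \<in> Xsp" "K u > 0" shows "mval p F b c \<gamma> \<le> (Q u + \<gamma> * (nrm (dinv u))\<^sup>2) / K u powr (2 / q)"
  unfolding mval_def
proof (rule cInf_lower)
  show "(Q u + \<gamma> * (nrm (dinv u))\<^sup>2) / K u powr (2 / q) \<in> {Ifun u b c \<gamma> / (Kfun p F u) powr (2 / (p + 1)) | u. u \<in> Xsp \<and> Kfun p F u > 0}"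
    unfolding Kfun_eq q_def[symmetric] using assms Ifun_eq[OF assms(2)] by (auto intro!: exI[of _ u])
  have "0 \<le> Ifun u b c \<gamma>" if "u \<in> Xsp" for u unfolding Ifun_eq[OF that] using assms Q_nonneg by simp
  then show "bdd_below {Ifun u b c \<gamma> / (Kfun p F u) powr (2 / (p + 1)) | u. u \<in> Xsp \<and> Kfun p F u > 0}"
    by (intro bdd_belowI[of _ 0]) (auto intro!: divide_nonneg_nonneg)
qed

text \<open>The lower bound is \<open>mval_ge\<close>. For the upper bound, fix a competitor that is
  nearly optimal for m0: it lies in \<open>Xsp\<close>, so its \<open>dinv\<close> term is a finite
  constant times \<open>\<gamma> n\<close> and disappears in the limit.\<close>

lemma mval_tendsto:
  assumes g: "\<And>n. \<gamma> n > 0" "\<gamma> \<longlonglongrightarrow> 0" shows "(\<lambda>n. mval p F b c (\<gamma> n)) \<longlonglongrightarrow> m0"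
proof (rule order_tendstoI)
  fix a assume "a < m0"
  then show "\<forall>\<^sub>F n in sequentially. a < mval p F b c (\<gamma> n)"
    using order_less_le_trans[OF _ mval_ge[OF g(1)]] by simp
next
  fix a assume "m0 < a"
  then obtain x where x: "x \<in> {Q u / K u powr (2 / q) | u. u \<in> Xsp \<and> K u > 0}" "x < a"
    unfolding m0_def using admissible
    by (subst (asm) cInf_less_iff) (auto intro!: bdd_belowI[of _ 0] divide_nonneg_nonneg Q_nonneg)
  then obtain u where u: "u \<in> Xsp" "K u > 0" "Q u / K u powr (2 / q) < a" by auto
  have "(\<lambda>n. (Q u + \<gamma> n * (nrm (dinv u))\<^sup>2) / K u powr (2 / q)) \<longlonglongrightarrow> (Q u + 0 * (nrm (dinv u))\<^sup>2) / K u powr (2 / q)"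
    using u(2) by (intro tendsto_intros g(2)) auto
  then have "\<forall>\<^sub>F n in sequentially. (Q u + \<gamma> n * (nrm (dinv u))\<^sup>2) / K u powr (2 / q) < a"
    by (rule order_tendstoD) (use u(3) in simp)
  then show "\<forall>\<^sub>F n in sequentially. mval p F b c (\<gamma> n) < a"
    by eventually_elim (use mval_le[OF g(1) u(1,2)] order_le_less_trans in blast)
qed

end

section \<open>Convergence in H^{1/2} and conclusion\<close>

context bo_problem
begin

lemma H12_tendsto:
  assumes h: "\<And>n. H12 (u n)" and lim: "(\<lambda>n. Q (u n)) \<longlonglongrightarrow> 0" shows "(\<lambda>n. H12_norm (u n)) \<longlonglongrightarrow> 0"
proof (rule Lim_null_comparison)
  show "\<forall>\<^sub>F n in sequentially. norm (H12_norm (u n)) \<le> sqrt (Q (u n) / min b (- c))"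
    using real_le_rsqrt[OF H12_norm_le[OF h]] by (simp add: H12_norm_def)
  have "(\<lambda>n. sqrt (Q (u n) / min b (- c))) \<longlonglongrightarrow> sqrt (0 / min b (- c))"
    using b c by (intro tendsto_intros lim) auto
  then show "(\<lambda>n. sqrt (Q (u n) / min b (- c))) \<longlonglongrightarrow> 0" by simp
qed

text \<open>\<open>hilbert\<close> of the zero function is a chosen representative and need not
  vanish pointwise, so its pairing is evaluated through the energy form, which is 0 by
  Cauchy-Schwarz. The zero function itself is obtained as the multiple 0 of
  \<open>u\<close>.\<close>

lemma zero_solution: assumes "H12 u" shows "H12 (\<lambda>x. 0)" "BO_solution f b c (\<lambda>x. 0)"
proof -
  have z: "H12 (\<lambda>x. 0)" "Q (\<lambda>x. 0) = 0" using H12_scale[OF assms, of 0] by auto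
  show "H12 (\<lambda>x. 0)" by (rule z(1))
  show "BO_solution f b c (\<lambda>x. 0)"
    unfolding BO_solution_def
  proof (intro allI impI)
    fix \<phi> assume t: "test_fun \<phi>"
    have "Bf (\<lambda>x. 0) \<phi> = 0" using Bf_bound[OF z(1) test_fun_H12(1)[OF t]] z(2) by simp
    then show "(LBINT x. (- c * 0 + f 0) * \<phi> x) - b * (LBINT x. hilbert (\<lambda>x. 0) x * deriv \<phi> x) = 0"
      using test_fun_H12(2)[OF t z(1)] f_0 by simp
  qed
qed

text \<open>If \<open>K\<close> is nowhere positive on the admissible class, the sets \<open>G\<close> contain only null functions.\<close>
theorem ground_state_limit:
  fixes \<psi> :: "nat \<Rightarrow> real \<Rightarrow> real"
  assumes g: "\<And>n. \<gamma> n > 0" "\<gamma> \<longlonglongrightarrow> 0" and \<psi>: "\<And>n. \<psi> n \<in> Gset p F b c (\<gamma> n)"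
  shows "\<exists>r :: nat \<Rightarrow> nat. \<exists>y :: nat \<Rightarrow> real. \<exists>\<Psi>. strict_mono r \<and> H12 \<Psi> \<and> BO_solution f b c \<Psi> \<and>
           (\<lambda>n. H12_norm (\<lambda>x. \<psi> (r n) (x + y n) - \<Psi> x)) \<longlonglongrightarrow> 0"
proof -
  have X: "\<psi> n \<in> Xsp" and KI: "K (\<psi> n) = Ifun (\<psi> n) b c (\<gamma> n)"
    and Im: "Ifun (\<psi> n) b c (\<gamma> n) = (mval p F b c (\<gamma> n)) powr ((p + 1) / (p - 1))" for n
    using \<psi>[of n] unfolding Gset_def Kfun_eq by auto
  have h: "H12 (\<psi> n)" for n using X by (simp add: Xsp_def)
  have QK: "Q (\<psi> n) \<le> K (\<psi> n)" for n unfolding KI Ifun_eq[OF X] using g(1)[of n] by simp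
  show ?thesis
  proof (cases "\<exists>u\<in>Xsp. K u > 0")
    case False
    then have "K (\<psi> n) \<le> 0" for n using X not_le by blast
    then have Q0: "Q (\<psi> n) = 0" for n using QK[of n] Q_nonneg[of "\<psi> n"] by (meson order_antisym order_trans)
    have "(\<lambda>n. H12_norm (\<psi> n)) \<longlonglongrightarrow> 0" by (rule H12_tendsto[OF h]) (simp add: Q0)
    then show ?thesis
      using zero_solution[OF h]
      by (intro exI[of _ "\<lambda>n. n"] exI[of _ "\<lambda>n. 0"] exI[of _ "\<lambda>x. 0"]) (auto simp: strict_mono_def)
  next
    case True
    interpret bo_minimization b c p f F by unfold_locales (rule True)
    \<comment> \<open>The normalization in \<open>Gset\<close> ties K to a power of the infimum, and
      (p + 1) / (p - 1) is q / (q - 2), the exponent in \<open>\<L>\<close>.\<close>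
    have "(\<lambda>n. K (\<psi> n)) \<longlonglongrightarrow> m0 powr ((p + 1) / (p - 1))"
      unfolding KI Im using m0_pos by (intro tendsto_intros mval_tendsto[OF g]) auto
    then have Kl: "(\<lambda>n. K (\<psi> n)) \<longlonglongrightarrow> \<L>" by (simp add: \<L>_def q_def)
    obtain r y v where r: "strict_mono (r :: nat \<Rightarrow> nat)" and v: "H12 v" "Q v = \<L>" "K v = \<L>"
      and lim: "(\<lambda>n. Q (\<lambda>x. \<psi> (r n) (x + y n) - v x)) \<longlonglongrightarrow> 0"
      using minimizing_sequence_compact[OF h Kl QK] by blast
    have "H12 (\<lambda>x. \<psi> (r n) (x + y n) - v x)" for n by (rule H12_diff(1)[OF H12_translate(1)[OF h] v(1)])
    from H12_tendsto[OF this lim] show ?thesis using r v(1) minimizer_BO_solution[OF v] by blast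
  qed
qed

end

theorem theorem5p1:
  fixes p \<beta> c :: real and f F :: "real \<Rightarrow> real"
    and \<gamma> :: "nat \<Rightarrow> real" and \<psi> :: "nat \<Rightarrow> real \<Rightarrow> real"
  assumes p: "p > 1"
    and f_C2: "\<exists>f' f''. (\<forall>s. (f has_real_derivative f' s) (at s)) \<and>
                 (\<forall>s. (f' has_real_derivative f'' s) (at s)) \<and> continuous_on UNIV f''"
    and f_hom: "\<And>l s. l > 0 \<Longrightarrow> f (l * s) = l powr p * f s"
    and F_anti: "\<And>s. (F has_real_derivative f s) (at s)" and F0: "F 0 = 0"
    and F_neg: "\<exists>s0. F s0 < 0"
    and \<beta>: "\<beta> > 0" and c: "c < 0"
    and \<gamma>_pos: "\<And>n. \<gamma> n > 0" and \<gamma>_lim: "\<gamma> \<longlonglongrightarrow> 0"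
    and \<psi>_in: "\<And>n. \<psi> n \<in> Gset p F \<beta> c (\<gamma> n)"
  shows "\<exists>r :: nat \<Rightarrow> nat. \<exists>y :: nat \<Rightarrow> real. \<exists>\<Psi>. strict_mono r \<and> H12 \<Psi> \<and> BO_solution f \<beta> c \<Psi> \<and>
           (\<lambda>n. H12_norm (\<lambda>x. \<psi> (r n) (x + y n) - \<Psi> x)) \<longlonglongrightarrow> 0"
proof -
  obtain f' where f': "\<And>s. (f has_real_derivative f' s) (at s)" using f_C2 by blast
  have "continuous_on UNIV f" using f' by (meson DERIV_continuous_on has_field_derivative_at_within)
  then interpret bo_problem \<beta> c p f F
    by unfold_locales (use \<beta> c p f_hom F_anti F0 in auto)
  show ?thesis by (rule ground_state_limit[OF \<gamma>_pos \<gamma>_lim \<psi>_in])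
qed

end
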